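(* Let $\mathscr G$ be an ample groupoid with compact unit space. Suppose that $K\mathscr G$ is stably finite for some commutative ring $K$ with unit. Then there exists a normalized invariant mean on $\mathscr G^{(0)}$. Consequently, $\mathbb C\mathscr G$ admits a $\Gamma_c(\mathscr G)$-contractive normalized trace, and if $\mathscr G$ is Hausdorff, then the reduced $C^*$-algebra $C^*_r(\mathscr G)$ admits a tracial state.
   Context: Rings are not assumed unital. A ring $R$ is Dedekind finite if for every idempotent $e\in R$ and all $u,v\in eRe$, $uv=e$ implies $vu=e$; $R$ is stably finite if $M_n(R)$ is Dedekind finite for all $n\geq 1$. A groupoid $\mathscr G$ is identified with its set of arrows, objects being identified with identity arrows; $\mathscr G^{(0)}$ is the unit space, $\boldsymbol d(\gamma)=\gamma^{-1}\gamma$, $\boldsymbol r(\gamma)=\gamma\gamma^{-1}$. A topological groupoid is étale if $\boldsymbol d$ is a local homeomorphism. An ample groupoid is an étale groupoid whose unit space is Hausdorff with a basis of compact open sets ($\mathscr G$ itself need not be Hausdorff). A bisection is an open subset $U\subseteq\mathscr G$ on which $\boldsymbol d$ and $\boldsymbol r$ are injective; $\Gamma_c(\mathscr G)$ is the set of compact open bisections, an inverse semigroup under setwise product and inverse, and $\Gamma_c(\mathscr G^{(0)})$ is the set of compact open subsets of $\mathscr G^{(0)}$. For a commutative ring $K$ with unit, $K\mathscr G$ is the $K$-span, inside the functions $\mathscr G\to K$, of the indicator functions $1_U$, $U\in\Gamma_c(\mathscr G)$, with convolution product $(f\ast g)(\gamma)=\sum_{\alpha\beta=\gamma}f(\alpha)g(\beta)$.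 On $\mathbb C\mathscr G$ there is the involution $f^\ast(\gamma)=\overline{f(\gamma^{-1})}$. A mean on $\mathscr G^{(0)}$ is a map $\mu\colon\Gamma_c(\mathscr G^{(0)})\to[0,\infty)$ with $\mu(U\cup V)=\mu(U)+\mu(V)$ whenever $U\cap V=\emptyset$; it is invariant if $\mu(U^{-1}U)=\mu(UU^{-1})$ for all $U\in\Gamma_c(\mathscr G)$, and (for compact $\mathscr G^{(0)}$) normalized if $\mu(\mathscr G^{(0)})=1$. A trace on a complex $\ast$-algebra $A$ is a linear functional $\tau\colon A\to\mathbb C$ with $\tau(ab)=\tau(ba)$, $\tau(a^\ast)=\overline{\tau(a)}$ and $\tau(aa^\ast)\geq 0$ for all $a,b\in A$; for unital $A$ it is normalized if $\tau(1)=1$. A trace $\tau$ on $\mathbb C\mathscr G$ is $\Gamma_c(\mathscr G)$-contractive if $\tau((f\ast 1_U)\ast(f\ast 1_U)^\ast)\leq\tau(f\ast f^\ast)$ for all $f\in\mathbb C\mathscr G$ and $U\in\Gamma_c(\mathscr G)$. *)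

theory Defs
  imports "HOL-Analysis.Analysis" "HOL-Algebra.Module" "HOL-Library.Complex_Order"
begin

section \<open>Dedekind finite and stably finite rings\<close>

text \<open>
  Rings are HOL-Algebra records. The field \<^term>\<open>one\<close> plays no role in the definitions of this
  section, so they apply verbatim to rings without unit.
\<close>

definition corner :: "('a, 'm) ring_scheme \<Rightarrow> 'a \<Rightarrow> 'a set"
  where "corner R e = {e \<otimes>\<^bsub>R\<^esub> a \<otimes>\<^bsub>R\<^esub> e | a. a \<in> carrier R}"

definition dedekind_finite :: "('a, 'm) ring_scheme \<Rightarrow> bool"
  where "dedekind_finite R \<longleftrightarrow>
    (\<forall>e\<in>carrier R. e \<otimes>\<^bsub>R\<^esub> e = e \<longrightarrow>
      (\<forall>u\<in>corner R e. \<forall>v\<in>corner R e. u \<otimes>\<^bsub>R\<^esub> v = e \<longrightarrow> v \<otimes>\<^bsub>R\<^esub> u = e))"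

text \<open>
  An \<open>n \<times> n\<close> matrix over \<open>R\<close> is a function on index pairs that is \<^term>\<open>undefined\<close> outside
  \<open>{..<n} \<times> {..<n}\<close>, so that equality in the carrier is equality of entries.
\<close>

definition mat_ring :: "nat \<Rightarrow> ('a, 'm) ring_scheme \<Rightarrow> (nat \<times> nat \<Rightarrow> 'a) ring"
  where "mat_ring n R =
    \<lparr> carrier = ({..<n} \<times> {..<n}) \<rightarrow>\<^sub>E carrier R,
      mult = (\<lambda>A B. \<lambda>(i, j)\<in>{..<n} \<times> {..<n}. \<Oplus>\<^bsub>R\<^esub>k\<in>{..<n}. A (i, k) \<otimes>\<^bsub>R\<^esub> B (k, j)),
      one = (\<lambda>(i, j)\<in>{..<n} \<times> {..<n}. if i = j then \<one>\<^bsub>R\<^esub> else \<zero>\<^bsub>R\<^esub>),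
      zero = (\<lambda>(i, j)\<in>{..<n} \<times> {..<n}. \<zero>\<^bsub>R\<^esub>),
      add = (\<lambda>A B. \<lambda>(i, j)\<in>{..<n} \<times> {..<n}. A (i, j) \<oplus>\<^bsub>R\<^esub> B (i, j)) \<rparr>"

definition stably_finite :: "('a, 'm) ring_scheme \<Rightarrow> bool"
  where "stably_finite R \<longleftrightarrow> (\<forall>n\<ge>1. dedekind_finite (mat_ring n R))"


section \<open>Ample groupoids\<close>

text \<open>
  The arrows of a groupoid are all elements of a type, and its topology is that of the type class
  \<^class>\<open>topological_space\<close>; in particular a groupoid is nonempty. The product is a total
  function whose values at non-composable pairs are irrelevant.
\<close>

record 'g groupoid_data =
  gmul :: "'g \<Rightarrow> 'g \<Rightarrow> 'g" (infixl \<open>\<cdot>\<index>\<close> 70)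
  ginv :: "'g \<Rightarrow> 'g"

definition src :: "'g groupoid_data \<Rightarrow> 'g \<Rightarrow> 'g"
  where "src G \<gamma> = ginv G \<gamma> \<cdot>\<^bsub>G\<^esub> \<gamma>"

definition rng :: "'g groupoid_data \<Rightarrow> 'g \<Rightarrow> 'g"
  where "rng G \<gamma> = \<gamma> \<cdot>\<^bsub>G\<^esub> ginv G \<gamma>"

definition composable :: "'g groupoid_data \<Rightarrow> ('g \<times> 'g) set"
  where "composable G = {(\<alpha>, \<beta>). src G \<alpha> = rng G \<beta>}"

definition units :: "'g groupoid_data \<Rightarrow> 'g set"
  where "units G = range (src G)"

locale groupoid =
  fixes G :: "'g groupoid_data" (structure)
  assumes src_inv: "src G (ginv G \<gamma>) = rng G \<gamma>"
    and rng_inv: "rng G (ginv G \<gamma>) = src G \<gamma>"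
    and src_mul: "(\<alpha>, \<beta>) \<in> composable G \<Longrightarrow> src G (\<alpha> \<cdot> \<beta>) = src G \<beta>"
    and rng_mul: "(\<alpha>, \<beta>) \<in> composable G \<Longrightarrow> rng G (\<alpha> \<cdot> \<beta>) = rng G \<alpha>"
    and mul_src: "\<gamma> \<cdot> src G \<gamma> = \<gamma>"
    and rng_mul_self: "rng G \<gamma> \<cdot> \<gamma> = \<gamma>"
    and mul_assoc: "(\<alpha>, \<beta>) \<in> composable G \<Longrightarrow> (\<beta>, \<gamma>) \<in> composable G \<Longrightarrow>
      (\<alpha> \<cdot> \<beta>) \<cdot> \<gamma> = \<alpha> \<cdot> (\<beta> \<cdot> \<gamma>)"

locale topological_groupoid = groupoid G
  for G :: "'g::topological_space groupoid_data" (structure) +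
  assumes continuous_mul: "continuous_on (composable G) (\<lambda>(\<alpha>, \<beta>). \<alpha> \<cdot> \<beta>)"
    and continuous_inv: "continuous_on UNIV (ginv G)"

text \<open>
  The source map is a local homeomorphism onto the unit space, which carries the subspace topology.
\<close>

locale etale_groupoid = topological_groupoid G
  for G :: "'g::topological_space groupoid_data" (structure) +
  assumes src_local_homeomorphism:
    "\<exists>U. open U \<and> \<gamma> \<in> U \<and> openin (top_of_set (units G)) (src G ` U) \<and>
      (\<exists>h. homeomorphism U (src G ` U) (src G) h)"

definition compact_open_units :: "'g::topological_space groupoid_data \<Rightarrow> 'g set set"
  where "compact_open_units G = {U. openin (top_of_set (units G)) U \<and> compact U}"

locale ample_groupoid = etale_groupoid G
  for G :: "'g::topological_space groupoid_data" (structure) +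
  assumes Hausdorff_units: "Hausdorff_space (top_of_set (units G))"
    and compact_open_basis: "openin (top_of_set (units G)) W \<Longrightarrow> x \<in> W \<Longrightarrow>
      \<exists>U\<in>compact_open_units G. x \<in> U \<and> U \<subseteq> W"

definition compact_open_bisections :: "'g::topological_space groupoid_data \<Rightarrow> 'g set set"
  where "compact_open_bisections G =
    {U. open U \<and> compact U \<and> inj_on (src G) U \<and> inj_on (rng G) U}"

definition set_mul :: "'g groupoid_data \<Rightarrow> 'g set \<Rightarrow> 'g set \<Rightarrow> 'g set"
  where "set_mul G U V = {\<alpha> \<cdot>\<^bsub>G\<^esub> \<beta> | \<alpha> \<beta>. \<alpha> \<in> U \<and> \<beta> \<in> V \<and> (\<alpha>, \<beta>) \<in> composable G}"

definition set_inv :: "'g groupoid_data \<Rightarrow> 'g set \<Rightarrow> 'g set"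
  where "set_inv G U = ginv G ` U"


section \<open>Invariant means\<close>

definition mean :: "'g::topological_space groupoid_data \<Rightarrow> ('g set \<Rightarrow> real) \<Rightarrow> bool"
  where "mean G \<mu> \<longleftrightarrow>
    (\<forall>U\<in>compact_open_units G. 0 \<le> \<mu> U) \<and>
    (\<forall>U\<in>compact_open_units G. \<forall>V\<in>compact_open_units G.
      U \<inter> V = {} \<longrightarrow> \<mu> (U \<union> V) = \<mu> U + \<mu> V)"

definition invariant_mean :: "'g::topological_space groupoid_data \<Rightarrow> ('g set \<Rightarrow> real) \<Rightarrow> bool"
  where "invariant_mean G \<mu> \<longleftrightarrow> mean G \<mu> \<and>
    (\<forall>U\<in>compact_open_bisections G.
      \<mu> (set_mul G (set_inv G U) U) = \<mu> (set_mul G U (set_inv G U)))"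

definition normalized_mean :: "'g::topological_space groupoid_data \<Rightarrow> ('g set \<Rightarrow> real) \<Rightarrow> bool"
  where "normalized_mean G \<mu> \<longleftrightarrow> \<mu> (units G) = 1"


section \<open>Groupoid algebras\<close>

text \<open>
  The sum ranges over the nonzero terms only, because \<^const>\<open>sum\<close> over an infinite index set is
  \<open>0\<close>. Wherever convolution is used below, for each \<open>\<gamma>\<close> only finitely many terms are nonzero.
\<close>

definition convolution ::
    "'g groupoid_data \<Rightarrow> ('g \<Rightarrow> 'k::comm_ring_1) \<Rightarrow> ('g \<Rightarrow> 'k) \<Rightarrow> 'g \<Rightarrow> 'k"
  where "convolution G f g \<gamma> =
    (\<Sum>(\<alpha>, \<beta>) | (\<alpha>, \<beta>) \<in> composable G \<and> \<alpha> \<cdot>\<^bsub>G\<^esub> \<beta> = \<gamma> \<and> f \<alpha> * g \<beta> \<noteq> 0. f \<alpha> * g \<beta>)"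

definition groupoid_functions ::
    "'g::topological_space groupoid_data \<Rightarrow> ('g \<Rightarrow> 'k::comm_ring_1) set"
  where "groupoid_functions G =
    {\<lambda>\<gamma>. \<Sum>U\<in>F. c U * indicator U \<gamma> | F c. finite F \<and> F \<subseteq> compact_open_bisections G}"

text \<open>
  The unit \<open>1\<close> recorded here belongs to the carrier, and is then a unit for convolution, when the
  unit space is compact.
\<close>

definition groupoid_algebra ::
    "'g::topological_space groupoid_data \<Rightarrow> ('g \<Rightarrow> 'k::comm_ring_1) ring"
  where "groupoid_algebra G =
    \<lparr> carrier = groupoid_functions G,
      mult = convolution G,
      one = indicator (units G),
      zero = (\<lambda>\<gamma>. 0),
      add = (\<lambda>f g \<gamma>. f \<gamma> + g \<gamma>) \<rparr>"

record 'a star_algebra = "(complex, 'a) module" +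
  star :: "'a \<Rightarrow> 'a"

definition complex_groupoid_algebra ::
    "'g::topological_space groupoid_data \<Rightarrow> ('g \<Rightarrow> complex) star_algebra"
  where "complex_groupoid_algebra G =
    ring.extend (groupoid_algebra G)
      \<lparr> smult = (\<lambda>c f \<gamma>. c * f \<gamma>), star = (\<lambda>f \<gamma>. cnj (f (ginv G \<gamma>))) \<rparr>"


section \<open>Traces and tracial states\<close>

text \<open>
  Inequalities between complex numbers are those of Complex_Order; in particular \<open>0 \<le> z\<close> says that
  \<open>z\<close> is real and nonnegative.
\<close>

definition linear_functional :: "'a star_algebra \<Rightarrow> ('a \<Rightarrow> complex) \<Rightarrow> bool"
  where "linear_functional A \<tau> \<longleftrightarrow>
    (\<forall>a\<in>carrier A. \<forall>b\<in>carrier A. \<tau> (a \<oplus>\<^bsub>A\<^esub> b) = \<tau> a + \<tau> b) \<and>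
    (\<forall>c. \<forall>a\<in>carrier A. \<tau> (c \<odot>\<^bsub>A\<^esub> a) = c * \<tau> a)"

definition trace :: "'a star_algebra \<Rightarrow> ('a \<Rightarrow> complex) \<Rightarrow> bool"
  where "trace A \<tau> \<longleftrightarrow> linear_functional A \<tau> \<and>
    (\<forall>a\<in>carrier A. \<forall>b\<in>carrier A. \<tau> (a \<otimes>\<^bsub>A\<^esub> b) = \<tau> (b \<otimes>\<^bsub>A\<^esub> a)) \<and>
    (\<forall>a\<in>carrier A. \<tau> (star A a) = cnj (\<tau> a)) \<and>
    (\<forall>a\<in>carrier A. 0 \<le> \<tau> (a \<otimes>\<^bsub>A\<^esub> star A a))"

definition normalized :: "'a star_algebra \<Rightarrow> ('a \<Rightarrow> complex) \<Rightarrow> bool"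
  where "normalized A \<tau> \<longleftrightarrow> \<tau> \<one>\<^bsub>A\<^esub> = 1"

definition contractive_trace ::
    "'g::topological_space groupoid_data \<Rightarrow> (('g \<Rightarrow> complex) \<Rightarrow> complex) \<Rightarrow> bool"
  where "contractive_trace G \<tau> \<longleftrightarrow> (let A = complex_groupoid_algebra G in
    trace A \<tau> \<and>
    (\<forall>f\<in>carrier A. \<forall>U\<in>compact_open_bisections G.
      \<tau> ((f \<otimes>\<^bsub>A\<^esub> indicator U) \<otimes>\<^bsub>A\<^esub> star A (f \<otimes>\<^bsub>A\<^esub> indicator U)) \<le> \<tau> (f \<otimes>\<^bsub>A\<^esub> star A f)))"

text \<open>
  States of a unital C*-algebra: positive linear functionals with value \<open>1\<close> at the unit
  (continuity is then automatic).
\<close>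

definition state :: "'a star_algebra \<Rightarrow> ('a \<Rightarrow> complex) \<Rightarrow> bool"
  where "state A \<tau> \<longleftrightarrow> linear_functional A \<tau> \<and>
    (\<forall>a\<in>carrier A. 0 \<le> \<tau> (star A a \<otimes>\<^bsub>A\<^esub> a)) \<and> \<tau> \<one>\<^bsub>A\<^esub> = 1"

definition tracial_state :: "'a star_algebra \<Rightarrow> ('a \<Rightarrow> complex) \<Rightarrow> bool"
  where "tracial_state A \<tau> \<longleftrightarrow> state A \<tau> \<and>
    (\<forall>a\<in>carrier A. \<forall>b\<in>carrier A. \<tau> (a \<otimes>\<^bsub>A\<^esub> b) = \<tau> (b \<otimes>\<^bsub>A\<^esub> a))"


section \<open>The reduced C*-algebra of a Hausdorff groupoid\<close>

definition l2 :: "('g \<Rightarrow> complex) set"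
  where "l2 = {\<xi>. (\<lambda>\<gamma>. (cmod (\<xi> \<gamma>))\<^sup>2) summable_on UNIV}"

definition l2_norm :: "('g \<Rightarrow> complex) \<Rightarrow> real"
  where "l2_norm \<xi> = sqrt (\<Sum>\<^sub>\<infinity>\<gamma>. (cmod (\<xi> \<gamma>))\<^sup>2)"

definition l2_inner :: "('g \<Rightarrow> complex) \<Rightarrow> ('g \<Rightarrow> complex) \<Rightarrow> complex"
  where "l2_inner \<xi> \<eta> = (\<Sum>\<^sub>\<infinity>\<gamma>. \<xi> \<gamma> * cnj (\<eta> \<gamma>))"

text \<open>
  Bounded operators on \<open>l2\<close> are represented by functions that are \<^term>\<open>undefined\<close> outside \<open>l2\<close>.
\<close>

definition bounded_operators :: "(('g \<Rightarrow> complex) \<Rightarrow> 'g \<Rightarrow> complex) set"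
  where "bounded_operators = {T \<in> l2 \<rightarrow>\<^sub>E l2.
    (\<forall>\<xi>\<in>l2. \<forall>\<eta>\<in>l2. T (\<lambda>\<gamma>. \<xi> \<gamma> + \<eta> \<gamma>) = (\<lambda>\<gamma>. T \<xi> \<gamma> + T \<eta> \<gamma>)) \<and>
    (\<forall>c. \<forall>\<xi>\<in>l2. T (\<lambda>\<gamma>. c * \<xi> \<gamma>) = (\<lambda>\<gamma>. c * T \<xi> \<gamma>)) \<and>
    (\<exists>C. \<forall>\<xi>\<in>l2. l2_norm (T \<xi>) \<le> C * l2_norm \<xi>)}"

definition adjoint_operator ::
    "(('g \<Rightarrow> complex) \<Rightarrow> 'g \<Rightarrow> complex) \<Rightarrow> ('g \<Rightarrow> complex) \<Rightarrow> 'g \<Rightarrow> complex"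
  where "adjoint_operator T = (THE S. S \<in> bounded_operators \<and>
    (\<forall>\<xi>\<in>l2. \<forall>\<eta>\<in>l2. l2_inner (T \<xi>) \<eta> = l2_inner \<xi> (S \<eta>)))"

definition compactly_supported_functions :: "('g::topological_space \<Rightarrow> complex) set"
  where "compactly_supported_functions =
    {f. continuous_on UNIV f \<and> (\<exists>C. compact C \<and> (\<forall>\<gamma>. \<gamma> \<notin> C \<longrightarrow> f \<gamma> = 0))}"

text \<open>
  The regular representation of \<open>C\<^sub>c(G)\<close> on \<open>\<ell>\<^sup>2(G)\<close> is left convolution. As the source fibres \<open>G\<^sub>x\<close>
  partition \<open>G\<close>, it is the direct sum over all units \<open>x\<close> of the regular representations on
  \<open>\<ell>\<^sup>2(G\<^sub>x)\<close>. Its operator norm is thus the reduced norm on \<open>C\<^sub>c(G)\<close>, and the completion of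
  \<open>C\<^sub>c(G)\<close> is the closure of the image in the bounded operators.
\<close>

definition regular_rep ::
    "'g groupoid_data \<Rightarrow> ('g \<Rightarrow> complex) \<Rightarrow> ('g \<Rightarrow> complex) \<Rightarrow> 'g \<Rightarrow> complex"
  where "regular_rep G f = (\<lambda>\<xi>\<in>l2. convolution G f \<xi>)"

text \<open>The inequality in the carrier says that the operator norm of \<open>T - regular_rep G f\<close> is
  at most \<open>\<epsilon>\<close>.\<close>

definition reduced_cstar_algebra ::
    "'g::topological_space groupoid_data \<Rightarrow> (('g \<Rightarrow> complex) \<Rightarrow> 'g \<Rightarrow> complex) star_algebra"
  where "reduced_cstar_algebra G =
    \<lparr> carrier = {T \<in> bounded_operators. \<forall>\<epsilon>>0. \<exists>f\<in>compactly_supported_functions.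
        \<forall>\<xi>\<in>l2. l2_norm (\<lambda>\<gamma>. T \<xi> \<gamma> - regular_rep G f \<xi> \<gamma>) \<le> \<epsilon> * l2_norm \<xi>},
      mult = (\<lambda>S T. \<lambda>\<xi>\<in>l2. S (T \<xi>)),
      one = (\<lambda>\<xi>\<in>l2. \<xi>),
      zero = (\<lambda>\<xi>\<in>l2. \<lambda>\<gamma>. 0),
      add = (\<lambda>S T. \<lambda>\<xi>\<in>l2. \<lambda>\<gamma>. S \<xi> \<gamma> + T \<xi> \<gamma>),
      smult = (\<lambda>c T. \<lambda>\<xi>\<in>l2. \<lambda>\<gamma>. c * T \<xi> \<gamma>),
      star = adjoint_operator \<rparr>"

end

theory Submission
  imports Defs
begin

text \<open>
  If no invariant mean existed, the Hahn-Banach theorem would yield a combination of differences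
  \<open>1\<^bsub>s(U)\<^esub> - 1\<^bsub>r(U)\<^esub>\<close> (\<open>s\<close>, \<open>r\<close> the source and range maps) that is uniformly positive on the
  unit space \<open>X\<close>; rounding the coefficients gives compact open bisections \<open>U\<^sub>i\<close> with
  \<open>1 + \<Sum>\<^sub>i 1\<^bsub>r(U\<^sub>i)\<^esub> \<le> \<Sum>\<^sub>i 1\<^bsub>s(U\<^sub>i)\<^esub>\<close>. Then the diagonal idempotent with entries
  \<open>1\<^bsub>r(U\<^sub>i)\<^esub>\<close> and \<open>1\<^sub>X\<close> is equivalent to a subidempotent that misses \<open>1\<^sub>X\<close>, and some matrix ring
  over the groupoid algebra is not Dedekind finite.

  For non-Hausdorff \<open>G\<close> the restriction of an element of the groupoid algebra to \<open>X\<close> is a combination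
  of indicators of open sets that need not be compact. A second application of Hahn-Banach extends the
  mean to a positive functional on all bounded functions on \<open>X\<close> that is inner regular on open sets, and
  hence invariant under all open bisections. The trace is this functional
  applied to \<open>f\<close> restricted to \<open>X\<close>, and the tracial state is the functional applied to the diagonal
  matrix coefficients \<open>x \<mapsto> \<langle>T \<delta>\<^sub>x, \<delta>\<^sub>x\<rangle>\<close>.
\<close>

section \<open>Positive functionals on bounded functions\<close>

text \<open>The mean is produced from the start as a functional on all bounded functions, that is, a
  finitely additive integral. Both traces are integrals of fibre sums, so no question of
  measurability arises. Hahn-Banach enters in a form that prescribes upper bounds on a family of
  functions: a functional exists as soon as no nonnegative combination of the family contradicts
  them.

  The trace property is a symmetry of sums. At a unit x, the values of f * g and g * f are the sums
  of the single function k(\<alpha>) = f(\<alpha>) g(\<alpha>^-1) over the arrows with range x and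
  over those with source x. If k is the indicator of a bisection W, these sums are the indicators of
  the range and the source of W. For indicators f, g of compact open bisections U, V one gets W = U
  \<inter> V^-1, which may fail to be compact when G is not Hausdorff; hence the demand of
  invariance under all open bisections. For the reduced algebra k is merely continuous and is
  approximated uniformly by combinations of such indicators. Finitely many bisections cover its
  support, so the fibre sums have boundedly many terms and the error stays small.\<close>

definition sublinear_on :: "('a \<Rightarrow> real) set \<Rightarrow> (('a \<Rightarrow> real) \<Rightarrow> real) \<Rightarrow> bool"
  where "sublinear_on V p \<longleftrightarrow>
    (\<forall>f\<in>V. \<forall>g\<in>V. p (\<lambda>x. f x + g x) \<le> p f + p g) \<and>
    (\<forall>f\<in>V. \<forall>c>0. p (\<lambda>x. c * f x) \<le> c * p f)"

definition linear_on :: "('a \<Rightarrow> real) set \<Rightarrow> (('a \<Rightarrow> real) \<Rightarrow> real) \<Rightarrow> bool"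
  where "linear_on V \<phi> \<longleftrightarrow>
    (\<forall>f\<in>V. \<forall>g\<in>V. \<phi> (\<lambda>x. f x + g x) = \<phi> f + \<phi> g) \<and>
    (\<forall>f\<in>V. \<forall>c. \<phi> (\<lambda>x. c * f x) = c * \<phi> f)"

context
  fixes V :: "('a \<Rightarrow> real) set"
  assumes V_add: "\<And>f g. f \<in> V \<Longrightarrow> g \<in> V \<Longrightarrow> (\<lambda>x. f x + g x) \<in> V"
    and V_scale: "\<And>f c. f \<in> V \<Longrightarrow> (\<lambda>x. c * f x) \<in> V"
begin

text \<open>The inequality for c and for 1/c together give equality, so for every infimum below only
  one direction has to be checked. For c = 0, doubling the zero function gives p 0 = 2 p 0.\<close>

lemma sublinear_on_scale:
  assumes p: "sublinear_on V p" and f: "f \<in> V" and c: "0 \<le> c"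
  shows "p (\<lambda>x. c * f x) = c * p f"
proof -
  have pos: "p (\<lambda>x. c * g x) = c * p g" if "c > 0" "g \<in> V" for c g
  proof (rule antisym)
    show "p (\<lambda>x. c * g x) \<le> c * p g"
      using p that by (simp add: sublinear_on_def)
    have "\<forall>f\<in>V. \<forall>c>0. p (\<lambda>x. c * f x) \<le> c * p f"
      using p by (simp add: sublinear_on_def)
    from this[rule_format, OF V_scale[OF that(2), of c], of "1 / c"]
    have "p (\<lambda>x. (1 / c) * (c * g x)) \<le> (1 / c) * p (\<lambda>x. c * g x)"
      using that by simp
    then show "c * p g \<le> p (\<lambda>x. c * g x)"
      using that by (simp add: field_simps)
  qed
  show ?thesis
  proof (cases "c = 0")
    case True
    have "(\<lambda>x. 0) \<in> V" using V_scale[OF f, of 0] by simp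
    from pos[OF _ this, of 2] have "p (\<lambda>x. 0) = 0" by simp
    then show ?thesis using True by simp
  qed (use c f pos in auto)
qed

text \<open>Splitting 0 = f + (-f) bounds p f from below by a value of p at -f; this keeps the
  infimum over a chain finite.\<close>

lemma sublinear_on_lower_bound:
  assumes "sublinear_on V p" "f \<in> V"
  shows "- p (\<lambda>x. - f x) \<le> p f"
proof -
  have m: "(\<lambda>x. - f x) \<in> V" using V_scale[OF assms(2), of "-1"] by simp
  have "\<forall>f\<in>V. \<forall>g\<in>V. p (\<lambda>x. f x + g x) \<le> p f + p g"
    using assms by (simp add: sublinear_on_def)
  from this[rule_format, OF assms(2) m]
  have "p (\<lambda>x. f x + - f x) \<le> p f + p (\<lambda>x. - f x)" .
  moreover have "p (\<lambda>x. f x + - f x) = 0"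
    using sublinear_on_scale[OF assms, of 0] by simp
  ultimately show ?thesis by simp
qed

text \<open>For fixed y, the infimum q f of p (f + t y) - t p y over t \<ge> 0 is again sublinear
  and at most p. Minimality makes it equal to p, and the term t = 1 then yields p f + p y \<le> p (f
  + y).\<close>

lemma minimal_sublinear_on_is_linear:
  assumes p: "sublinear_on V p"
    and min: "\<And>q f. sublinear_on V q \<Longrightarrow> (\<And>g. g \<in> V \<Longrightarrow> q g \<le> p g) \<Longrightarrow> f \<in> V \<Longrightarrow> q f = p f"
  shows "linear_on V p"
proof -
  have sub: "p (\<lambda>x. f x + g x) \<le> p f + p g" if "f \<in> V" "g \<in> V" for f g
    using p that by (simp add: sublinear_on_def)
  have add: "p (\<lambda>x. f x + y x) = p f + p y" if f: "f \<in> V" and y: "y \<in> V" for f y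
  proof -
    define s where "s f t = p (\<lambda>x. f x + t * y x) - t * p y" for f t
    define q where "q f = (INF t\<in>{0..}. s f t)" for f
    have mem: "(\<lambda>x. f x + t * y x) \<in> V" if "f \<in> V" for f t
      using V_add[OF that V_scale[OF y]] .
    have bd: "- p (\<lambda>x. - f x) \<le> s f t" if f: "f \<in> V" and t: "0 \<le> t" for f t
    proof -
      have "(\<lambda>x. - f x) \<in> V" using V_scale[OF f, of "-1"] by simp
      from sub[OF mem[OF f, of t] this] show ?thesis
        using sublinear_on_scale[OF p y t] by (simp add: s_def)
    qed
    have bdd: "bdd_below (s f ` {0..})" if "f \<in> V" for f
      using bd[OF that] by (intro bdd_belowI2[of _ "- p (\<lambda>x. - f x)"]) auto
    have le: "q f \<le> s f t" if "f \<in> V" "0 \<le> t" for f t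
      unfolding q_def using bdd[OF that(1)] that(2) by (intro cINF_lower) auto
    have "sublinear_on V q"
      unfolding sublinear_on_def
    proof (intro conjI ballI allI impI)
      fix f g assume f: "f \<in> V" and g: "g \<in> V"
      have *: "q (\<lambda>x. f x + g x) \<le> s f t + s g u" if "0 \<le> t" "0 \<le> u" for t u
      proof -
        have "q (\<lambda>x. f x + g x) \<le> s (\<lambda>x. f x + g x) (t + u)"
          using le V_add f g that by simp
        also have "\<dots> = p (\<lambda>x. (f x + t * y x) + (g x + u * y x)) - (t + u) * p y"
          by (simp add: s_def algebra_simps)
        also have "\<dots> \<le> s f t + s g u"
          using sub[OF mem[OF f] mem[OF g], of t u] by (simp add: s_def algebra_simps)
        finally show ?thesis .
      qed
      have "q (\<lambda>x. f x + g x) - s f t \<le> q g" if "0 \<le> t" for t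
        unfolding q_def[of g] using *[OF that] by (intro cINF_greatest) (auto simp: algebra_simps)
      then have "q (\<lambda>x. f x + g x) - q g \<le> q f"
        unfolding q_def[of f] by (intro cINF_greatest) (auto simp: algebra_simps)
      then show "q (\<lambda>x. f x + g x) \<le> q f + q g" by simp
    next
      fix f and c :: real assume f: "f \<in> V" and c: "0 < c"
      have "q (\<lambda>x. c * f x) / c \<le> s f t" if t: "0 \<le> t" for t
      proof -
        have "q (\<lambda>x. c * f x) \<le> s (\<lambda>x. c * f x) (c * t)"
          using le V_scale f t c by simp
        also have "\<dots> = p (\<lambda>x. c * (f x + t * y x)) - c * t * p y"
          by (simp add: s_def algebra_simps)
        also have "\<dots> = c * s f t"
          using sublinear_on_scale[OF p mem[OF f]] c by (simp add: s_def algebra_simps)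
        finally show ?thesis using c by (simp add: field_simps)
      qed
      then have "q (\<lambda>x. c * f x) / c \<le> q f"
        unfolding q_def[of f] by (intro cINF_greatest) auto
      then show "q (\<lambda>x. c * f x) \<le> c * q f" using c by (simp add: field_simps)
    qed
    moreover have "q g \<le> p g" if "g \<in> V" for g
      using le[OF that, of 0] by (simp add: s_def)
    ultimately have "q f = p f" using min f by blast
    then have "p f \<le> s f 1" using le[OF f, of 1] by simp
    then show ?thesis using sub[OF f y] by (simp add: s_def)
  qed
  have neg: "p (\<lambda>x. - f x) = - p f" if "f \<in> V" for f
  proof -
    have "(\<lambda>x. - f x) \<in> V" using V_scale[OF that, of "-1"] by simp
    from add[OF that this] sublinear_on_scale[OF p that, of 0] show ?thesis by simp
  qed
  have "p (\<lambda>x. c * f x) = c * p f" if "f \<in> V" for f c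
  proof (cases "0 \<le> c")
    case False
    then show ?thesis
      using neg[OF V_scale[OF that, of "- c"]] sublinear_on_scale[OF p that, of "- c"] by simp
  qed (use sublinear_on_scale[OF p that] in simp)
  with add show ?thesis by (simp add: linear_on_def)
qed

text \<open>Hahn-Banach without a subspace to extend from: Zorn's lemma gives a minimal sublinear
  functional below \<open>p0\<close>, and minimal ones are linear.\<close>

theorem sublinear_dominates_linear:
  assumes p0: "sublinear_on V p0"
  shows "\<exists>\<phi>. linear_on V \<phi> \<and> (\<forall>f\<in>V. \<phi> f \<le> p0 f)"
proof -
  \<comment> \<open>The value 0 off \<open>V\<close> turns comparison on \<open>V\<close> into
    comparison of total functions, and keeps infima over chains finite there.\<close>
  define A where "A = {p. sublinear_on V p \<and> (\<forall>f\<in>V. p f \<le> p0 f) \<and> (\<forall>f. f \<notin> V \<longrightarrow> p f = 0)}"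
  let ?P = "\<lambda>p q :: ('a \<Rightarrow> real) \<Rightarrow> real. q \<le> p"
  have po: "partial_order_on A (relation_of ?P A)"
    by (rule partial_order_on_relation_ofI) auto
  have cl: "(\<lambda>f. if f \<in> V then p0 f else 0) \<in> A"
    using p0 V_add V_scale by (auto simp: A_def sublinear_on_def)
  have ub: "\<exists>u\<in>A. \<forall>a\<in>C. ?P a u" if C: "C \<in> Chains (relation_of ?P A)" for C
  proof (cases "C = {}")
    case True
    then show ?thesis using cl by auto
  next
    case False
    have CA: "p \<in> A" if "p \<in> C" for p
      using C that by (auto simp: Chains_def relation_of_def)
    have comp: "p \<le> q \<or> q \<le> p" if "p \<in> C" "q \<in> C" for p q
      using C that by (auto simp: Chains_def relation_of_def)
    define q where "q f = (INF p\<in>C. p f)" for f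
    have bdd: "bdd_below ((\<lambda>p. p f) ` C)" for f
    proof (cases "f \<in> V")
      case True
      have "- p0 (\<lambda>x. - f x) \<le> p f" if "p \<in> C" for p
      proof -
        have "(\<lambda>x. - f x) \<in> V" using V_scale[OF True, of "-1"] by simp
        then have "p (\<lambda>x. - f x) \<le> p0 (\<lambda>x. - f x)" "sublinear_on V p"
          using CA[OF that] by (auto simp: A_def)
        then show ?thesis using sublinear_on_lower_bound[OF _ True, of p] by linarith
      qed
      then show ?thesis by (intro bdd_belowI2) auto
    next
      case False
      then have "0 \<le> p f" if "p \<in> C" for p using CA[OF that] by (simp add: A_def)
      then show ?thesis by (rule bdd_belowI2)
    qed
    have le: "q f \<le> p f" if "p \<in> C" for p f
      unfolding q_def using bdd that by (rule cINF_lower)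
    have ge: "z \<le> q f" if "\<And>p. p \<in> C \<Longrightarrow> z \<le> p f" for z f
      unfolding q_def using \<open>C \<noteq> {}\<close> that by (rule cINF_greatest)
    have "sublinear_on V q"
      unfolding sublinear_on_def
    proof (intro conjI ballI allI impI)
      fix f g assume f: "f \<in> V" and g: "g \<in> V"
      have *: "q (\<lambda>x. f x + g x) \<le> p1 f + p2 g" if p: "p1 \<in> C" "p2 \<in> C" for p1 p2
      proof -
        \<comment> \<open>Subadditivity survives the infimum because two members of a chain can be
          replaced by the smaller one.\<close>
        obtain p where p: "p \<in> C" "p \<le> p1" "p \<le> p2"
          using comp[OF p] p by auto
        have "q (\<lambda>x. f x + g x) \<le> p (\<lambda>x. f x + g x)" by (rule le[OF p(1)])
        also have "\<dots> \<le> p f + p g"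
          using CA[OF p(1)] f g by (simp add: A_def sublinear_on_def)
        also have "\<dots> \<le> p1 f + p2 g" using p by (simp add: le_fun_def add_mono)
        finally show ?thesis .
      qed
      have "q (\<lambda>x. f x + g x) - p1 f \<le> q g" if "p1 \<in> C" for p1
        using *[OF that] by (intro ge) (auto simp: algebra_simps)
      then have "q (\<lambda>x. f x + g x) - q g \<le> q f"
        by (intro ge) (auto simp: algebra_simps)
      then show "q (\<lambda>x. f x + g x) \<le> q f + q g" by simp
    next
      fix f and c :: real assume f: "f \<in> V" and c: "0 < c"
      have "q (\<lambda>x. c * f x) / c \<le> p f" if "p \<in> C" for p
      proof -
        have "q (\<lambda>x. c * f x) \<le> p (\<lambda>x. c * f x)" by (rule le[OF that])
        also have "\<dots> \<le> c * p f" using CA[OF that] f c by (simp add: A_def sublinear_on_def)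
        finally show ?thesis using c by (simp add: field_simps)
      qed
      then have "q (\<lambda>x. c * f x) / c \<le> q f" by (rule ge)
      then show "q (\<lambda>x. c * f x) \<le> c * q f" using c by (simp add: field_simps)
    qed
    moreover obtain p where p: "p \<in> C" using \<open>C \<noteq> {}\<close> by auto
    moreover have "q f \<le> p0 f" if "f \<in> V" for f
      using le[OF p, of f] CA[OF p] that unfolding A_def by force
    moreover have "q f = 0" if "f \<notin> V" for f
    proof (rule antisym)
      have z: "p f = 0" if "p \<in> C" for p
        using CA[OF that] \<open>f \<notin> V\<close> by (simp add: A_def)
      show "q f \<le> 0" using le[OF p, of f] z[OF p] by simp
      show "0 \<le> q f" by (rule ge, subst z) simp_all
    qed
    ultimately have "q \<in> A" by (auto simp: A_def)
    moreover have "q \<le> p" if "p \<in> C" for p using le[OF that] by (simp add: le_fun_def)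
    ultimately show ?thesis by auto
  qed
  obtain m where m: "m \<in> A" and min: "\<And>a. a \<in> A \<Longrightarrow> a \<le> m \<Longrightarrow> a = m"
    using predicate_Zorn[OF po ub] by blast
  have "linear_on V m"
  proof (rule minimal_sublinear_on_is_linear)
    show "sublinear_on V m" using m by (simp add: A_def)
    fix q f assume q: "sublinear_on V q" "\<And>g. g \<in> V \<Longrightarrow> q g \<le> m g" and f: "f \<in> V"
    let ?q = "\<lambda>f. if f \<in> V then q f else 0"
    have "q f \<le> p0 f" if "f \<in> V" for f
      using q(2)[OF that] m that unfolding A_def by force
    then have "?q \<in> A"
      using q(1) V_add V_scale unfolding A_def sublinear_on_def by auto
    moreover have "?q \<le> m" using q m by (auto simp: A_def le_fun_def)
    ultimately have "?q = m" by (rule min)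
    then show "q f = m f" using f by (auto dest: fun_cong[of _ _ f])
  qed
  then show ?thesis using m by (auto simp: A_def)
qed

end


section \<open>Finitely additive integration of bounded functions\<close>

definition bounded_on :: "'a set \<Rightarrow> ('a \<Rightarrow> real) set"
  where "bounded_on X = {f. \<exists>b. \<forall>x\<in>X. \<bar>f x\<bar> \<le> b}"

lemma bounded_onI: "(\<And>x. x \<in> X \<Longrightarrow> \<bar>f x\<bar> \<le> b) \<Longrightarrow> f \<in> bounded_on X"
  by (auto simp: bounded_on_def)

lemma bounded_on_add:
  assumes "f \<in> bounded_on X" "g \<in> bounded_on X"
  shows "(\<lambda>x. f x + g x) \<in> bounded_on X"
proof -
  obtain b c where "\<forall>x\<in>X. \<bar>f x\<bar> \<le> b" "\<forall>x\<in>X. \<bar>g x\<bar> \<le> c"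
    using assms by (auto simp: bounded_on_def)
  then have "\<bar>f x + g x\<bar> \<le> b + c" if "x \<in> X" for x
    using that by (meson abs_triangle_ineq add_mono order_trans)
  then show ?thesis by (rule bounded_onI)
qed

lemma bounded_on_scale:
  assumes "f \<in> bounded_on X"
  shows "(\<lambda>x. c * f x) \<in> bounded_on X"
proof -
  obtain b where "\<forall>x\<in>X. \<bar>f x\<bar> \<le> b"
    using assms by (auto simp: bounded_on_def)
  then have "\<bar>c * f x\<bar> \<le> \<bar>c\<bar> * b" if "x \<in> X" for x
    using that by (simp add: abs_mult mult_left_mono)
  then show ?thesis by (rule bounded_onI)
qed

lemma bounded_on_const [simp]: "(\<lambda>x. c) \<in> bounded_on X"
  by (rule bounded_onI[of _ _ "\<bar>c\<bar>"]) simp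

lemma bounded_on_indicator [simp]: "(\<lambda>x. indicator A x) \<in> bounded_on X"
  by (rule bounded_onI[of _ _ 1]) (simp add: indicator_def)

lemma bounded_on_minus: "f \<in> bounded_on X \<Longrightarrow> (\<lambda>x. - f x) \<in> bounded_on X"
  using bounded_on_scale[of f X "-1"] by simp

lemma bounded_on_diff:
  "f \<in> bounded_on X \<Longrightarrow> g \<in> bounded_on X \<Longrightarrow> (\<lambda>x. f x - g x) \<in> bounded_on X"
  using bounded_on_add[OF _ bounded_on_minus, of f X g] by simp

lemma bounded_on_sum:
  assumes "\<And>i. i \<in> I \<Longrightarrow> f i \<in> bounded_on X"
  shows "(\<lambda>x. \<Sum>i\<in>I. f i x) \<in> bounded_on X"
  using assms by (induction I rule: infinite_finite_induct) (simp_all add: bounded_on_add)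

text \<open>Integration against a finitely additive probability measure defined on all subsets of
  \<open>X\<close>.\<close>

locale positive_functional =
  fixes X :: "'a set" and \<phi> :: "('a \<Rightarrow> real) \<Rightarrow> real"
  assumes linear: "linear_on (bounded_on X) \<phi>"
    and mono: "\<And>f g. f \<in> bounded_on X \<Longrightarrow> g \<in> bounded_on X \<Longrightarrow>
      (\<And>x. x \<in> X \<Longrightarrow> f x \<le> g x) \<Longrightarrow> \<phi> f \<le> \<phi> g"
    and one: "\<phi> (\<lambda>x. 1) = 1"
begin

lemma add: "f \<in> bounded_on X \<Longrightarrow> g \<in> bounded_on X \<Longrightarrow> \<phi> (\<lambda>x. f x + g x) = \<phi> f + \<phi> g"
  using linear by (simp add: linear_on_def)

lemma scale: "f \<in> bounded_on X \<Longrightarrow> \<phi> (\<lambda>x. c * f x) = c * \<phi> f"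
  using linear by (simp add: linear_on_def)

lemma const: "\<phi> (\<lambda>x. c) = c"
  using scale[OF bounded_on_const, of c 1] one by simp

lemma minus: "f \<in> bounded_on X \<Longrightarrow> \<phi> (\<lambda>x. - f x) = - \<phi> f"
  using scale[of f "-1"] by simp

lemma diff: "f \<in> bounded_on X \<Longrightarrow> g \<in> bounded_on X \<Longrightarrow> \<phi> (\<lambda>x. f x - g x) = \<phi> f - \<phi> g"
  using add[OF _ bounded_on_minus, of f g] minus[of g] by simp

lemma sum:
  assumes "\<And>i. i \<in> I \<Longrightarrow> f i \<in> bounded_on X"
  shows "\<phi> (\<lambda>x. \<Sum>i\<in>I. f i x) = (\<Sum>i\<in>I. \<phi> (f i))"
  using assms
  by (induction I rule: infinite_finite_induct) (simp_all add: const add bounded_on_sum)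

text \<open>Monotonicity in both directions: values off \<open>X\<close> are invisible to
  \<open>\<phi>\<close>, although functions are total on the type.\<close>

lemma cong:
  assumes "f \<in> bounded_on X" "\<And>x. x \<in> X \<Longrightarrow> f x = g x"
  shows "\<phi> f = \<phi> g"
proof -
  have "g \<in> bounded_on X" using assms by (auto simp: bounded_on_def)
  then show ?thesis using assms by (intro antisym mono) auto
qed

lemma abs_le:
  assumes "\<And>x. x \<in> X \<Longrightarrow> \<bar>f x\<bar> \<le> b"
  shows "\<bar>\<phi> f\<bar> \<le> b"
proof -
  have f: "f \<in> bounded_on X" using assms by (rule bounded_onI)
  have "\<phi> f \<le> \<phi> (\<lambda>x. b)" "\<phi> (\<lambda>x. - b) \<le> \<phi> f"
    using assms f by (intro mono; force simp: abs_le_iff minus_le_iff)+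
  then show ?thesis by (simp add: const abs_le_iff)
qed

end

text \<open>A Farkas lemma. Regard \<open>v s\<close> as the price of \<open>l s\<close> and every
  constant as its own price; \<open>p f\<close> is the infimum of the prices of nonnegative
  combinations, shifted by a constant, that dominate f. Hypothesis \<open>cone\<close> says that no
  combination is cheaper than a constant it dominates, which keeps \<open>p\<close> finite; any
  solution \<open>\<phi>\<close> forces it. A linear functional below \<open>p\<close> respects all
  prices.\<close>

theorem positive_functional_exists:
  fixes l :: "'s \<Rightarrow> 'a \<Rightarrow> real" and v :: "'s \<Rightarrow> real"
  assumes "X \<noteq> {}"
    and l: "\<And>s. s \<in> S \<Longrightarrow> l s \<in> bounded_on X"
    and cone: "\<And>F c a. finite F \<Longrightarrow> F \<subseteq> S \<Longrightarrow> (\<And>s. s \<in> F \<Longrightarrow> 0 \<le> c s) \<Longrightarrow>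
      (\<And>x. x \<in> X \<Longrightarrow> a \<le> (\<Sum>s\<in>F. c s * l s x)) \<Longrightarrow> a \<le> (\<Sum>s\<in>F. c s * v s)"
  shows "\<exists>\<phi>. positive_functional X \<phi> \<and> (\<forall>s\<in>S. \<phi> (l s) \<le> v s)"
proof -
  define P where "P f = {(\<Sum>s\<in>F. c s * v s) - a | F c a. finite F \<and> F \<subseteq> S \<and> (\<forall>s. 0 \<le> c s) \<and>
      (\<forall>x\<in>X. f x \<le> (\<Sum>s\<in>F. c s * l s x) - a)}" for f
  define p where "p f = Inf (P f)" for f
  have PI: "(\<Sum>s\<in>F. c s * v s) - a \<in> P f"
    if "finite F" "F \<subseteq> S" "\<And>s. 0 \<le> c s" "\<And>x. x \<in> X \<Longrightarrow> f x \<le> (\<Sum>s\<in>F. c s * l s x) - a"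
    for F c a f
    using that unfolding P_def by blast
  have PI0: "a \<in> P f" if "\<And>x. x \<in> X \<Longrightarrow> f x \<le> a" for a f
    using PI[of "{}" "\<lambda>_. 0" f "- a"] that by simp
  have bd: "b \<le> z" if z: "z \<in> P f" and b: "\<And>x. x \<in> X \<Longrightarrow> b \<le> f x" for z f b
  proof -
    obtain F c a where *: "z = (\<Sum>s\<in>F. c s * v s) - a" "finite F" "F \<subseteq> S" "\<And>s. 0 \<le> c s"
      "\<And>x. x \<in> X \<Longrightarrow> f x \<le> (\<Sum>s\<in>F. c s * l s x) - a"
      using z unfolding P_def by blast
    have "b + a \<le> (\<Sum>s\<in>F. c s * v s)"
    proof (rule cone)
      show "b + a \<le> (\<Sum>s\<in>F. c s * l s x)" if "x \<in> X" for x
        using b[OF that] *(5)[OF that] by linarith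
    qed (use * in auto)
    then show ?thesis using * by simp
  qed
  have ne: "P f \<noteq> {}" and bdd: "bdd_below (P f)" if f: "f \<in> bounded_on X" for f
  proof -
    obtain b where b: "\<And>x. x \<in> X \<Longrightarrow> \<bar>f x\<bar> \<le> b" using f by (auto simp: bounded_on_def)
    have "b \<in> P f" by (rule PI0) (use b in \<open>force simp: abs_le_iff\<close>)
    then show "P f \<noteq> {}" by blast
    show "bdd_below (P f)"
      by (rule bdd_belowI[of _ "- b"], rule bd) (use b in \<open>force simp: abs_le_iff\<close>)+
  qed
  have le: "p f \<le> z" if "z \<in> P f" "f \<in> bounded_on X" for f z
    unfolding p_def using that bdd by (intro cInf_lower)
  have ge: "z \<le> p f" if "\<And>y. y \<in> P f \<Longrightarrow> z \<le> y" "f \<in> bounded_on X" for f z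
    unfolding p_def using that ne by (intro cInf_greatest)
  have "sublinear_on (bounded_on X) p"
    unfolding sublinear_on_def
  proof (intro conjI ballI allI impI)
    fix f g assume f: "f \<in> bounded_on X" and g: "g \<in> bounded_on X"
    have *: "p (\<lambda>x. f x + g x) \<le> y + z" if y: "y \<in> P f" and z: "z \<in> P g" for y z
    proof -
      obtain F c a where 1: "y = (\<Sum>s\<in>F. c s * v s) - a" "finite F" "F \<subseteq> S" "\<And>s. 0 \<le> c s"
        "\<And>x. x \<in> X \<Longrightarrow> f x \<le> (\<Sum>s\<in>F. c s * l s x) - a"
        using y unfolding P_def by blast
      obtain F' c' a' where 2: "z = (\<Sum>s\<in>F'. c' s * v s) - a'" "finite F'" "F' \<subseteq> S" "\<And>s. 0 \<le> c' s"
        "\<And>x. x \<in> X \<Longrightarrow> g x \<le> (\<Sum>s\<in>F'. c' s * l s x) - a'"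
        using z unfolding P_def by blast
      define d where "d s = (if s \<in> F then c s else 0) + (if s \<in> F' then c' s else 0)" for s
      have d: "(\<Sum>s\<in>F \<union> F'. d s * w s) = (\<Sum>s\<in>F. c s * w s) + (\<Sum>s\<in>F'. c' s * w s)" for w :: "'s \<Rightarrow> real"
      proof -
        have "(\<Sum>s\<in>F \<union> F'. d s * w s) = (\<Sum>s\<in>F \<union> F'. (if s \<in> F then c s * w s else 0)) +
           (\<Sum>s\<in>F \<union> F'. (if s \<in> F' then c' s * w s else 0))"
          by (simp add: d_def ring_distribs sum.distrib if_distrib[of "\<lambda>u. u * _"] cong: if_cong)
        also have "(\<Sum>s\<in>F \<union> F'. (if s \<in> F then c s * w s else 0)) = (\<Sum>s\<in>F. c s * w s)"
          using 1 2 by (intro sum.mono_neutral_cong_right) auto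
        also have "(\<Sum>s\<in>F \<union> F'. (if s \<in> F' then c' s * w s else 0)) = (\<Sum>s\<in>F'. c' s * w s)"
          using 1 2 by (intro sum.mono_neutral_cong_right) auto
        finally show ?thesis .
      qed
      have "(\<Sum>s\<in>F \<union> F'. d s * v s) - (a + a') \<in> P (\<lambda>x. f x + g x)"
      proof (rule PI)
        show "f x + g x \<le> (\<Sum>s\<in>F \<union> F'. d s * l s x) - (a + a')" if "x \<in> X" for x
          using 1(5)[OF that] 2(5)[OF that] by (simp add: d)
      qed (use 1 2 in \<open>auto simp: d_def\<close>)
      from le[OF this bounded_on_add[OF f g]] show ?thesis by (simp add: d 1 2)
    qed
    have "p (\<lambda>x. f x + g x) - y \<le> p g" if "y \<in> P f" for y
      using *[OF that] g by (intro ge) (auto simp: algebra_simps)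
    then have "p (\<lambda>x. f x + g x) - p g \<le> p f"
      using f by (intro ge) (auto simp: algebra_simps)
    then show "p (\<lambda>x. f x + g x) \<le> p f + p g" by simp
  next
    fix f and t :: real assume f: "f \<in> bounded_on X" and t: "0 < t"
    have "p (\<lambda>x. t * f x) / t \<le> y" if y: "y \<in> P f" for y
    proof -
      obtain F c a where 1: "y = (\<Sum>s\<in>F. c s * v s) - a" "finite F" "F \<subseteq> S" "\<And>s. 0 \<le> c s"
        "\<And>x. x \<in> X \<Longrightarrow> f x \<le> (\<Sum>s\<in>F. c s * l s x) - a"
        using y unfolding P_def by blast
      have "(\<Sum>s\<in>F. (t * c s) * v s) - t * a \<in> P (\<lambda>x. t * f x)"
      proof (rule PI)
        show "t * f x \<le> (\<Sum>s\<in>F. (t * c s) * l s x) - t * a" if "x \<in> X" for x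
          using mult_left_mono[OF 1(5)[OF that], of t] t
          by (simp add: sum_distrib_left algebra_simps)
      qed (use 1 t in auto)
      from le[OF this bounded_on_scale[OF f]] show ?thesis
        using t by (simp add: 1 field_simps sum_distrib_left)
    qed
    then have "p (\<lambda>x. t * f x) / t \<le> p f" using f by (rule ge)
    then show "p (\<lambda>x. t * f x) \<le> t * p f" using t by (simp add: field_simps)
  qed
  then obtain \<phi> where \<phi>: "linear_on (bounded_on X) \<phi>" and dom: "\<And>f. f \<in> bounded_on X \<Longrightarrow> \<phi> f \<le> p f"
    using sublinear_dominates_linear[of "bounded_on X" p] bounded_on_add bounded_on_scale by blast
  \<comment> \<open>This one bound yields monotonicity (a = 0, applied to f - g) as well as
    normalization (a = 1 and a = -1).\<close>
  have upper: "\<phi> f \<le> a" if "f \<in> bounded_on X" "\<And>x. x \<in> X \<Longrightarrow> f x \<le> a" for f a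
    using dom[OF that(1)] le[OF PI0 that(1)] that(2) by fastforce
  have neg: "\<phi> (\<lambda>x. - f x) = - \<phi> f" if f: "f \<in> bounded_on X" for f
  proof -
    have "\<phi> (\<lambda>x. (-1) * f x) = (-1) * \<phi> f" using \<phi> f unfolding linear_on_def by blast
    then show ?thesis by simp
  qed
  have "positive_functional X \<phi>"
  proof
    fix f g assume f: "f \<in> bounded_on X" and g: "g \<in> bounded_on X"
      and "\<And>x. x \<in> X \<Longrightarrow> f x \<le> g x"
    then have "\<phi> (\<lambda>x. f x + - g x) \<le> 0"
      by (intro upper bounded_on_add bounded_on_minus) auto
    moreover have "\<phi> (\<lambda>x. f x + - g x) = \<phi> f + \<phi> (\<lambda>x. - g x)"
      using \<phi>[unfolded linear_on_def, THEN conjunct1, rule_format, OF f bounded_on_minus[OF g]] .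
    ultimately show "\<phi> f \<le> \<phi> g" using neg[OF g] by simp
  next
    have "\<phi> (\<lambda>x. 1) \<le> 1" "\<phi> (\<lambda>x. - 1) \<le> - 1" by (intro upper; simp)+
    then show "\<phi> (\<lambda>x. 1) = 1" using neg[of "\<lambda>x. 1"] by simp
  qed (fact \<phi>)
  moreover have "\<phi> (l s) \<le> v s" if "s \<in> S" for s
  proof -
    have "v s \<in> P (l s)" using PI[of "{s}" "\<lambda>_. 1" "l s" 0] that by simp
    then show ?thesis using dom[OF l[OF that]] le[OF _ l[OF that]] by fastforce
  qed
  ultimately show ?thesis by blast
qed

section \<open>Ample groupoids and compact open bisections\<close>

context groupoid
begin

lemma inv_mul_self [simp]: "ginv G \<gamma> \<cdot> \<gamma> = src G \<gamma>" and mul_inv_self [simp]: "\<gamma> \<cdot> ginv G \<gamma> = rng G \<gamma>"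
  by (simp_all add: src_def rng_def)

lemma composable_iff [simp]: "(\<alpha>, \<beta>) \<in> composable G \<longleftrightarrow> src G \<alpha> = rng G \<beta>"
  by (simp add: composable_def)

declare src_inv [simp] rng_inv [simp] mul_src [simp] rng_mul_self [simp]

lemma src_mul' [simp]: "src G \<alpha> = rng G \<beta> \<Longrightarrow> src G (\<alpha> \<cdot> \<beta>) = src G \<beta>"
  and rng_mul' [simp]: "src G \<alpha> = rng G \<beta> \<Longrightarrow> rng G (\<alpha> \<cdot> \<beta>) = rng G \<alpha>"
  by (simp_all add: src_mul rng_mul)

lemma assoc: "src G \<alpha> = rng G \<beta> \<Longrightarrow> src G \<beta> = rng G \<gamma> \<Longrightarrow> (\<alpha> \<cdot> \<beta>) \<cdot> \<gamma> = \<alpha> \<cdot> (\<beta> \<cdot> \<gamma>)"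
  by (simp add: mul_assoc)

lemma src_src [simp]: "src G (src G \<gamma>) = src G \<gamma>"
  and rng_src [simp]: "rng G (src G \<gamma>) = src G \<gamma>"
  using src_mul'[of "ginv G \<gamma>" \<gamma>] rng_mul'[of "ginv G \<gamma>" \<gamma>] by simp_all

lemma src_rng [simp]: "src G (rng G \<gamma>) = rng G \<gamma>"
  and rng_rng [simp]: "rng G (rng G \<gamma>) = rng G \<gamma>"
  using src_mul'[of \<gamma> "ginv G \<gamma>"] rng_mul'[of \<gamma> "ginv G \<gamma>"] by simp_all

lemma inv_mul_cancel [simp]: "src G \<alpha> = rng G \<beta> \<Longrightarrow> ginv G \<alpha> \<cdot> (\<alpha> \<cdot> \<beta>) = \<beta>"
  by (subst assoc[symmetric]) simp_all

lemma mul_inv_cancel [simp]: "rng G \<alpha> = rng G \<beta> \<Longrightarrow> \<alpha> \<cdot> (ginv G \<alpha> \<cdot> \<beta>) = \<beta>"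
  by (subst assoc[symmetric]) simp_all

lemma mul_inv_cancel_right [simp]: "src G \<alpha> = rng G \<beta> \<Longrightarrow> (\<alpha> \<cdot> \<beta>) \<cdot> ginv G \<beta> = \<alpha>"
  using mul_src[of \<alpha>] by (subst assoc) simp_all

lemma inv_mul_cancel_right [simp]: "src G \<alpha> = src G \<beta> \<Longrightarrow> (\<alpha> \<cdot> ginv G \<beta>) \<cdot> \<beta> = \<alpha>"
  using mul_src[of \<alpha>] by (subst assoc) simp_all

lemma inv_inv [simp]: "ginv G (ginv G \<gamma>) = \<gamma>"
  using inv_mul_cancel[of "ginv G \<gamma>" \<gamma>] mul_src[of "ginv G (ginv G \<gamma>)"] by simp

lemma inv_inject [simp]: "ginv G \<alpha> = ginv G \<beta> \<longleftrightarrow> \<alpha> = \<beta>"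
  by (metis inv_inv)

lemma unit_iff: "x \<in> units G \<longleftrightarrow> src G x = x"
  by (auto simp: units_def) (metis rangeI)

lemma unit_src [simp]: "x \<in> units G \<Longrightarrow> src G x = x"
  by (simp add: unit_iff)

lemma src_in_units [simp]: "src G \<gamma> \<in> units G" and rng_in_units [simp]: "rng G \<gamma> \<in> units G"
  by (simp_all add: unit_iff)

lemma unit_rng [simp]: "x \<in> units G \<Longrightarrow> rng G x = x"
  by (metis rng_src unit_src)

lemma unit_inv [simp]:
  assumes "x \<in> units G" shows "ginv G x = x"
  using assms mul_src[of "ginv G x"] inv_mul_self[of x] by simp

lemma mul_unit [simp]: "x \<in> units G \<Longrightarrow> src G \<gamma> = x \<Longrightarrow> \<gamma> \<cdot> x = \<gamma>"
  and unit_mul [simp]: "x \<in> units G \<Longrightarrow> rng G \<gamma> = x \<Longrightarrow> x \<cdot> \<gamma> = \<gamma>"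
  by auto

lemma rng_image_inv: "rng G ` ginv G ` U = src G ` U" and src_image_inv: "src G ` ginv G ` U = rng G ` U"
  by (simp_all add: image_image)

text \<open>For u and v in \<open>U\<close>, the arrows u^-1 and v are composable only if u and v
  have the same range, hence only if u = v.\<close>

lemma set_mul_inv_left:
  assumes "inj_on (rng G) U" shows "set_mul G (set_inv G U) U = src G ` U"
proof
  show "set_mul G (set_inv G U) U \<subseteq> src G ` U"
    using assms by (auto simp: set_mul_def set_inv_def) (metis inj_onD inv_mul_self imageI)
  show "src G ` U \<subseteq> set_mul G (set_inv G U) U"
    by (force simp: set_mul_def set_inv_def)
qed

lemma set_mul_inv_right:
  assumes "inj_on (src G) U" shows "set_mul G U (set_inv G U) = rng G ` U"
proof
  show "set_mul G U (set_inv G U) \<subseteq> rng G ` U"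
    using assms by (auto simp: set_mul_def set_inv_def) (metis inj_onD mul_inv_self imageI)
  show "rng G ` U \<subseteq> set_mul G U (set_inv G U)"
    by (force simp: set_mul_def set_inv_def)
qed

end

context topological_groupoid
begin

lemma continuous_on_src: "continuous_on A (src G)"
proof -
  have "continuous_on UNIV (\<lambda>\<gamma>. (\<lambda>(\<alpha>, \<beta>). \<alpha> \<cdot> \<beta>) (ginv G \<gamma>, \<gamma>))"
    by (rule continuous_on_compose2[OF continuous_mul])
       (auto intro!: continuous_intros continuous_inv)
  then have "continuous_on UNIV (src G)" by simp
  then show ?thesis by (rule continuous_on_subset) simp
qed

lemma continuous_on_ginv: "continuous_on A (ginv G)"
  using continuous_inv by (rule continuous_on_subset) simp

lemma continuous_on_rng: "continuous_on A (rng G)"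
proof -
  have "continuous_on A (\<lambda>\<gamma>. src G (ginv G \<gamma>))"
    by (rule continuous_on_compose2[OF continuous_on_src[of UNIV] continuous_on_ginv]) simp
  then show ?thesis by simp
qed

lemma open_vimage_src: "open U \<Longrightarrow> open (src G -` U)"
  and open_vimage_ginv: "open U \<Longrightarrow> open (ginv G -` U)"
  by (simp_all add: open_vimage continuous_on_src continuous_on_ginv)

lemma ginv_image: "ginv G ` U = ginv G -` U"
proof
  show "ginv G -` U \<subseteq> ginv G ` U"
  proof
    fix x assume "x \<in> ginv G -` U"
    then have "ginv G (ginv G x) \<in> ginv G ` U" by blast
    then show "x \<in> ginv G ` U" by simp
  qed
qed auto

lemma open_ginv_image: "open U \<Longrightarrow> open (ginv G ` U)"
  by (simp add: ginv_image open_vimage_ginv)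

end

text \<open>Intersections of two compact open bisections need not be compact when G is not
  Hausdorff. This larger class is closed under passing to open subsets.\<close>

definition open_bisections :: "'g::topological_space groupoid_data \<Rightarrow> 'g set set"
  where "open_bisections G = {U. open U \<and> inj_on (src G) U \<and> inj_on (rng G) U}"

lemma compact_open_bisections_eq: "compact_open_bisections G = {U \<in> open_bisections G. compact U}"
  by (auto simp: compact_open_bisections_def open_bisections_def)

lemma open_bisection_subset: "U \<in> open_bisections G \<Longrightarrow> open V \<Longrightarrow> V \<subseteq> U \<Longrightarrow> V \<in> open_bisections G"
  by (auto simp: open_bisections_def intro: inj_on_subset)

context topological_groupoid
begin

lemma open_bisection_inv:
  assumes "U \<in> open_bisections G" shows "ginv G ` U \<in> open_bisections G"
  using assms by (auto simp: open_bisections_def open_ginv_image inj_on_def)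

lemma compact_open_bisection_inv:
  assumes "U \<in> compact_open_bisections G" shows "ginv G ` U \<in> compact_open_bisections G"
  using assms open_bisection_inv[of U] compact_continuous_image[OF continuous_on_ginv, of U]
  by (simp add: compact_open_bisections_eq)

end

section \<open>Etale groupoids: open maps and restriction of bisections\<close>

context etale_groupoid
begin

text \<open>Let \<open>src G\<close> be injective on a neighbourhood of a unit. If an arrow and its
  source both lie in that neighbourhood, they have the same source, hence coincide, and the arrow is
  a unit.\<close>

lemma open_units: "open (units G)"
proof (subst open_subopen, rule ballI)
  fix x assume x: "x \<in> units G"
  obtain U h where U: "open U" "x \<in> U" "homeomorphism U (src G ` U) (src G) h"
    using src_local_homeomorphism[of x] by blast
  have inj: "inj_on (src G) U" by (rule inj_on_inverseI[of _ h]) (rule homeomorphism_apply1[OF U(3)])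
  have "U \<inter> src G -` U \<subseteq> units G"
    using inj by (auto simp: unit_iff inj_on_def)
  moreover have "open (U \<inter> src G -` U)" using U(1) open_vimage_src by blast
  ultimately show "\<exists>T. open T \<and> x \<in> T \<and> T \<subseteq> units G" using U(2) x by auto
qed

lemma openin_units: "openin (top_of_set (units G)) U \<longleftrightarrow> open U \<and> U \<subseteq> units G"
  using open_units by (simp add: openin_open_eq)

lemma open_src_image:
  assumes "open W" shows "open (src G ` W)"
proof (subst open_subopen, rule ballI)
  fix y assume "y \<in> src G ` W"
  then obtain \<gamma> where \<gamma>: "\<gamma> \<in> W" "y = src G \<gamma>" by blast
  obtain U h where U: "open U" "\<gamma> \<in> U" "openin (top_of_set (units G)) (src G ` U)"
    "homeomorphism U (src G ` U) (src G) h"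
    using src_local_homeomorphism[of \<gamma>] by blast
  have "openin (top_of_set U) (U \<inter> W)" using assms by auto
  then have "openin (top_of_set (src G ` U)) (src G ` (U \<inter> W))"
    by (rule homeomorphism_imp_open_map[OF U(4)])
  then have "open (src G ` (U \<inter> W))"
    using U(3) openin_units by (metis openin_open_eq)
  then show "\<exists>T. open T \<and> y \<in> T \<and> T \<subseteq> src G ` W" using \<gamma> U(2) by blast
qed

lemma open_rng_image: "open W \<Longrightarrow> open (rng G ` W)"
  using open_src_image[OF open_ginv_image, of W] by (simp add: src_image_inv)

lemma compact_open_unitsI: "open U \<Longrightarrow> compact U \<Longrightarrow> U \<subseteq> units G \<Longrightarrow> U \<in> compact_open_units G"
  and compact_open_unitsD: "U \<in> compact_open_units G \<Longrightarrow> open U \<and> compact U \<and> U \<subseteq> units G"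
  by (auto simp: compact_open_units_def openin_units)

lemma src_compact_open_bisection:
  "U \<in> compact_open_bisections G \<Longrightarrow> src G ` U \<in> compact_open_units G"
  by (auto simp: compact_open_bisections_def intro!: compact_open_unitsI open_src_image
      compact_continuous_image continuous_on_src)

lemma rng_compact_open_bisection:
  "U \<in> compact_open_bisections G \<Longrightarrow> rng G ` U \<in> compact_open_units G"
  by (auto simp: compact_open_bisections_def intro!: compact_open_unitsI open_rng_image
      compact_continuous_image continuous_on_rng)

lemma inj_on_units: "A \<subseteq> units G \<Longrightarrow> inj_on (src G) A" "A \<subseteq> units G \<Longrightarrow> inj_on (rng G) A"
  by (auto simp: inj_on_def subset_iff)

lemma compact_open_units_bisection: "U \<in> compact_open_units G \<Longrightarrow> U \<in> compact_open_bisections G"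
  by (auto simp: compact_open_bisections_def inj_on_units dest: compact_open_unitsD)

text \<open>The source map is a homeomorphism of \<open>W\<close> onto its image, so the part of
  \<open>W\<close> over \<open>K\<close> is the image of \<open>K\<close> under the inverse map and
  inherits compactness. This is how an open bisection is exhausted by compact open ones.\<close>

lemma open_bisection_restrict:
  assumes W: "W \<in> open_bisections G" and K: "open K" "compact K" "K \<subseteq> src G ` W"
  shows "{w \<in> W. src G w \<in> K} \<in> compact_open_bisections G" "src G ` {w \<in> W. src G w \<in> K} = K"
proof -
  have o: "open W" and inj: "inj_on (src G) W" using W by (auto simp: open_bisections_def)
  obtain h where h: "homeomorphism W (src G ` W) (src G) h"
  proof (rule homeomorphism_injective_open_map[OF continuous_on_src refl inj])
    show "openin (top_of_set (src G ` W)) (src G ` U)" if "openin (top_of_set W) U" for U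
      using that o openin_open_eq[OF o] openin_open_eq[OF open_src_image[OF o]] open_src_image by auto
  qed
  have eq: "{w \<in> W. src G w \<in> K} = h ` K"
  proof (intro Set.set_eqI iffI)
    fix w assume "w \<in> {w \<in> W. src G w \<in> K}"
    then show "w \<in> h ` K" using homeomorphism_apply1[OF h, of w] by (metis (lifting) image_eqI mem_Collect_eq)
  next
    fix w assume "w \<in> h ` K"
    then obtain x where x: "x \<in> K" "w = h x" by blast
    then have "src G w = x" "w \<in> W"
      using K(3) homeomorphism_apply2[OF h, of x] homeomorphism_image2[OF h] by auto
    then show "w \<in> {w \<in> W. src G w \<in> K}" using x by simp
  qed
  have "compact (h ` K)"
    using h K by (meson compact_continuous_image continuous_on_subset homeomorphism_cont2)
  moreover have "open {w \<in> W. src G w \<in> K}"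
    using open_Int[OF o open_vimage_src[OF K(1)]] by (simp add: Int_def)
  ultimately show "{w \<in> W. src G w \<in> K} \<in> compact_open_bisections G"
    using open_bisection_subset[OF W] eq by (auto simp: compact_open_bisections_eq)
  show "src G ` {w \<in> W. src G w \<in> K} = K" using K by auto
qed

end

context ample_groupoid
begin

text \<open>A neighbourhood of \<gamma>^-1 on which the source is injective becomes, by inversion, a
  neighbourhood of \<gamma> on which the range is injective. Compactness comes from cutting down to
  the arrows over a compact open set of units.\<close>

lemma compact_open_bisection_basis:
  assumes O: "open W" "\<gamma> \<in> W"
  obtains U where "U \<in> compact_open_bisections G" "\<gamma> \<in> U" "U \<subseteq> W"
proof -
  have ex: "\<exists>U. open U \<and> \<gamma> \<in> U \<and> inj_on (src G) U" for \<gamma>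
  proof -
    obtain U h where U: "open U" "\<gamma> \<in> U" "homeomorphism U (src G ` U) (src G) h"
      using src_local_homeomorphism[of \<gamma>] by blast
    have "inj_on (src G) U"
      by (rule inj_on_inverseI[of _ h]) (rule homeomorphism_apply1[OF U(3)])
    with U show ?thesis by blast
  qed
  obtain U where U: "open U" "\<gamma> \<in> U" "inj_on (src G) U" using ex by blast
  obtain V where V: "open V" "ginv G \<gamma> \<in> V" "inj_on (src G) V" using ex by blast
  have Vr: "inj_on (rng G) (ginv G -` V)"
    using V(3) by (auto simp: inj_on_def) (metis inv_inject src_inv)
  define W' where "W' = W \<inter> U \<inter> ginv G -` V"
  have W': "W' \<in> open_bisections G" "\<gamma> \<in> W'"
    using O U V Vr by (auto simp: W'_def open_bisections_def open_vimage_ginv inj_on_def)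
  then have "openin (top_of_set (units G)) (src G ` W')"
    by (auto simp: openin_units open_bisections_def open_src_image)
  from compact_open_basis[OF this imageI[OF W'(2)]]
  obtain K where K: "K \<in> compact_open_units G" "src G \<gamma> \<in> K" "K \<subseteq> src G ` W'" by blast
  show ?thesis
  proof (rule that)
    show "{w \<in> W'. src G w \<in> K} \<in> compact_open_bisections G"
      using open_bisection_restrict(1)[OF W'(1)] K(3) compact_open_unitsD[OF K(1)] by simp
  qed (use K W' in \<open>auto simp: W'_def\<close>)
qed

end

section \<open>Boolean operations on compact open sets of units\<close>

locale compact_ample_groupoid = ample_groupoid G
  for G :: "'g::topological_space groupoid_data" (structure) +
  assumes compact_units: "compact (units G)"
begin

lemma units_compact_open: "units G \<in> compact_open_units G"
  by (rule compact_open_unitsI) (auto simp: open_units compact_units)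

text \<open>\<open>K\<close> is closed in the unit space because that space is Hausdorff, even if
  \<open>G\<close> is not; the complement is compact because the unit space is.\<close>

lemma compact_open_units_diff_units:
  assumes "K \<in> compact_open_units G" shows "units G - K \<in> compact_open_units G"
proof (rule compact_open_unitsI)
  have "compactin (top_of_set (units G)) K"
    using compact_open_unitsD[OF assms] by (simp add: compactin_subtopology)
  then have "closedin (top_of_set (units G)) K"
    by (rule compactin_imp_closedin[OF Hausdorff_units])
  then have "openin (top_of_set (units G)) (units G - K)"
    by (metis openin_diff openin_subtopology_self)
  then show "open (units G - K)" by (simp add: openin_units)
  show "compact (units G - K)"
    using compact_diff[OF compact_units] compact_open_unitsD[OF assms] by blast
qed simp

lemma compact_open_units_diff:
  assumes "K \<in> compact_open_units G" "L \<in> compact_open_units G"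
  shows "K - L \<in> compact_open_units G"
proof (rule compact_open_unitsI)
  have *: "K - L = K \<inter> (units G - L)" using compact_open_unitsD[OF assms(1)] by blast
  show "open (K - L)"
    unfolding * using compact_open_unitsD[OF assms(1)]
      compact_open_unitsD[OF compact_open_units_diff_units[OF assms(2)]] by blast
  show "compact (K - L)"
    using compact_open_unitsD[OF assms(1)] compact_open_unitsD[OF assms(2)] compact_diff by blast
qed (use compact_open_unitsD[OF assms(1)] in auto)

lemma compact_open_units_Int:
  assumes "K \<in> compact_open_units G" "L \<in> compact_open_units G"
  shows "K \<inter> L \<in> compact_open_units G"
  using compact_open_units_diff[OF assms(1) compact_open_units_diff[OF assms]]
  by (simp add: Diff_Diff_Int)

lemma compact_open_units_UN:
  assumes "finite I" "\<And>i. i \<in> I \<Longrightarrow> K i \<in> compact_open_units G"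
  shows "(\<Union>i\<in>I. K i) \<in> compact_open_units G"
proof (rule compact_open_unitsI)
  show "open (\<Union>i\<in>I. K i)" "compact (\<Union>i\<in>I. K i)" "(\<Union>i\<in>I. K i) \<subseteq> units G"
    using assms compact_open_unitsD by (auto intro!: compact_UN open_UN)
qed

lemma compact_open_units_empty: "{} \<in> compact_open_units G"
  by (rule compact_open_unitsI) auto

lemma compact_open_bisection_restrict:
  assumes U: "U \<in> compact_open_bisections G" and K: "K \<in> compact_open_units G"
  shows "{u \<in> U. src G u \<in> K} \<in> compact_open_bisections G"
proof -
  have L: "K \<inter> src G ` U \<in> compact_open_units G"
    using compact_open_units_Int K src_compact_open_bisection[OF U] by blast
  have "{u \<in> U. src G u \<in> K \<inter> src G ` U} \<in> compact_open_bisections G"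
    using U compact_open_unitsD[OF L] by (intro open_bisection_restrict) (auto simp: compact_open_bisections_eq)
  moreover have "{u \<in> U. src G u \<in> K \<inter> src G ` U} = {u \<in> U. src G u \<in> K}" by auto
  ultimately show ?thesis by simp
qed

end

section \<open>Convolution\<close>

context groupoid
begin

text \<open>A factorization of \<gamma> is determined by its left factor, and likewise by its right
  factor; this turns the sum over pairs into a sum over a range fibre or a source fibre.\<close>

lemma convolution_eq_rng_sum:
  "convolution G f g \<gamma> =
    (\<Sum>\<alpha> | rng G \<alpha> = rng G \<gamma> \<and> f \<alpha> * g (ginv G \<alpha> \<cdot> \<gamma>) \<noteq> 0. f \<alpha> * g (ginv G \<alpha> \<cdot> \<gamma>))"
  unfolding convolution_def
  by (rule sum.reindex_bij_witness[where i = "\<lambda>\<alpha>. (\<alpha>, ginv G \<alpha> \<cdot> \<gamma>)" and j = fst]) auto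

lemma convolution_eq_src_sum:
  "convolution G f g \<gamma> =
    (\<Sum>\<beta> | src G \<beta> = src G \<gamma> \<and> f (\<gamma> \<cdot> ginv G \<beta>) * g \<beta> \<noteq> 0. f (\<gamma> \<cdot> ginv G \<beta>) * g \<beta>)"
  unfolding convolution_def
  by (rule sum.reindex_bij_witness[where i = "\<lambda>\<beta>. (\<gamma> \<cdot> ginv G \<beta>, \<beta>)" and j = snd]) auto

lemma convolution_indicator_unit_left:
  fixes f :: "'g \<Rightarrow> 'k::comm_ring_1"
  assumes A: "A \<subseteq> units G" and f: "\<And>\<gamma>. f \<gamma> \<noteq> 0 \<Longrightarrow> rng G \<gamma> \<in> A"
  shows "convolution G (indicator A) f = f"
proof
  fix \<gamma>
  have "convolution G (indicator A) f \<gamma> =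
    (\<Sum>\<alpha>\<in>(if f \<gamma> \<noteq> 0 then {rng G \<gamma>} else {}). indicator A \<alpha> * f (ginv G \<alpha> \<cdot> \<gamma>))"
    unfolding convolution_eq_rng_sum using A f[of \<gamma>]
    by (intro sum.cong) (auto simp: indicator_def subset_iff split: if_splits)
  moreover have "(if f \<gamma> \<noteq> 0 then {rng G \<gamma>} else {}) = {rng G \<gamma>}" if "f \<gamma> \<noteq> 0"
    using that by simp
  ultimately show "convolution G (indicator A) f \<gamma> = f \<gamma>"
    using f[of \<gamma>] by (cases "f \<gamma> = 0") simp_all
qed

lemma convolution_indicator_unit_right:
  fixes f :: "'g \<Rightarrow> 'k::comm_ring_1"
  assumes A: "A \<subseteq> units G" and f: "\<And>\<gamma>. f \<gamma> \<noteq> 0 \<Longrightarrow> src G \<gamma> \<in> A"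
  shows "convolution G f (indicator A) = f"
proof
  fix \<gamma>
  have "convolution G f (indicator A) \<gamma> =
    (\<Sum>\<beta>\<in>(if f \<gamma> \<noteq> 0 then {src G \<gamma>} else {}). f (\<gamma> \<cdot> ginv G \<beta>) * indicator A \<beta>)"
    unfolding convolution_eq_src_sum using A f[of \<gamma>]
    by (intro sum.cong) (auto simp: indicator_def subset_iff split: if_splits)
  moreover have "(if f \<gamma> \<noteq> 0 then {src G \<gamma>} else {}) = {src G \<gamma>}" if "f \<gamma> \<noteq> 0"
    using that by simp
  ultimately show "convolution G f (indicator A) \<gamma> = f \<gamma>"
    using f[of \<gamma>] by (cases "f \<gamma> = 0") simp_all
qed

lemma convolution_zero_left: "convolution G (\<lambda>\<gamma>. 0) f = (\<lambda>\<gamma>. 0)"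
  and convolution_zero_right: "convolution G f (\<lambda>\<gamma>. 0) = (\<lambda>\<gamma>. 0)"
  by (simp_all add: convolution_def fun_eq_iff)

text \<open>All pieces lie in one bisection \<open>U\<close>, so v^-1 w with v in \<open>V\<close>
  and w in \<open>W\<close> is defined only for v = w, where it is the source of v.\<close>

lemma convolution_indicator_inv:
  assumes inj: "inj_on (rng G) U" "inj_on (src G) U" and "V \<subseteq> U" "W \<subseteq> U"
  shows "convolution G (indicator (ginv G ` V)) (indicator W) =
    (indicator (src G ` (V \<inter> W)) :: 'g \<Rightarrow> 'k::comm_ring_1)"
proof
  fix \<gamma>
  let ?S = "{\<beta>. src G \<beta> = src G \<gamma> \<and>
    indicator (ginv G ` V) (\<gamma> \<cdot> ginv G \<beta>) * (indicator W \<beta> :: 'k) \<noteq> 0}"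
  have S: "\<beta> \<in> V \<inter> W \<and> \<gamma> = src G \<beta>" if "\<beta> \<in> ?S" for \<beta>
  proof -
    from that obtain v where v: "v \<in> V" "\<gamma> \<cdot> ginv G \<beta> = ginv G v" "src G \<beta> = src G \<gamma>" "\<beta> \<in> W"
      by (auto split: split_indicator_asm)
    have "src G (\<gamma> \<cdot> ginv G \<beta>) = rng G \<beta>" using v(3) by simp
    then have "rng G \<beta> = rng G v" using v(2) by simp
    then have "\<beta> = v" using inj v assms by (auto dest: inj_onD)
    moreover have "(\<gamma> \<cdot> ginv G \<beta>) \<cdot> \<beta> = \<gamma>" using v(3) by simp
    ultimately show ?thesis using v(1,2,4) by simp
  qed
  show "convolution G (indicator (ginv G ` V)) (indicator W) \<gamma> = (indicator (src G ` (V \<inter> W)) \<gamma> :: 'k)"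
  proof (cases "\<gamma> \<in> src G ` (V \<inter> W)")
    case True
    then obtain w where w: "w \<in> V" "w \<in> W" "\<gamma> = src G w" by auto
    have "w \<in> ?S" using w by simp
    moreover have "\<beta> = w" if "\<beta> \<in> ?S" for \<beta>
      using S[OF that] w inj(2) assms(3,4) by (auto dest: inj_onD)
    ultimately have "?S = {w}" by blast
    then show ?thesis using w unfolding convolution_eq_src_sum by simp
  next
    case False
    then have "?S = {}" using S by blast
    then show ?thesis using False unfolding convolution_eq_src_sum by simp
  qed
qed

end

section \<open>Elements and finite sums in the groupoid algebra\<close>

lemma mat_ring_mult:
  "A \<otimes>\<^bsub>mat_ring n R\<^esub> B =
    (\<lambda>(i, j)\<in>{..<n} \<times> {..<n}. \<Oplus>\<^bsub>R\<^esub>k\<in>{..<n}. A (i, k) \<otimes>\<^bsub>R\<^esub> B (k, j))"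
  by (simp add: mat_ring_def)

lemma groupoid_functionsI:
  assumes "finite F" "F \<subseteq> compact_open_bisections G" "\<And>\<gamma>. f \<gamma> = (\<Sum>U\<in>F. c U * indicator U \<gamma>)"
  shows "f \<in> groupoid_functions G"
proof -
  have "f = (\<lambda>\<gamma>. \<Sum>U\<in>F. c U * indicator U \<gamma>)" using assms(3) by (rule ext)
  then show ?thesis unfolding groupoid_functions_def using assms(1,2) by blast
qed

lemma groupoid_functionsE:
  assumes "f \<in> groupoid_functions G"
  obtains F c where "finite F" "F \<subseteq> compact_open_bisections G"
    "\<And>\<gamma>. f \<gamma> = (\<Sum>U\<in>F. c U * indicator U \<gamma>)"
  using assms unfolding groupoid_functions_def by blast

lemma groupoid_functions_indicator:
  "U \<in> compact_open_bisections G \<Longrightarrow> indicator U \<in> groupoid_functions G"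
  by (rule groupoid_functionsI[of "{U}" _ _ "\<lambda>_. 1"]) simp_all

lemma groupoid_functions_zero: "(\<lambda>\<gamma>. 0) \<in> groupoid_functions G"
  by (rule groupoid_functionsI[of "{}"]) simp_all

lemma groupoid_functions_add:
  fixes f g :: "'g::topological_space \<Rightarrow> 'k::comm_ring_1"
  assumes "f \<in> groupoid_functions G" "g \<in> groupoid_functions G"
  shows "(\<lambda>\<gamma>. f \<gamma> + g \<gamma>) \<in> groupoid_functions G"
proof -
  obtain F c where f: "finite F" "F \<subseteq> compact_open_bisections G" "\<And>\<gamma>. f \<gamma> = (\<Sum>U\<in>F. c U * indicator U \<gamma>)"
    using groupoid_functionsE[OF assms(1)] by blast
  obtain F' c' where g: "finite F'" "F' \<subseteq> compact_open_bisections G" "\<And>\<gamma>. g \<gamma> = (\<Sum>U\<in>F'. c' U * indicator U \<gamma>)"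
    using groupoid_functionsE[OF assms(2)] by blast
  define d where "d U = (if U \<in> F then c U else 0) + (if U \<in> F' then c' U else 0)" for U
  show ?thesis
  proof (rule groupoid_functionsI)
    fix \<gamma>
    have "(\<Sum>U\<in>F \<union> F'. d U * indicator U \<gamma>) =
      (\<Sum>U\<in>F \<union> F'. (if U \<in> F then c U * indicator U \<gamma> else 0)) +
      (\<Sum>U\<in>F \<union> F'. (if U \<in> F' then c' U * indicator U \<gamma> else 0))"
      unfolding sum.distrib[symmetric] by (intro sum.cong refl) (simp add: d_def ring_distribs)
    also have "(\<Sum>U\<in>F \<union> F'. (if U \<in> F then c U * indicator U \<gamma> else 0)) = f \<gamma>"
      unfolding f(3) using f(1) g(1) by (intro sum.mono_neutral_cong_right) auto
    also have "(\<Sum>U\<in>F \<union> F'. (if U \<in> F' then c' U * indicator U \<gamma> else 0)) = g \<gamma>"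
      unfolding g(3) using f(1) g(1) by (intro sum.mono_neutral_cong_right) auto
    finally show "f \<gamma> + g \<gamma> = (\<Sum>U\<in>F \<union> F'. d U * indicator U \<gamma>)" by simp
  qed (use f g in auto)
qed

lemma groupoid_algebra_simps [simp]:
  "carrier (groupoid_algebra G) = groupoid_functions G"
  "f \<otimes>\<^bsub>groupoid_algebra G\<^esub> g = convolution G f g"
  "\<one>\<^bsub>groupoid_algebra G\<^esub> = indicator (units G)"
  "\<zero>\<^bsub>groupoid_algebra G\<^esub> = (\<lambda>\<gamma>. 0)"
  "f \<oplus>\<^bsub>groupoid_algebra G\<^esub> g = (\<lambda>\<gamma>. f \<gamma> + g \<gamma>)"
  by (simp_all add: groupoid_algebra_def)

lemma abelian_monoid_groupoid_algebra: "abelian_monoid (groupoid_algebra G)"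
  by (rule abelian_monoidI)
     (simp_all add: groupoid_functions_add groupoid_functions_zero add_ac)

lemma finsum_groupoid_algebra:
  assumes "finite A" "\<And>a. a \<in> A \<Longrightarrow> f a \<in> groupoid_functions G"
  shows "finsum (groupoid_algebra G) f A = (\<lambda>\<gamma>. \<Sum>a\<in>A. f a \<gamma>)"
proof -
  interpret abelian_monoid "groupoid_algebra G" by (rule abelian_monoid_groupoid_algebra)
  show ?thesis
    using assms
  proof (induction A rule: finite_induct)
    case (insert a A)
    then have "finsum (groupoid_algebra G) f (insert a A) =
      f a \<oplus>\<^bsub>groupoid_algebra G\<^esub> finsum (groupoid_algebra G) f A"
      by (intro finsum_insert) auto
    then show ?case using insert by simp
  qed simp
qed

section \<open>Stable finiteness excludes paradoxical families of bisections\<close>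

context compact_ample_groupoid
begin

text \<open>These sets are the atoms of the Boolean algebra generated by the \<open>B i\<close>.
  Whatever depends on x only through its membership pattern is therefore constant on each of
  finitely many compact open pieces.\<close>

lemma compact_open_units_pattern:
  assumes I: "finite I" and B: "\<And>i. i \<in> I \<Longrightarrow> B i \<in> compact_open_units G"
  shows "{x \<in> units G. {i \<in> I. x \<in> B i} = p} \<in> compact_open_units G"
proof (cases "p \<subseteq> I")
  case True
  \<comment> \<open>The intersection of the \<open>B i\<close> over p is written as a complement, so
    that p = {} gives the whole unit space.\<close>
  have eq: "{x \<in> units G. {i \<in> I. x \<in> B i} = p} =
    (units G - (\<Union>i\<in>p. units G - B i)) - (\<Union>i\<in>I - p. B i)"
    using True by auto
  have "finite p" using I True by (rule rev_finite_subset)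
  then show ?thesis
    unfolding eq using I B True
    by (intro compact_open_units_diff compact_open_units_UN units_compact_open) auto
next
  case False
  then have "{x \<in> units G. {i \<in> I. x \<in> B i} = p} = {}" by blast
  then show ?thesis by (simp only: compact_open_units_empty)
qed

text \<open>
  Fibrewise injections from the range layers and one extra copy of the unit space into the source
  layers, followed by the bisections, give matrices \<open>u\<close>, \<open>v\<close> in a corner with \<open>u v = e \<noteq> v u\<close>.
\<close>

lemma stably_finite_no_paradox:
  fixes U :: "nat \<Rightarrow> 'g set"
  assumes sf: "stably_finite (groupoid_algebra G :: ('g \<Rightarrow> 'k::comm_ring_1) ring)"
    and U: "\<And>i. i < m \<Longrightarrow> U i \<in> compact_open_bisections G"
  shows "\<exists>x\<in>units G. card {i. i < m \<and> x \<in> src G ` U i} \<le> card {i. i < m \<and> x \<in> rng G ` U i}"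
proof (rule ccontr)
  assume "\<not> ?thesis"
  then have less: "card {i. i < m \<and> x \<in> rng G ` U i} < card {i. i < m \<and> x \<in> src G ` U i}"
    if "x \<in> units G" for x using that by force
  let ?R = "groupoid_algebra G :: ('g \<Rightarrow> 'k) ring"
  let ?n = "Suc m"
  \<comment> \<open>Index \<open>m\<close> is the extra copy of the unit space: it has a range layer
    but no source layer.\<close>
  define R where "R i = (if i < m then rng G ` U i else units G)" for i
  define P where "P x = {i \<in> {..<?n}. x \<in> R i}" for x
  define Q where "Q x = {i \<in> {..<m}. x \<in> src G ` U i}" for x
  have R: "R i \<in> compact_open_units G" for i
    using U units_compact_open rng_compact_open_bisection by (simp add: R_def)
  have Rsub: "R i \<subseteq> units G" for i using compact_open_unitsD[OF R] by blast
  have card: "card (P x) \<le> card (Q x)" if "x \<in> units G" for x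
  proof -
    have "P x = insert m {i. i < m \<and> x \<in> rng G ` U i}"
      using that by (auto simp: P_def R_def less_Suc_eq)
    then have "card (P x) = Suc (card {i. i < m \<and> x \<in> rng G ` U i})" by simp
    also have "\<dots> \<le> card (Q x)" using less[OF that] by (simp add: Q_def)
    finally show ?thesis .
  qed
  \<comment> \<open>The injection is chosen for a pair of finite index sets, not for a unit. Hence
    \<open>\<sigma> x\<close> depends only on the membership patterns of x, and the sets
    \<open>A k i\<close> below are compact open.\<close>
  define s :: "nat set \<Rightarrow> nat set \<Rightarrow> nat \<Rightarrow> nat"
    where "s p q = (SOME f. f ` p \<subseteq> q \<and> inj_on f p)" for p q
  have s: "s p q ` p \<subseteq> q \<and> inj_on (s p q) p" if "finite p" "finite q" "card p \<le> card q" for p q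
    unfolding s_def using card_le_inj[OF that] by (rule someI_ex)
  have fin: "finite (P x)" "finite (Q x)" for x by (simp_all add: P_def Q_def)
  define \<sigma> where "\<sigma> x = s (P x) (Q x)" for x
  have \<sigma>: "\<sigma> x ` P x \<subseteq> Q x" "inj_on (\<sigma> x) (P x)" if "x \<in> units G" for x
    using s[OF fin card[OF that]] by (simp_all add: \<sigma>_def)
  \<comment> \<open>\<open>A k i\<close> consists of the units at which layer i is moved into source
    layer k; \<open>V k i\<close> is the part of \<open>U k\<close> over it. The convention that
    \<open>V k i\<close> is empty for k \<ge> m makes row \<open>m\<close> of the matrix
    \<open>v\<close> zero.\<close>
  define A where "A k i = {x \<in> units G. i \<in> P x \<and> \<sigma> x i = k}" for k i
  define V where "V k i = (if k < m then {u \<in> U k. src G u \<in> A k i} else {})" for k i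
  have A: "A k i \<in> compact_open_units G" for k i
  proof -
    let ?T = "{t \<in> Pow {..<?n} \<times> Pow {..<m}. i \<in> fst t \<and> s (fst t) (snd t) i = k}"
    have PQ: "(P x, Q x) \<in> Pow {..<?n} \<times> Pow {..<m}" for x by (auto simp: P_def Q_def)
    have P: "{x \<in> units G. P x = p} \<in> compact_open_units G" for p
      unfolding P_def by (rule compact_open_units_pattern) (simp_all add: R)
    have Q: "{x \<in> units G. Q x = q} \<in> compact_open_units G" for q
      unfolding Q_def
      by (rule compact_open_units_pattern) (simp_all add: U src_compact_open_bisection)
    have "A k i = (\<Union>t\<in>?T. {x \<in> units G. P x = fst t} \<inter> {x \<in> units G. Q x = snd t})"
      using PQ by (auto simp: A_def \<sigma>_def simp del: mem_Sigma_iff)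
    also have "\<dots> \<in> compact_open_units G"
    proof (rule compact_open_units_UN)
      have "finite (Pow {..<?n} \<times> Pow {..<m})" by simp
      then show "finite ?T" by (rule rev_finite_subset) auto
    qed (intro compact_open_units_Int P Q)
    finally show ?thesis .
  qed
  have V: "V k i \<in> compact_open_bisections G" for k i
    using compact_open_bisection_restrict[OF U A] compact_open_units_empty[THEN compact_open_units_bisection]
    by (auto simp: V_def)
  have VU: "V k i \<subseteq> U k" "\<not> k < m \<Longrightarrow> V k i = {}" for k i by (auto simp: V_def)
  \<comment> \<open>Injectivity of \<open>\<sigma>\<close>: no source layer receives two different
    layers at the same unit.\<close>
  have Vdisj: "V k i \<inter> V k j = {}" if "i \<noteq> j" for k i j
    using that by (auto simp: V_def A_def) (metis \<sigma>(2) inj_onD src_in_units)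
  have Vsrc: "src G ` V k i = A k i" if "k < m" for k i
  proof -
    have "x \<in> src G ` U k" if "x \<in> A k i" for x
      using that \<sigma>(1)[of x] by (auto simp: A_def Q_def)
    then show ?thesis using \<open>k < m\<close> by (auto simp: V_def)
  qed
  have Asum: "(\<Sum>k<m. indicator (A k i) x) = (indicator (R i) x :: 'k)" if "i < ?n" for i x
  proof (cases "x \<in> R i")
    case True
    then have x: "x \<in> units G" "i \<in> P x" using Rsub that by (auto simp: P_def)
    then have "\<sigma> x i < m" using \<sigma>(1)[of x] by (auto simp: Q_def)
    have "(\<Sum>k<m. indicator (A k i) x) = (\<Sum>k<m. if k = \<sigma> x i then 1 else 0 :: 'k)"
      using x by (intro sum.cong) (auto simp: A_def indicator_def)
    then show ?thesis using True \<open>\<sigma> x i < m\<close> by simp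
  next
    case False
    then have "x \<notin> A k i" for k by (auto simp: A_def P_def)
    then show ?thesis using False by simp
  qed
  let ?I = "{..<?n} \<times> {..<?n}"
  \<comment> \<open>\<open>u\<close> is the transpose of \<open>v\<close> with every bisection
    inverted. In \<open>u v\<close>, \<open>Vdisj\<close> removes the off-diagonal entries, while by
    \<open>Asum\<close> the sources \<open>A k i\<close> of the pieces in column i of
    \<open>v\<close> add up to \<open>R i\<close>.\<close>
  define E :: "nat \<times> nat \<Rightarrow> 'g \<Rightarrow> 'k" where "E = (\<lambda>(i, j)\<in>?I. if i = j then indicator (R i) else (\<lambda>\<gamma>. 0))"
  define u :: "nat \<times> nat \<Rightarrow> 'g \<Rightarrow> 'k" where "u = (\<lambda>(i, k)\<in>?I. indicator (ginv G ` V k i))"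
  define v :: "nat \<times> nat \<Rightarrow> 'g \<Rightarrow> 'k" where "v = (\<lambda>(k, i)\<in>?I. indicator (V k i))"
  note ind = groupoid_functions_indicator
  have R_mem: "(indicator (R i) :: 'g \<Rightarrow> 'k) \<in> groupoid_functions G" for i
    by (intro ind compact_open_units_bisection R)
  have carr: "E \<in> carrier (mat_ring ?n ?R)" "u \<in> carrier (mat_ring ?n ?R)" "v \<in> carrier (mat_ring ?n ?R)"
    by (auto simp: E_def u_def v_def mat_ring_def
        intro!: R_mem ind[OF V] ind[OF compact_open_bisection_inv[OF V]] groupoid_functions_zero)
  have ind_empty: "(indicator {} :: 'g \<Rightarrow> 'k) = (\<lambda>\<gamma>. 0)" by (simp add: fun_eq_iff)
  have uR: "rng G \<gamma> \<in> R i" if "i < ?n" "\<gamma> \<in> ginv G ` V k i" for \<gamma> i k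
    using that by (auto simp: V_def A_def P_def split: if_splits)
  have vR: "rng G \<gamma> \<in> R k" if "\<gamma> \<in> V k i" for \<gamma> i k
    using that by (auto simp: V_def R_def split: if_splits)
  have uR': "src G \<gamma> \<in> R k" if "\<gamma> \<in> ginv G ` V k i" for \<gamma> i k
    using that vR by auto
  have vR': "src G \<gamma> \<in> R i" if "i < ?n" "\<gamma> \<in> V k i" for \<gamma> i k
    using that by (auto simp: V_def A_def P_def split: if_splits)
  have Rself: "\<gamma> \<in> R i \<Longrightarrow> rng G \<gamma> \<in> R i" "\<gamma> \<in> R i \<Longrightarrow> src G \<gamma> \<in> R i" for \<gamma> i
    using Rsub[of i] by (auto simp: subset_iff)
  have left: "E \<otimes>\<^bsub>mat_ring ?n ?R\<^esub> a = a"
    if a: "a \<in> carrier (mat_ring ?n ?R)"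
      and supp: "\<And>i j \<gamma>. i < ?n \<Longrightarrow> j < ?n \<Longrightarrow> a (i, j) \<gamma> \<noteq> 0 \<Longrightarrow> rng G \<gamma> \<in> R i" for a
  proof (rule extensionalityI[where A = ?I])
    show "E \<otimes>\<^bsub>mat_ring ?n ?R\<^esub> a \<in> extensional ?I" by (simp add: mat_ring_mult)
    show "a \<in> extensional ?I" using a by (simp add: mat_ring_def PiE_def)
    fix t assume "t \<in> ?I"
    then obtain i j where t: "t = (i, j)" "i < ?n" "j < ?n" by auto
    have mem: "a (i, j) \<in> groupoid_functions G" using a t by (auto simp: mat_ring_def)
    have *: "convolution G (E (i, k)) (a (k, j)) = (if k = i then a (i, j) else (\<lambda>\<gamma>. 0))" if "k < ?n" for k
      using t that convolution_indicator_unit_left[OF Rsub supp[OF t(2,3)]]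
      by (auto simp: E_def convolution_zero_left)
    have "(E \<otimes>\<^bsub>mat_ring ?n ?R\<^esub> a) t = (\<Oplus>\<^bsub>?R\<^esub>k\<in>{..<?n}. convolution G (E (i, k)) (a (k, j)))"
      using t by (simp add: mat_ring_mult)
    also have "\<dots> = (\<lambda>\<gamma>. \<Sum>k<?n. convolution G (E (i, k)) (a (k, j)) \<gamma>)"
      using mem groupoid_functions_zero by (intro finsum_groupoid_algebra) (auto simp: *)
    also have "\<dots> = (\<lambda>\<gamma>. \<Sum>k<?n. if k = i then a (i, j) \<gamma> else 0)"
      by (intro ext sum.cong refl) (simp add: *)
    also have "\<dots> = a t" using t by (simp add: fun_eq_iff del: sum.lessThan_Suc)
    finally show "(E \<otimes>\<^bsub>mat_ring ?n ?R\<^esub> a) t = a t" .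
  qed
  have right: "a \<otimes>\<^bsub>mat_ring ?n ?R\<^esub> E = a"
    if a: "a \<in> carrier (mat_ring ?n ?R)"
      and supp: "\<And>i j \<gamma>. i < ?n \<Longrightarrow> j < ?n \<Longrightarrow> a (i, j) \<gamma> \<noteq> 0 \<Longrightarrow> src G \<gamma> \<in> R j" for a
  proof (rule extensionalityI[where A = ?I])
    show "a \<otimes>\<^bsub>mat_ring ?n ?R\<^esub> E \<in> extensional ?I" by (simp add: mat_ring_mult)
    show "a \<in> extensional ?I" using a by (simp add: mat_ring_def PiE_def)
    fix t assume "t \<in> ?I"
    then obtain i j where t: "t = (i, j)" "i < ?n" "j < ?n" by auto
    have mem: "a (i, j) \<in> groupoid_functions G" using a t by (auto simp: mat_ring_def)
    have *: "convolution G (a (i, k)) (E (k, j)) = (if k = j then a (i, j) else (\<lambda>\<gamma>. 0))" if "k < ?n" for k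
      using t that convolution_indicator_unit_right[OF Rsub supp[OF t(2,3)]]
      by (auto simp: E_def convolution_zero_right)
    have "(a \<otimes>\<^bsub>mat_ring ?n ?R\<^esub> E) t = (\<Oplus>\<^bsub>?R\<^esub>k\<in>{..<?n}. convolution G (a (i, k)) (E (k, j)))"
      using t by (simp add: mat_ring_mult)
    also have "\<dots> = (\<lambda>\<gamma>. \<Sum>k<?n. convolution G (a (i, k)) (E (k, j)) \<gamma>)"
      using mem groupoid_functions_zero by (intro finsum_groupoid_algebra) (auto simp: *)
    also have "\<dots> = (\<lambda>\<gamma>. \<Sum>k<?n. if k = j then a (i, j) \<gamma> else 0)"
      by (intro ext sum.cong refl) (simp add: *)
    also have "\<dots> = a t" using t by (simp add: fun_eq_iff del: sum.lessThan_Suc)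
    finally show "(a \<otimes>\<^bsub>mat_ring ?n ?R\<^esub> E) t = a t" .
  qed
  have EE: "E \<otimes>\<^bsub>mat_ring ?n ?R\<^esub> E = E"
    using Rself by (intro left carr) (auto simp: E_def indicator_def split: if_splits)
  have corner_u: "u \<in> corner (mat_ring ?n ?R) E"
  proof -
    have "E \<otimes>\<^bsub>mat_ring ?n ?R\<^esub> u = u"
      using uR by (intro left carr) (auto simp: u_def indicator_def split: if_splits)
    moreover have "u \<otimes>\<^bsub>mat_ring ?n ?R\<^esub> E = u"
      using uR' by (intro right carr) (auto simp: u_def indicator_def split: if_splits)
    ultimately show ?thesis unfolding corner_def using carr(2) by force
  qed
  have corner_v: "v \<in> corner (mat_ring ?n ?R) E"
  proof -
    have "E \<otimes>\<^bsub>mat_ring ?n ?R\<^esub> v = v"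
      using vR by (intro left carr) (auto simp: v_def indicator_def split: if_splits)
    moreover have "v \<otimes>\<^bsub>mat_ring ?n ?R\<^esub> E = v"
      using vR' by (intro right carr) (auto simp: v_def indicator_def split: if_splits)
    ultimately show ?thesis unfolding corner_def using carr(3) by force
  qed
  have uv: "u \<otimes>\<^bsub>mat_ring ?n ?R\<^esub> v = E"
  proof (rule extensionalityI[where A = ?I])
    show "u \<otimes>\<^bsub>mat_ring ?n ?R\<^esub> v \<in> extensional ?I" by (simp add: mat_ring_mult)
    show "E \<in> extensional ?I" by (simp add: E_def)
    fix t assume "t \<in> ?I"
    then obtain i j where t: "t = (i, j)" "i < ?n" "j < ?n" by auto
    let ?W = "\<lambda>k. if i = j \<and> k < m then A k i else {}"
    have *: "convolution G (u (i, k)) (v (k, j)) = indicator (?W k)" if "k < ?n" for k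
    proof (cases "k < m")
      case True
      have "convolution G (u (i, k)) (v (k, j)) = indicator (src G ` (V k i \<inter> V k j))"
        using convolution_indicator_inv[OF _ _ VU(1) VU(1), of k i j] U[OF True] t that
        by (simp add: u_def v_def compact_open_bisections_def)
      then show ?thesis using Vdisj[of i j k] Vsrc[OF True, of i] True by auto
    next
      case False
      then show ?thesis using t that VU(2)[of k]
        by (simp add: u_def v_def ind_empty convolution_zero_left)
    qed
    have W: "?W k \<in> compact_open_bisections G" for k
      using A compact_open_units_empty by (auto intro: compact_open_units_bisection)
    have "(u \<otimes>\<^bsub>mat_ring ?n ?R\<^esub> v) t = (\<Oplus>\<^bsub>?R\<^esub>k\<in>{..<?n}. convolution G (u (i, k)) (v (k, j)))"
      using t by (simp add: mat_ring_mult)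
    also have "\<dots> = (\<lambda>\<gamma>. \<Sum>k<?n. convolution G (u (i, k)) (v (k, j)) \<gamma>)"
      by (rule finsum_groupoid_algebra, simp, subst *, simp, rule groupoid_functions_indicator, rule W)
    also have "\<dots> = (\<lambda>\<gamma>. \<Sum>k<m. if i = j then indicator (A k i) \<gamma> else 0)"
      by (auto simp: fun_eq_iff * intro!: sum.cong)
    also have "\<dots> = E t" using t by (auto simp: fun_eq_iff E_def Asum)
    finally show "(u \<otimes>\<^bsub>mat_ring ?n ?R\<^esub> v) t = E t" .
  qed
  have "dedekind_finite (mat_ring ?n ?R)" using sf by (simp add: stably_finite_def)
  then have "v \<otimes>\<^bsub>mat_ring ?n ?R\<^esub> u = E"
    using EE corner_u corner_v uv carr(1) unfolding dedekind_finite_def by blast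
  then have "(v \<otimes>\<^bsub>mat_ring ?n ?R\<^esub> u) (m, m) = indicator (units G)"
    by (simp add: E_def R_def)
  \<comment> \<open>Row \<open>m\<close> of \<open>v\<close> vanishes, whereas the entry of
    \<open>E\<close> at this place is the indicator of the unit space. Since 1 differs from 0 in K,
    the two disagree at any unit.\<close>
  moreover have "(v \<otimes>\<^bsub>mat_ring ?n ?R\<^esub> u) (m, m) = (\<lambda>\<gamma>. 0)"
  proof -
    have zero: "convolution G (v (m, i)) (u (i, m)) = (\<lambda>\<gamma>. 0)" if "i < ?n" for i
      using that VU(2)[of m i] by (simp add: v_def ind_empty convolution_zero_left)
    have "(v \<otimes>\<^bsub>mat_ring ?n ?R\<^esub> u) (m, m) = (\<Oplus>\<^bsub>?R\<^esub>i\<in>{..<?n}. convolution G (v (m, i)) (u (i, m)))"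
      by (simp add: mat_ring_mult)
    also have "\<dots> = (\<lambda>\<gamma>. \<Sum>i<?n. convolution G (v (m, i)) (u (i, m)) \<gamma>)"
      by (intro finsum_groupoid_algebra) (auto simp: zero groupoid_functions_zero)
    also have "\<dots> = (\<lambda>\<gamma>. 0)" by (simp add: zero fun_eq_iff)
    finally show ?thesis .
  qed
  ultimately have "indicator (units G) (src G undefined) = (0 :: 'k)" by metis
  then show False by simp
qed

end

section \<open>Invariant functionals\<close>

context compact_ample_groupoid
begin

text \<open>A uniform lower bound a > 0 can be scaled above the total error of rounding the
  coefficients down to integers. The rounded coefficients are the multiplicities of a finite family
  of bisections, to which \<open>stably_finite_no_paradox\<close> applies.\<close>

lemma stably_finite_cone:
  fixes c :: "'g set \<Rightarrow> real"
  assumes sf: "stably_finite (groupoid_algebra G :: ('g \<Rightarrow> 'k::comm_ring_1) ring)"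
    and F: "finite F" "F \<subseteq> compact_open_bisections G"
    and c: "\<And>U. U \<in> F \<Longrightarrow> 0 \<le> c U"
    and le: "\<And>x. x \<in> units G \<Longrightarrow>
      a \<le> (\<Sum>U\<in>F. c U * (indicator (src G ` U) x - indicator (rng G ` U) x))"
  shows "a \<le> 0"
proof (rule ccontr)
  assume "\<not> a \<le> 0"
  then have a: "a > 0" by simp
  \<comment> \<open>This gives M a = card F + 1, one more than the rounding errors can contribute:
    there are card F of them, each at most 1.\<close>
  define M where "M = (card F + 1) / a"
  have M: "M > 0" "M * a = card F + 1" using a by (simp_all add: M_def)
  define k where "k U = nat \<lfloor>M * c U\<rfloor>" for U
  have k: "real (k U) \<le> M * c U" "M * c U \<le> real (k U) + 1" if "U \<in> F" for U
  proof -
    have "0 \<le> M * c U" using M c[OF that] by simp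
    then show "real (k U) \<le> M * c U" "M * c U \<le> real (k U) + 1" unfolding k_def by linarith+
  qed
  \<comment> \<open>Each \<open>U\<close> is listed \<open>k U\<close> times, and \<open>b\<close>
    numbers the list; repetitions are allowed in \<open>stably_finite_no_paradox\<close>.\<close>
  define I where "I = (SIGMA U:F. {..<k U})"
  have fI: "finite I" using F by (simp add: I_def)
  obtain b where b: "bij_betw b {0..<card I} I" using ex_bij_betw_nat_finite[OF fI] by blast
  have bF: "fst (b i) \<in> F" if "i < card I" for i
  proof -
    have "b i \<in> I" using bij_betwE[OF b] that by simp
    then show ?thesis by (auto simp: I_def)
  qed
  have count: "real (card {i. i < card I \<and> x \<in> f ` fst (b i)}) = (\<Sum>U\<in>F. real (k U) * indicat_real (f ` U) x)"
    for x and f :: "'g \<Rightarrow> 'g"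
  proof -
    have "{i. i < card I \<and> x \<in> f ` fst (b i)} = {i \<in> {0..<card I}. x \<in> f ` fst (b i)}" by auto
    then have "real (card {i. i < card I \<and> x \<in> f ` fst (b i)}) =
        (\<Sum>i\<in>{0..<card I}. indicator (f ` fst (b i)) x)"
      by (simp add: indicator_def of_bool_def flip: sum.inter_filter)
    also have "\<dots> = (\<Sum>p\<in>I. indicator (f ` fst p) x)"
      by (rule sum.reindex_bij_betw[OF b])
    also have "\<dots> = (\<Sum>U\<in>F. \<Sum>j<k U. indicator (f ` U) x)"
      unfolding I_def using F by (subst sum.Sigma) (auto simp: case_prod_beta)
    finally show ?thesis by simp
  qed
  obtain x where x: "x \<in> units G"
    "card {i. i < card I \<and> x \<in> src G ` fst (b i)} \<le> card {i. i < card I \<and> x \<in> rng G ` fst (b i)}"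
    using stably_finite_no_paradox[OF sf, of "card I" "\<lambda>i. fst (b i)"] bF F(2) by blast
  define h where "h U = (indicator (src G ` U) x - indicator (rng G ` U) x :: real)" for U
  have h: "\<bar>h U\<bar> \<le> 1" for U by (simp add: h_def indicator_def)
  have "(\<Sum>U\<in>F. real (k U) * indicat_real (src G ` U) x) \<le> (\<Sum>U\<in>F. real (k U) * indicat_real (rng G ` U) x)"
    unfolding count[symmetric] using x(2) by simp
  then have neg: "(\<Sum>U\<in>F. k U * h U) \<le> 0"
    by (simp add: h_def right_diff_distrib sum_subtractf)
  have "M * a \<le> M * (\<Sum>U\<in>F. c U * h U)"
    using le[OF x(1)] M by (intro mult_left_mono) (simp_all add: h_def)
  also have "\<dots> = (\<Sum>U\<in>F. (M * c U - k U) * h U) + (\<Sum>U\<in>F. k U * h U)"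
    unfolding sum_distrib_left sum.distrib[symmetric] by (intro sum.cong refl) (simp add: algebra_simps)
  also have "\<dots> \<le> (\<Sum>U\<in>F. 1) + 0"
  proof (intro add_mono sum_mono neg)
    fix U assume "U \<in> F"
    from k[OF this] have "\<bar>(M * c U - k U) * h U\<bar> \<le> 1 * 1"
      unfolding abs_mult using h by (intro mult_mono) auto
    then show "(M * c U - k U) * h U \<le> 1" by linarith
  qed
  finally show False using M(2) by simp
qed

text \<open>Only the inequality from source to range is prescribed, with all bounds \<open>v\<close>
  equal to 0. Inverting a bisection exchanges source and range and yields the reverse
  inequality.\<close>

lemma exists_invariant_functional:
  assumes "stably_finite (groupoid_algebra G :: ('g \<Rightarrow> 'k::comm_ring_1) ring)"
  obtains \<phi> where "positive_functional (units G) \<phi>"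
    "\<And>U. U \<in> compact_open_bisections G \<Longrightarrow> \<phi> (indicator (src G ` U)) = \<phi> (indicator (rng G ` U))"
proof -
  let ?l = "\<lambda>U x. indicator (src G ` U) x - indicator (rng G ` U) x :: real"
  have "\<exists>\<phi>. positive_functional (units G) \<phi> \<and> (\<forall>U\<in>compact_open_bisections G. \<phi> (?l U) \<le> 0)"
  proof (rule positive_functional_exists)
    show "units G \<noteq> {}" using src_in_units by blast
    show "?l U \<in> bounded_on (units G)" for U
      by (intro bounded_on_diff bounded_on_indicator)
    fix F c a
    assume "finite F" "F \<subseteq> compact_open_bisections G" "\<And>U. U \<in> F \<Longrightarrow> (0::real) \<le> c U"
      "\<And>x. x \<in> units G \<Longrightarrow> a \<le> (\<Sum>U\<in>F. c U * ?l U x)"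
    from stably_finite_cone[OF assms this] show "a \<le> (\<Sum>U\<in>F. c U * 0)" by simp
  qed
  then obtain \<phi> where \<phi>: "positive_functional (units G) \<phi>"
    and le: "\<And>U. U \<in> compact_open_bisections G \<Longrightarrow> \<phi> (?l U) \<le> 0" by blast
  interpret positive_functional "units G" \<phi> by fact
  have le': "\<phi> (indicator (src G ` U)) \<le> \<phi> (indicator (rng G ` U))"
    if "U \<in> compact_open_bisections G" for U
    using le[OF that] diff[OF bounded_on_indicator bounded_on_indicator, of "src G ` U" "rng G ` U"]
    by simp
  show thesis
  proof (rule that[OF \<phi>], rule antisym)
    fix U assume "U \<in> compact_open_bisections G"
    from le'[OF compact_open_bisection_inv[OF this]]
    show "\<phi> (indicator (rng G ` U)) \<le> \<phi> (indicator (src G ` U))"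
      by (simp add: src_image_inv rng_image_inv)
  qed (rule le')
qed

text \<open>The inner measure \<open>\<mu>\<close> is imposed as an upper bound on every open set.
  The cone condition is a compactness argument: finitely many open sets can be shrunk to compact
  open subsets without losing a uniform lower bound of a combination. The upper bound then becomes
  an equality, on compact open sets by passing to complements and on open sets by
  monotonicity.\<close>

lemma inner_regular_functional_exists:
  assumes "positive_functional (units G) \<phi>\<^sub>0"
  obtains \<phi> where "positive_functional (units G) \<phi>"
    "\<And>W. open W \<Longrightarrow> W \<subseteq> units G \<Longrightarrow>
      \<phi> (indicator W) = (SUP K\<in>{K \<in> compact_open_units G. K \<subseteq> W}. \<phi>\<^sub>0 (indicator K))"
    "\<And>K. K \<in> compact_open_units G \<Longrightarrow> \<phi> (indicator K) = \<phi>\<^sub>0 (indicator K)"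
proof -
  interpret p0: positive_functional "units G" \<phi>\<^sub>0 by fact
  define \<mu> where "\<mu> W = (SUP K\<in>{K \<in> compact_open_units G. K \<subseteq> W}. \<phi>\<^sub>0 (indicator K))" for W
  have bdd: "bdd_above ((\<lambda>K. \<phi>\<^sub>0 (indicator K)) ` A)" for A
  proof (rule bdd_aboveI2)
    fix K
    have "\<bar>\<phi>\<^sub>0 (indicator K)\<bar> \<le> 1" by (rule p0.abs_le) (simp add: indicator_def)
    then show "\<phi>\<^sub>0 (indicator K) \<le> 1" by simp
  qed
  have up: "\<phi>\<^sub>0 (indicator K) \<le> \<mu> W" if "K \<in> compact_open_units G" "K \<subseteq> W" for K W
    unfolding \<mu>_def using that by (intro cSUP_upper bdd) auto
  have least: "\<mu> W \<le> z" if "\<And>K. K \<in> compact_open_units G \<Longrightarrow> K \<subseteq> W \<Longrightarrow> \<phi>\<^sub>0 (indicator K) \<le> z" for W z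
    unfolding \<mu>_def using that compact_open_units_empty by (intro cSUP_least) auto
  have mono0: "\<phi>\<^sub>0 (indicator K) \<le> \<phi>\<^sub>0 (indicator L)" if "K \<subseteq> L" for K L
    using that by (intro p0.mono bounded_on_indicator) (auto simp: indicator_def)
  have \<mu>K: "\<mu> K = \<phi>\<^sub>0 (indicator K)" if "K \<in> compact_open_units G" for K
    using that by (intro antisym least up mono0) auto
  let ?S = "{W. open W \<and> W \<subseteq> units G}"
  have "\<exists>\<phi>. positive_functional (units G) \<phi> \<and> (\<forall>W\<in>?S. \<phi> (\<lambda>x. indicator W x) \<le> \<mu> W)"
  proof (rule positive_functional_exists)
    show "units G \<noteq> {}" using src_in_units by blast
    show "(\<lambda>x. indicator W x) \<in> bounded_on (units G)" for W :: "'g set"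
      by (rule bounded_on_indicator)
    fix F c a
    assume F: "finite F" "F \<subseteq> ?S" and c: "\<And>W. W \<in> F \<Longrightarrow> (0::real) \<le> c W"
      and le: "\<And>x. x \<in> units G \<Longrightarrow> a \<le> (\<Sum>W\<in>F. c W * indicator W x)"
    have "\<exists>K\<in>compact_open_units G. x \<in> K \<and> K \<subseteq> units G \<inter> \<Inter>{W \<in> F. x \<in> W}" if "x \<in> units G" for x
    proof (rule compact_open_basis)
      have "open (\<Inter>{W \<in> F. x \<in> W})" using F by (intro open_Inter) auto
      then show "openin (top_of_set (units G)) (units G \<inter> \<Inter>{W \<in> F. x \<in> W})"
        by (simp add: openin_units open_Int open_units)
    qed (use that in auto)
    then obtain N where N: "\<And>x. x \<in> units G \<Longrightarrow> N x \<in> compact_open_units G"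
      "\<And>x. x \<in> units G \<Longrightarrow> x \<in> N x"
      "\<And>x. x \<in> units G \<Longrightarrow> N x \<subseteq> units G \<inter> \<Inter>{W \<in> F. x \<in> W}" by metis
    obtain Y where Y: "Y \<subseteq> units G" "finite Y" "units G \<subseteq> (\<Union>y\<in>Y. N y)"
    proof (rule compactE_image[OF compact_units])
      show "open (N x)" if "x \<in> units G" for x using compact_open_unitsD[OF N(1)[OF that]] by blast
      show "units G \<subseteq> (\<Union>x\<in>units G. N x)" using N(2) by auto
    qed
    \<comment> \<open>A point x of \<open>N y\<close> lies in \<open>K W\<close> whenever y lies in
      \<open>W\<close>. As the coefficients are nonnegative, the combination of the
      \<open>K W\<close> at x is at least that of the \<open>W\<close> at y, so the bound a carries
      over.\<close>
    define K where "K W = (\<Union>y\<in>{y \<in> Y. y \<in> W}. N y)" for W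
    have K: "K W \<in> compact_open_units G" for W
      unfolding K_def by (rule compact_open_units_UN) (use Y N in auto)
    have KW: "K W \<subseteq> W" if "W \<in> F" for W
      unfolding K_def using N(3) Y(1) that by fastforce
    have "\<phi>\<^sub>0 (\<lambda>x. a) \<le> \<phi>\<^sub>0 (\<lambda>x. \<Sum>W\<in>F. c W * indicator (K W) x)"
    proof (rule p0.mono)
      show "(\<lambda>x. \<Sum>W\<in>F. c W * indicator (K W) x) \<in> bounded_on (units G)"
        by (intro bounded_on_sum bounded_on_scale bounded_on_indicator)
      fix x assume "x \<in> units G"
      then obtain y where y: "y \<in> Y" "x \<in> N y" using Y by auto
      have "a \<le> (\<Sum>W\<in>F. c W * indicator W y)" using le y Y by auto
      also have "\<dots> \<le> (\<Sum>W\<in>F. c W * indicator (K W) x)"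
        using y c by (intro sum_mono mult_left_mono) (auto simp: indicator_def K_def)
      finally show "a \<le> (\<Sum>W\<in>F. c W * indicator (K W) x)" .
    qed simp
    also have "\<dots> = (\<Sum>W\<in>F. c W * \<phi>\<^sub>0 (indicator (K W)))"
      by (simp add: p0.sum p0.scale bounded_on_scale)
    also have "\<dots> \<le> (\<Sum>W\<in>F. c W * \<mu> W)"
      using c K KW by (intro sum_mono mult_left_mono up) auto
    finally show "a \<le> (\<Sum>W\<in>F. c W * \<mu> W)" by (simp add: p0.const)
  qed
  then obtain \<phi> where \<phi>: "positive_functional (units G) \<phi>"
    and le: "\<And>W. open W \<Longrightarrow> W \<subseteq> units G \<Longrightarrow> \<phi> (indicator W) \<le> \<mu> W" by auto
  interpret positive_functional "units G" \<phi> by fact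
  have \<phi>K: "\<phi> (indicator K) = \<phi>\<^sub>0 (indicator K)" if K: "K \<in> compact_open_units G" for K
  proof (rule antisym)
    show "\<phi> (indicator K) \<le> \<phi>\<^sub>0 (indicator K)"
      using le[of K] compact_open_unitsD[OF K] \<mu>K[OF K] by simp
    \<comment> \<open>The upper bound also holds on the complement, where each functional has value
      1 minus its value on \<open>K\<close>; so it cannot be strict on \<open>K\<close>.\<close>
    let ?L = "units G - K"
    have L: "?L \<in> compact_open_units G" by (rule compact_open_units_diff_units[OF K])
    have c: "\<psi> (indicator ?L) = 1 - \<psi> (indicator K)" if "positive_functional (units G) \<psi>" for \<psi>
    proof -
      interpret q: positive_functional "units G" \<psi> by fact
      have "\<psi> (indicator ?L) = \<psi> (\<lambda>x. 1 - indicator K x)"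
        by (intro q.cong bounded_on_indicator) (auto simp: indicator_def)
      also have "\<dots> = 1 - \<psi> (indicator K)"
        using q.diff[OF bounded_on_const bounded_on_indicator, of 1 K] by (simp add: q.const)
      finally show ?thesis .
    qed
    have "\<phi> (indicator ?L) \<le> \<phi>\<^sub>0 (indicator ?L)"
      using le[of ?L] compact_open_unitsD[OF L] \<mu>K[OF L] by simp
    then show "\<phi>\<^sub>0 (indicator K) \<le> \<phi> (indicator K)"
      unfolding c[OF \<phi>] c[OF assms] by simp
  qed
  have "\<phi> (indicator W) = \<mu> W" if W: "open W" "W \<subseteq> units G" for W
  proof (rule antisym)
    show "\<mu> W \<le> \<phi> (indicator W)"
    proof (rule least)
      fix K assume K: "K \<in> compact_open_units G" "K \<subseteq> W"
      then have "\<phi> (indicator K) \<le> \<phi> (indicator W)"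
        by (intro mono bounded_on_indicator) (auto simp: indicator_def)
      then show "\<phi>\<^sub>0 (indicator K) \<le> \<phi> (indicator W)" using \<phi>K[OF K(1)] by simp
    qed
  qed (rule le[OF W])
  then show thesis using that[OF \<phi>] \<phi>K unfolding \<mu>_def by blast
qed

end

locale invariant_functional = compact_ample_groupoid G + positive_functional "units G" \<phi>
  for G :: "'g::topological_space groupoid_data" (structure) and \<phi> +
  assumes invariant: "W \<in> open_bisections G \<Longrightarrow>
    \<phi> (indicator (src G ` W)) = \<phi> (indicator (rng G ` W))"

text \<open>A compact open \<open>K\<close> in the source of an open bisection \<open>W\<close>
  lifts to a compact open bisection inside \<open>W\<close>, whose range has the same measure as
  \<open>K\<close> and lies in the range of \<open>W\<close>. The supremum over \<open>K\<close>
  gives one inequality, inverting \<open>W\<close> the other.\<close>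

theorem (in compact_ample_groupoid) exists_open_invariant_functional:
  assumes "stably_finite (groupoid_algebra G :: ('g \<Rightarrow> 'k::comm_ring_1) ring)"
  shows "\<exists>\<phi>. invariant_functional G \<phi>"
proof -
  obtain \<phi>\<^sub>0 where \<phi>0: "positive_functional (units G) \<phi>\<^sub>0"
    and inv0: "\<And>U. U \<in> compact_open_bisections G \<Longrightarrow>
      \<phi>\<^sub>0 (indicator (src G ` U)) = \<phi>\<^sub>0 (indicator (rng G ` U))"
    using exists_invariant_functional[OF assms] by blast
  obtain \<phi> where \<phi>: "positive_functional (units G) \<phi>"
    and reg: "\<And>W. open W \<Longrightarrow> W \<subseteq> units G \<Longrightarrow>
      \<phi> (indicator W) = (SUP K\<in>{K \<in> compact_open_units G. K \<subseteq> W}. \<phi>\<^sub>0 (indicator K))"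
    and ext: "\<And>K. K \<in> compact_open_units G \<Longrightarrow> \<phi> (indicator K) = \<phi>\<^sub>0 (indicator K)"
    using inner_regular_functional_exists[OF \<phi>0] by blast
  interpret positive_functional "units G" \<phi> by fact
  have le: "\<phi> (indicator (src G ` W)) \<le> \<phi> (indicator (rng G ` W))" if W: "W \<in> open_bisections G" for W
  proof -
    have "open W" using W by (simp add: open_bisections_def)
    then have o: "open (src G ` W)" "src G ` W \<subseteq> units G" by (auto simp: open_src_image)
    show ?thesis
      unfolding reg[OF o]
    proof (rule cSUP_least)
      show "{K \<in> compact_open_units G. K \<subseteq> src G ` W} \<noteq> {}" using compact_open_units_empty by blast
      fix K assume "K \<in> {K \<in> compact_open_units G. K \<subseteq> src G ` W}"
      then have K: "K \<in> compact_open_units G" "open K" "compact K" "K \<subseteq> src G ` W"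
        using compact_open_unitsD by auto
      let ?V = "{w \<in> W. src G w \<in> K}"
      note V = open_bisection_restrict[OF W K(2-4)]
      have "\<phi>\<^sub>0 (indicator K) = \<phi>\<^sub>0 (indicator (rng G ` ?V))" using inv0[OF V(1)] V(2) by simp
      also have "\<dots> = \<phi> (indicator (rng G ` ?V))"
        using ext[OF rng_compact_open_bisection[OF V(1)]] by simp
      also have "\<dots> \<le> \<phi> (indicator (rng G ` W))"
        by (intro mono bounded_on_indicator) (auto simp: indicator_def)
      finally show "\<phi>\<^sub>0 (indicator K) \<le> \<phi> (indicator (rng G ` W))" .
    qed
  qed
  have eq: "\<phi> (indicator (src G ` W)) = \<phi> (indicator (rng G ` W))" if "W \<in> open_bisections G" for W
    using le[OF that] le[OF open_bisection_inv[OF that]]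
    by (simp add: src_image_inv rng_image_inv)
  have "invariant_functional G \<phi>"
    by unfold_locales (rule eq)
  then show ?thesis by blast
qed

context invariant_functional
begin

lemma invariant_mean_functional: "invariant_mean G (\<lambda>U. \<phi> (indicator U))"
  unfolding invariant_mean_def mean_def
proof (intro conjI ballI impI)
  fix U V
  have "\<phi> (\<lambda>x. 0) \<le> \<phi> (indicator U)"
    by (rule mono) simp_all
  then show "0 \<le> \<phi> (indicator U)" by (simp add: const)
  assume "U \<inter> V = {}"
  then have "(indicator (U \<union> V) :: 'g \<Rightarrow> real) = (\<lambda>x. indicator U x + indicator V x)"
    by (auto simp: fun_eq_iff indicator_def)
  then show "\<phi> (indicator (U \<union> V)) = \<phi> (indicator U) + \<phi> (indicator V)"
    using add[OF bounded_on_indicator bounded_on_indicator, of U V] by simp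
next
  fix U assume "U \<in> compact_open_bisections G"
  then have U: "U \<in> open_bisections G" by (simp add: compact_open_bisections_eq)
  then show "\<phi> (indicator (set_mul G (set_inv G U) U)) = \<phi> (indicator (set_mul G U (set_inv G U)))"
    using invariant[OF U] by (simp add: open_bisections_def set_mul_inv_left set_mul_inv_right)
qed

lemma normalized_mean_functional: "normalized_mean G (\<lambda>U. \<phi> (indicator U))"
proof -
  have "\<phi> (indicator (units G)) = \<phi> (\<lambda>x. 1)" by (intro cong bounded_on_indicator) simp
  then show ?thesis by (simp add: normalized_mean_def one)
qed

end

section \<open>The trace on the complex groupoid algebra\<close>

definition complex_bounded_on :: "'a set \<Rightarrow> ('a \<Rightarrow> complex) set"
  where "complex_bounded_on X = {f. \<exists>b. \<forall>x\<in>X. cmod (f x) \<le> b}"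

lemma complex_bounded_onI: "(\<And>x. x \<in> X \<Longrightarrow> cmod (f x) \<le> b) \<Longrightarrow> f \<in> complex_bounded_on X"
  by (auto simp: complex_bounded_on_def)

lemma complex_bounded_on_Re: "f \<in> complex_bounded_on X \<Longrightarrow> (\<lambda>x. Re (f x)) \<in> bounded_on X"
  and complex_bounded_on_Im: "f \<in> complex_bounded_on X \<Longrightarrow> (\<lambda>x. Im (f x)) \<in> bounded_on X"
  unfolding complex_bounded_on_def bounded_on_def
  using abs_Re_le_cmod abs_Im_le_cmod order_trans by blast+

lemma complex_bounded_on_scale:
  assumes "f \<in> complex_bounded_on X"
  shows "(\<lambda>x. c * f x) \<in> complex_bounded_on X"
proof -
  obtain b where b: "\<And>x. x \<in> X \<Longrightarrow> cmod (f x) \<le> b" using assms by (auto simp: complex_bounded_on_def)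
  show ?thesis
    by (rule complex_bounded_onI[of _ _ "cmod c * b"]) (simp add: norm_mult mult_left_mono b)
qed

lemma complex_bounded_on_add:
  assumes "f \<in> complex_bounded_on X" "g \<in> complex_bounded_on X"
  shows "(\<lambda>x. f x + g x) \<in> complex_bounded_on X"
proof -
  obtain b c where b: "\<And>x. x \<in> X \<Longrightarrow> cmod (f x) \<le> b" "\<And>x. x \<in> X \<Longrightarrow> cmod (g x) \<le> c"
    using assms by (auto simp: complex_bounded_on_def)
  show ?thesis
    by (rule complex_bounded_onI[of _ _ "b + c"]) (intro norm_triangle_mono b)
qed

lemma complex_bounded_on_sum:
  assumes "\<And>i. i \<in> I \<Longrightarrow> f i \<in> complex_bounded_on X"
  shows "(\<lambda>x. \<Sum>i\<in>I. f i x) \<in> complex_bounded_on X"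
proof -
  have zero: "(\<lambda>x. 0) \<in> complex_bounded_on X" by (rule complex_bounded_onI[of _ _ 0]) simp
  show ?thesis
    using assms zero
    by (induction I rule: infinite_finite_induct) (simp_all add: complex_bounded_on_add)
qed

lemma complex_bounded_on_indicator: "indicator A \<in> complex_bounded_on X"
  by (rule complex_bounded_onI[of _ _ 1]) (simp add: indicator_def)

context positive_functional
begin

definition complexified :: "('a \<Rightarrow> complex) \<Rightarrow> complex"
  where "complexified f = Complex (\<phi> (\<lambda>x. Re (f x))) (\<phi> (\<lambda>x. Im (f x)))"

lemma complexified_add:
  assumes "f \<in> complex_bounded_on X" "g \<in> complex_bounded_on X"
  shows "complexified (\<lambda>x. f x + g x) = complexified f + complexified g"
  using add[OF assms[THEN complex_bounded_on_Re]] add[OF assms[THEN complex_bounded_on_Im]]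
  by (simp add: complexified_def complex_eq_iff)

lemma complexified_scale:
  assumes "f \<in> complex_bounded_on X"
  shows "complexified (\<lambda>x. c * f x) = c * complexified f"
proof -
  note re = complex_bounded_on_Re[OF assms] and im = complex_bounded_on_Im[OF assms]
  show ?thesis
    using diff[OF bounded_on_scale[OF re] bounded_on_scale[OF im], of "Re c" "Im c"]
      add[OF bounded_on_scale[OF im] bounded_on_scale[OF re], of "Re c" "Im c"]
    by (simp add: complexified_def complex_eq_iff scale[OF re] scale[OF im])
qed

lemma complexified_diff:
  assumes "f \<in> complex_bounded_on X" "g \<in> complex_bounded_on X"
  shows "complexified (\<lambda>x. f x - g x) = complexified f - complexified g"
  using diff[OF assms[THEN complex_bounded_on_Re]] diff[OF assms[THEN complex_bounded_on_Im]]
  by (simp add: complexified_def complex_eq_iff)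

lemma complexified_sum:
  assumes "\<And>i. i \<in> I \<Longrightarrow> f i \<in> complex_bounded_on X"
  shows "complexified (\<lambda>x. \<Sum>i\<in>I. f i x) = (\<Sum>i\<in>I. complexified (f i))"
proof -
  have "complexified (\<lambda>x. 0) = 0" by (simp add: complexified_def complex_eq_iff const)
  then show ?thesis
    using assms
    by (induction I rule: infinite_finite_induct)
       (simp_all add: complexified_add complex_bounded_on_sum)
qed

lemma complexified_cong:
  assumes "f \<in> complex_bounded_on X" "\<And>x. x \<in> X \<Longrightarrow> f x = g x"
  shows "complexified f = complexified g"
  unfolding complexified_def
  by (intro arg_cong2[where f = Complex] cong complex_bounded_on_Re complex_bounded_on_Im assms(1))
     (simp_all add: assms(2))

lemma complexified_of_real: "complexified (\<lambda>x. of_real (f x)) = of_real (\<phi> f)"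
  by (simp add: complexified_def complex_eq_iff const)

lemma complexified_indicator: "complexified (indicator A) = of_real (\<phi> (indicator A))"
proof -
  have "(indicator A :: 'a \<Rightarrow> complex) = (\<lambda>x. of_real (indicator A x))"
    by (simp add: fun_eq_iff indicator_def)
  then show ?thesis by (simp only: complexified_of_real)
qed

lemma complexified_cnj:
  assumes "f \<in> complex_bounded_on X"
  shows "complexified (\<lambda>x. cnj (f x)) = cnj (complexified f)"
  using minus[OF complex_bounded_on_Im[OF assms]] by (simp add: complexified_def complex_eq_iff)

text \<open>Real and imaginary parts are estimated separately, whence the factor 2. The bound serves
  only for errors that tend to 0.\<close>

lemma norm_complexified_le:
  assumes "\<And>x. x \<in> X \<Longrightarrow> cmod (f x) \<le> b"
  shows "cmod (complexified f) \<le> 2 * b"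
proof -
  have "\<bar>\<phi> (\<lambda>x. Re (f x))\<bar> \<le> b" "\<bar>\<phi> (\<lambda>x. Im (f x))\<bar> \<le> b"
    using assms abs_Re_le_cmod abs_Im_le_cmod order_trans by (intro abs_le; blast)+
  then show ?thesis
    using cmod_le[of "complexified f"] by (simp add: complexified_def)
qed

end

section \<open>Fibre sums over thin sets\<close>

context groupoid
begin

text \<open>The covering sets carry no topological condition, so the notion also applies to the set
  where f * 1_U is nonzero. It provides a uniform bound on the number of arrows of \<open>D\<close>
  with a given source or range.\<close>

definition thin :: "'g set \<Rightarrow> bool"
  where "thin D \<longleftrightarrow> (\<exists>\<U>. finite \<U> \<and> D \<subseteq> \<Union>\<U> \<and> (\<forall>U\<in>\<U>. inj_on (src G) U \<and> inj_on (rng G) U))"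

lemma thinE:
  assumes "thin D"
  obtains \<U> where "finite \<U>" "D \<subseteq> \<Union>\<U>"
    "\<And>U. U \<in> \<U> \<Longrightarrow> inj_on (src G) U" "\<And>U. U \<in> \<U> \<Longrightarrow> inj_on (rng G) U"
  using assms unfolding thin_def by blast

lemma card_fibres_le:
  assumes \<U>: "finite \<U>" "D \<subseteq> \<Union>\<U>" and inj: "\<And>U. U \<in> \<U> \<Longrightarrow> inj_on f U"
  shows "finite {\<alpha> \<in> D. f \<alpha> = x}" "card {\<alpha> \<in> D. f \<alpha> = x} \<le> card \<U>"
proof -
  let ?A = "\<lambda>U. {\<alpha> \<in> U. f \<alpha> = x}"
  have A: "finite (?A U) \<and> card (?A U) \<le> 1" if "U \<in> \<U>" for U
  proof -
    have "inj_on f U" by (rule inj[OF that])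
    then obtain y where "?A U \<subseteq> {y}" unfolding inj_on_def by blast
    then show ?thesis using finite_subset[of "?A U" "{y}"] card_mono[of "{y}" "?A U"] by simp
  qed
  have sub: "{\<alpha> \<in> D. f \<alpha> = x} \<subseteq> (\<Union>U\<in>\<U>. ?A U)" using \<U>(2) by blast
  have fin: "finite (\<Union>U\<in>\<U>. ?A U)" using \<U>(1) A by blast
  then show "finite {\<alpha> \<in> D. f \<alpha> = x}" by (rule rev_finite_subset[OF _ sub])
  have "card {\<alpha> \<in> D. f \<alpha> = x} \<le> card (\<Union>U\<in>\<U>. ?A U)" by (rule card_mono[OF fin sub])
  also have "\<dots> \<le> (\<Sum>U\<in>\<U>. card (?A U))" by (rule card_UN_le[OF \<U>(1)])
  also have "\<dots> \<le> (\<Sum>U\<in>\<U>. 1)" using A by (intro sum_mono) blast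
  finally show "card {\<alpha> \<in> D. f \<alpha> = x} \<le> card \<U>" by simp
qed

lemma thin_fibres_bounded:
  assumes "thin D"
  obtains N :: nat where "\<And>x. card {\<alpha> \<in> D. rng G \<alpha> = x} \<le> N" "\<And>x. card {\<alpha> \<in> D. src G \<alpha> = x} \<le> N"
proof -
  obtain \<U> where \<U>: "finite \<U>" "D \<subseteq> \<Union>\<U>" "\<And>U. U \<in> \<U> \<Longrightarrow> inj_on (src G) U" "\<And>U. U \<in> \<U> \<Longrightarrow> inj_on (rng G) U"
    using thinE[OF assms] by blast
  show ?thesis
    by (rule that[OF card_fibres_le(2)[OF \<U>(1,2,4)] card_fibres_le(2)[OF \<U>(1,2,3)]])
qed

lemma thin_finite_fibres:
  assumes "thin D"
  shows "finite {\<alpha> \<in> D. rng G \<alpha> = x}" "finite {\<alpha> \<in> D. src G \<alpha> = x}"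
proof -
  obtain \<U> where \<U>: "finite \<U>" "D \<subseteq> \<Union>\<U>" "\<And>U. U \<in> \<U> \<Longrightarrow> inj_on (src G) U" "\<And>U. U \<in> \<U> \<Longrightarrow> inj_on (rng G) U"
    using thinE[OF assms] by blast
  show "finite {\<alpha> \<in> D. rng G \<alpha> = x}" by (rule card_fibres_le(1)[OF \<U>(1,2,4)])
  show "finite {\<alpha> \<in> D. src G \<alpha> = x}" by (rule card_fibres_le(1)[OF \<U>(1,2,3)])
qed

text \<open>The sum runs over the whole fibre of \<open>D\<close> and not just over the nonzero
  terms, which makes it linear in the summand. \<open>convolution_at_unit_src\<close> has the same
  summand over the source fibre.\<close>

lemma convolution_at_unit_rng:
  assumes D: "thin D" "\<And>\<alpha>. f \<alpha> \<noteq> 0 \<Longrightarrow> \<alpha> \<in> D" and x: "x \<in> units G"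
  shows "convolution G f g x = (\<Sum>\<alpha> | \<alpha> \<in> D \<and> rng G \<alpha> = x. f \<alpha> * g (ginv G \<alpha>))"
  unfolding convolution_eq_rng_sum unit_rng[OF x]
proof (rule sum.mono_neutral_cong_left)
  show "{\<alpha>. rng G \<alpha> = x \<and> f \<alpha> * g (ginv G \<alpha> \<cdot> x) \<noteq> 0} \<subseteq> {\<alpha> \<in> D. rng G \<alpha> = x}"
    by (auto intro!: D(2))
qed (use x thin_finite_fibres[OF D(1)] in auto)

lemma convolution_at_unit_src:
  assumes D: "thin D" "\<And>\<alpha>. f \<alpha> \<noteq> 0 \<Longrightarrow> \<alpha> \<in> D" and x: "x \<in> units G"
  shows "convolution G g f x = (\<Sum>\<alpha> | \<alpha> \<in> D \<and> src G \<alpha> = x. f \<alpha> * g (ginv G \<alpha>))"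
  unfolding convolution_eq_src_sum unit_src[OF x]
proof (rule sum.mono_neutral_cong_left)
  show "{\<beta>. src G \<beta> = x \<and> g (x \<cdot> ginv G \<beta>) * f \<beta> \<noteq> 0} \<subseteq> {\<alpha> \<in> D. src G \<alpha> = x}"
    by (auto intro!: D(2))
qed (use x thin_finite_fibres[OF D(1)] in \<open>auto simp: mult.commute\<close>)

lemma sum_fibre_indicator:
  fixes f :: "'g \<Rightarrow> 'g"
  assumes "finite {\<alpha> \<in> D. f \<alpha> = x}" "W \<subseteq> D" "inj_on f W"
  shows "(\<Sum>\<alpha> | \<alpha> \<in> D \<and> f \<alpha> = x. indicator W \<alpha>) = (indicator (f ` W) x :: 'k::comm_ring_1)"
proof (cases "x \<in> f ` W")
  case True
  then obtain w where w: "w \<in> W" "x = f w" by blast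
  have "(\<Sum>\<alpha> | \<alpha> \<in> D \<and> f \<alpha> = x. indicator W \<alpha>) = (\<Sum>\<alpha>\<in>{w}. indicator W \<alpha> :: 'k)"
    using assms w by (intro sum.mono_neutral_right) (auto simp: indicator_def dest: inj_onD)
  then show ?thesis using w by simp
next
  case False
  then show ?thesis by (auto intro!: sum.neutral simp: indicator_def)
qed

end

context invariant_functional
begin

text \<open>By linearity one bisection \<open>W i\<close> is enough. It meets each fibre in at most
  one arrow, so its two fibre sums are the indicators of its range and its source, to which
  \<open>\<phi>\<close> gives the same value.\<close>

lemma complexified_balanced:
  assumes D: "thin D" and I: "finite I"
    and W: "\<And>i. i \<in> I \<Longrightarrow> W i \<in> open_bisections G" "\<And>i. i \<in> I \<Longrightarrow> W i \<subseteq> D"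
    and k: "\<And>\<alpha>. k \<alpha> = (\<Sum>i\<in>I. c i * indicator (W i) \<alpha>)"
  shows "complexified (\<lambda>x. \<Sum>\<alpha> | \<alpha> \<in> D \<and> rng G \<alpha> = x. k \<alpha>) =
    complexified (\<lambda>x. \<Sum>\<alpha> | \<alpha> \<in> D \<and> src G \<alpha> = x. k \<alpha>)"
proof -
  have *: "complexified (\<lambda>x. \<Sum>\<alpha> | \<alpha> \<in> D \<and> f \<alpha> = x. k \<alpha>) =
      (\<Sum>i\<in>I. c i * of_real (\<phi> (indicator (f ` W i))))"
    if f: "\<And>x. finite {\<alpha> \<in> D. f \<alpha> = x}" "\<And>i. i \<in> I \<Longrightarrow> inj_on f (W i)" for f :: "'g \<Rightarrow> 'g"
  proof -
    have "(\<Sum>\<alpha> | \<alpha> \<in> D \<and> f \<alpha> = x. k \<alpha>) = (\<Sum>i\<in>I. c i * indicator (f ` W i) x)" for x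
    proof -
      have "(\<Sum>\<alpha> | \<alpha> \<in> D \<and> f \<alpha> = x. k \<alpha>) = (\<Sum>i\<in>I. \<Sum>\<alpha> | \<alpha> \<in> D \<and> f \<alpha> = x. c i * indicator (W i) \<alpha>)"
        unfolding k by (rule sum.swap)
      also have "\<dots> = (\<Sum>i\<in>I. c i * indicator (f ` W i) x)"
        unfolding sum_distrib_left[symmetric]
        using f W(2) by (intro sum.cong refl arg_cong2[where f = "(*)"] sum_fibre_indicator) auto
      finally show ?thesis .
    qed
    then have "complexified (\<lambda>x. \<Sum>\<alpha> | \<alpha> \<in> D \<and> f \<alpha> = x. k \<alpha>) =
      complexified (\<lambda>x. \<Sum>i\<in>I. c i * indicator (f ` W i) x)" by simp
    also have "\<dots> = (\<Sum>i\<in>I. complexified (\<lambda>x. c i * indicator (f ` W i) x))"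
      by (intro complexified_sum complex_bounded_on_scale complex_bounded_on_indicator)
    also have "\<dots> = (\<Sum>i\<in>I. c i * of_real (\<phi> (indicator (f ` W i))))"
      by (intro sum.cong refl) (simp add: complexified_scale complex_bounded_on_indicator complexified_indicator)
    finally show ?thesis .
  qed
  have "inj_on (rng G) (W i)" "inj_on (src G) (W i)" if "i \<in> I" for i
    using W(1)[OF that] by (auto simp: open_bisections_def)
  then show ?thesis
    using W(1) by (simp add: * thin_finite_fibres[OF D] invariant)
qed

end

context compact_ample_groupoid
begin

lemma thin_Union_bisections:
  "finite F \<Longrightarrow> F \<subseteq> compact_open_bisections G \<Longrightarrow> thin (\<Union>F)"
  unfolding thin_def compact_open_bisections_def by blast

lemma groupoid_functions_thin:
  assumes "f \<in> groupoid_functions G"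
  obtains D where "thin D" "\<And>\<alpha>. f \<alpha> \<noteq> 0 \<Longrightarrow> \<alpha> \<in> D"
proof -
  obtain F c where f: "finite F" "F \<subseteq> compact_open_bisections G" "\<And>\<gamma>. f \<gamma> = (\<Sum>U\<in>F. c U * indicator U \<gamma>)"
    using groupoid_functionsE[OF assms] by blast
  show ?thesis
  proof (rule that[OF thin_Union_bisections[OF f(1,2)]], rule ccontr)
    fix \<alpha> assume "f \<alpha> \<noteq> 0" "\<alpha> \<notin> \<Union>F"
    then show False using f(3)[of \<alpha>] by (simp add: indicator_def)
  qed
qed

lemma groupoid_functions_bounded:
  assumes "f \<in> groupoid_functions G"
  shows "f \<in> complex_bounded_on X"
proof -
  obtain F c where f: "finite F" "F \<subseteq> compact_open_bisections G" "\<And>\<gamma>. f \<gamma> = (\<Sum>U\<in>F. c U * indicator U \<gamma>)"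
    using groupoid_functionsE[OF assms] by blast
  have "(\<lambda>\<gamma>. \<Sum>U\<in>F. c U * indicator U \<gamma>) \<in> complex_bounded_on X"
    by (intro complex_bounded_on_sum complex_bounded_on_scale complex_bounded_on_indicator)
  moreover have "f = (\<lambda>\<gamma>. \<Sum>U\<in>F. c U * indicator U \<gamma>)" using f(3) by (rule ext)
  ultimately show ?thesis by simp
qed

lemma convolution_star_at_unit:
  fixes f :: "'g \<Rightarrow> complex"
  assumes "thin D" "\<And>\<alpha>. f \<alpha> \<noteq> 0 \<Longrightarrow> \<alpha> \<in> D" "x \<in> units G"
  shows "convolution G f (\<lambda>\<gamma>. cnj (f (ginv G \<gamma>))) x =
    of_real (\<Sum>\<alpha> | \<alpha> \<in> D \<and> rng G \<alpha> = x. (cmod (f \<alpha>))\<^sup>2)"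
proof -
  have "convolution G f (\<lambda>\<gamma>. cnj (f (ginv G \<gamma>))) x =
    (\<Sum>\<alpha> | \<alpha> \<in> D \<and> rng G \<alpha> = x. f \<alpha> * cnj (f (ginv G (ginv G \<alpha>))))"
    by (rule convolution_at_unit_rng[where f = f, OF assms])
  then show ?thesis by (simp only: of_real_sum complex_norm_square inv_inv)
qed

lemma thin_sum_bounded:
  fixes f :: "'g \<Rightarrow> complex"
  assumes "thin D" "f \<in> complex_bounded_on UNIV"
  shows "(\<lambda>x. \<Sum>\<alpha> | \<alpha> \<in> D \<and> rng G \<alpha> = x. f \<alpha>) \<in> complex_bounded_on X"
    "(\<lambda>x. \<Sum>\<alpha> | \<alpha> \<in> D \<and> src G \<alpha> = x. f \<alpha>) \<in> complex_bounded_on X"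
proof -
  obtain N where N: "\<And>x. card {\<alpha> \<in> D. rng G \<alpha> = x} \<le> N" "\<And>x. card {\<alpha> \<in> D. src G \<alpha> = x} \<le> N"
    using thin_fibres_bounded[OF assms(1)] by blast
  obtain b where b: "\<And>x. cmod (f x) \<le> b" using assms(2) by (auto simp: complex_bounded_on_def)
  have b0: "0 \<le> b" using b[of undefined] norm_ge_zero order_trans by blast
  have *: "cmod (\<Sum>\<alpha>\<in>A. f \<alpha>) \<le> real N * b" if "card A \<le> N" for A
  proof -
    have "cmod (\<Sum>\<alpha>\<in>A. f \<alpha>) \<le> real (card A) * b" by (rule sum_norm_bound) (rule b)
    also have "\<dots> \<le> real N * b" using that b0 by (intro mult_right_mono) auto
    finally show ?thesis .
  qed
  show "(\<lambda>x. \<Sum>\<alpha> | \<alpha> \<in> D \<and> rng G \<alpha> = x. f \<alpha>) \<in> complex_bounded_on X"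
    "(\<lambda>x. \<Sum>\<alpha> | \<alpha> \<in> D \<and> src G \<alpha> = x. f \<alpha>) \<in> complex_bounded_on X"
    by (rule complex_bounded_onI, rule *, rule N)+
qed

end

lemma complex_groupoid_algebra_simps [simp]:
  "carrier (complex_groupoid_algebra G) = groupoid_functions G"
  "f \<otimes>\<^bsub>complex_groupoid_algebra G\<^esub> g = convolution G f g"
  "\<one>\<^bsub>complex_groupoid_algebra G\<^esub> = indicator (units G)"
  "f \<oplus>\<^bsub>complex_groupoid_algebra G\<^esub> g = (\<lambda>\<gamma>. f \<gamma> + g \<gamma>)"
  "c \<odot>\<^bsub>complex_groupoid_algebra G\<^esub> f = (\<lambda>\<gamma>. c * f \<gamma>)"
  "star (complex_groupoid_algebra G) f = (\<lambda>\<gamma>. cnj (f (ginv G \<gamma>)))"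
  by (simp_all add: complex_groupoid_algebra_def ring.defs groupoid_algebra_def)

section \<open>Trace property, positivity and contractivity\<close>

context invariant_functional
begin

lemma complexified_convolution_commute:
  assumes "f \<in> groupoid_functions G" "g \<in> groupoid_functions G"
  shows "complexified (convolution G f g) = complexified (convolution G g f)"
proof -
  obtain F c where f: "finite F" "F \<subseteq> compact_open_bisections G" "\<And>\<gamma>. f \<gamma> = (\<Sum>U\<in>F. c U * indicator U \<gamma>)"
    using groupoid_functionsE[OF assms(1)] by blast
  obtain F' c' where g: "finite F'" "F' \<subseteq> compact_open_bisections G" "\<And>\<gamma>. g \<gamma> = (\<Sum>U\<in>F'. c' U * indicator U \<gamma>)"
    using groupoid_functionsE[OF assms(2)] by blast
  let ?D = "\<Union>F" and ?k = "\<lambda>\<alpha>. f \<alpha> * g (ginv G \<alpha>)"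
  have D: "thin ?D" by (rule thin_Union_bisections[OF f(1,2)])
  have supp: "\<alpha> \<in> ?D" if "f \<alpha> \<noteq> 0" for \<alpha>
  proof (rule ccontr)
    assume "\<alpha> \<notin> ?D"
    then show False using that f(3)[of \<alpha>] by (simp add: indicator_def)
  qed
  have k: "?k \<in> complex_bounded_on UNIV"
  proof -
    obtain b c where b: "\<And>x. cmod (f x) \<le> b" "\<And>x. cmod (g x) \<le> c"
      using groupoid_functions_bounded[OF assms(1), of UNIV] groupoid_functions_bounded[OF assms(2), of UNIV]
      by (auto simp: complex_bounded_on_def)
    have "0 \<le> b" using b(1)[of undefined] norm_ge_zero order_trans by blast
    then show ?thesis
      by (intro complex_bounded_onI[of _ _ "b * c"]) (simp add: norm_mult mult_mono b)
  qed
  have "complexified (convolution G f g) = complexified (\<lambda>x. \<Sum>\<alpha> | \<alpha> \<in> ?D \<and> rng G \<alpha> = x. ?k \<alpha>)"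
    by (rule sym, rule complexified_cong[OF thin_sum_bounded(1)[OF D k]])
       (simp add: convolution_at_unit_rng[where f = f, OF D supp])
  \<comment> \<open>The summand is a combination of the indicators of U \<inter> V^-1 with U in
    \<open>F\<close> and V in \<open>F'\<close>; these are open bisections inside the union of
    \<open>F\<close>.\<close>
  also have "\<dots> = complexified (\<lambda>x. \<Sum>\<alpha> | \<alpha> \<in> ?D \<and> src G \<alpha> = x. ?k \<alpha>)"
  proof (rule complexified_balanced[OF D, where I = "F \<times> F'" and W = "\<lambda>p. fst p \<inter> ginv G ` snd p"
        and c = "\<lambda>p. c (fst p) * c' (snd p)"])
    show "finite (F \<times> F')" using f g by simp
    fix p assume p: "p \<in> F \<times> F'"
    then have *: "fst p \<in> open_bisections G" "open (fst p)" "open (ginv G ` snd p)"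
      using f(2) g(2) by (auto simp: compact_open_bisections_eq open_bisections_def open_ginv_image)
    show "fst p \<inter> ginv G ` snd p \<in> open_bisections G"
      by (rule open_bisection_subset[OF *(1) open_Int[OF *(2,3)] Int_lower1])
    show "fst p \<inter> ginv G ` snd p \<subseteq> \<Union>F" using p by auto
  next
    fix \<alpha>
    have ind: "indicator V (ginv G \<alpha>) = (indicator (ginv G ` V) \<alpha> :: complex)" for V
      by (simp add: ginv_image indicator_def)
    show "?k \<alpha> = (\<Sum>p\<in>F \<times> F'. c (fst p) * c' (snd p) * indicator (fst p \<inter> ginv G ` snd p) \<alpha>)"
      unfolding f(3) g(3) ind sum_product sum.cartesian_product
      by (intro sum.cong) (auto simp: indicator_inter_arith)
  qed
  also have "\<dots> = complexified (convolution G g f)"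
    by (rule complexified_cong[OF thin_sum_bounded(2)[OF D k]])
       (simp add: convolution_at_unit_src[where f = f, OF D supp])
  finally show ?thesis .
qed

lemma real_sum_bounded:
  fixes f :: "'g \<Rightarrow> complex"
  assumes "thin D" "f \<in> complex_bounded_on UNIV"
  shows "(\<lambda>x. \<Sum>\<alpha> | \<alpha> \<in> D \<and> rng G \<alpha> = x. (cmod (f \<alpha>))\<^sup>2) \<in> bounded_on Y"
proof -
  obtain b where b: "\<And>x. cmod (f x) \<le> b" using assms(2) by (auto simp: complex_bounded_on_def)
  have "(\<lambda>\<alpha>. complex_of_real ((cmod (f \<alpha>))\<^sup>2)) \<in> complex_bounded_on UNIV"
    by (rule complex_bounded_onI[of _ _ "b\<^sup>2"]) (simp add: norm_power power_mono b)
  from complex_bounded_on_Re[OF thin_sum_bounded(1)[OF assms(1) this]]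
  show ?thesis by simp
qed

lemma complexified_convolution_star:
  assumes "thin D" "\<And>\<alpha>. f \<alpha> \<noteq> 0 \<Longrightarrow> \<alpha> \<in> D"
    and "(\<lambda>x. \<Sum>\<alpha> | \<alpha> \<in> D \<and> rng G \<alpha> = x. (cmod (f \<alpha>))\<^sup>2) \<in> bounded_on (units G)"
  shows "complexified (convolution G f (\<lambda>\<gamma>. cnj (f (ginv G \<gamma>)))) =
    of_real (\<phi> (\<lambda>x. \<Sum>\<alpha> | \<alpha> \<in> D \<and> rng G \<alpha> = x. (cmod (f \<alpha>))\<^sup>2))"
proof -
  let ?S = "\<lambda>x. \<Sum>\<alpha> | \<alpha> \<in> D \<and> rng G \<alpha> = x. (cmod (f \<alpha>))\<^sup>2"
  have "complexified (\<lambda>x. of_real (?S x)) = complexified (convolution G f (\<lambda>\<gamma>. cnj (f (ginv G \<gamma>))))"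
  proof (rule complexified_cong)
    obtain b where "\<And>x. x \<in> units G \<Longrightarrow> \<bar>?S x\<bar> \<le> b" using assms(3) by (auto simp: bounded_on_def)
    then show "(\<lambda>x. complex_of_real (?S x)) \<in> complex_bounded_on (units G)"
      by (intro complex_bounded_onI[of _ _ b]) (simp only: norm_of_real)
  qed (rule convolution_star_at_unit[where f = f, OF assms(1,2), symmetric])
  then show ?thesis by (simp only: complexified_of_real)
qed

text \<open>
  Right multiplication by a bisection moves the values of a function injectively within each range
  fibre, so the contractivity already holds pointwise on the unit space.
\<close>

lemma convolution_indicator_sum_le:
  fixes f :: "'g \<Rightarrow> complex"
  assumes D: "thin D" "\<And>\<alpha>. f \<alpha> \<noteq> 0 \<Longrightarrow> \<alpha> \<in> D" and U: "inj_on (src G) U" "inj_on (rng G) U"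
  defines "E \<equiv> {\<gamma>. convolution G f (indicator U) \<gamma> \<noteq> 0}"
  shows "thin E"
    "(\<Sum>\<alpha> | \<alpha> \<in> E \<and> rng G \<alpha> = x. (cmod (convolution G f (indicator U) \<alpha>))\<^sup>2) \<le>
      (\<Sum>\<alpha> | \<alpha> \<in> D \<and> rng G \<alpha> = x. (cmod (f \<alpha>))\<^sup>2)"
proof -
  let ?F = "convolution G f (indicator U)"
  have val: "\<exists>\<beta>\<in>U. src G \<beta> = src G \<gamma> \<and> ?F \<gamma> = f (\<gamma> \<cdot> ginv G \<beta>)" if "\<gamma> \<in> E" for \<gamma>
  proof -
    let ?S = "{\<beta>. src G \<beta> = src G \<gamma> \<and> f (\<gamma> \<cdot> ginv G \<beta>) * (indicator U \<beta> :: complex) \<noteq> 0}"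
    have "?S \<noteq> {}"
    proof
      assume "?S = {}"
      then have "?F \<gamma> = 0" unfolding convolution_eq_src_sum by (simp only: sum.empty)
      then show False using that by (simp add: E_def)
    qed
    then obtain \<beta> where \<beta>: "\<beta> \<in> ?S" by blast
    then have bU: "\<beta> \<in> U" "src G \<beta> = src G \<gamma>" by (auto split: split_indicator_asm)
    have "?S \<subseteq> {\<beta>}"
      using bU U(1) by (auto simp: indicator_def inj_on_def)
    then have "?S = {\<beta>}" using \<beta> by blast
    then have "?F \<gamma> = f (\<gamma> \<cdot> ginv G \<beta>)"
      unfolding convolution_eq_src_sum using bU by simp
    then show ?thesis using bU by blast
  qed
  then obtain b where b: "\<And>\<gamma>. \<gamma> \<in> E \<Longrightarrow> b \<gamma> \<in> U" "\<And>\<gamma>. \<gamma> \<in> E \<Longrightarrow> src G (b \<gamma>) = src G \<gamma>"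
    "\<And>\<gamma>. \<gamma> \<in> E \<Longrightarrow> ?F \<gamma> = f (\<gamma> \<cdot> ginv G (b \<gamma>))" by metis
  \<comment> \<open>The only nonzero term of the convolution at \<gamma> comes from the
    factorization of \<gamma> into \<open>\<theta> \<gamma>\<close> and \<open>b \<gamma>\<close>.
    The source of \<open>\<theta> \<gamma>\<close> is the range of \<open>b \<gamma>\<close>, so
    \<open>\<theta> \<gamma>\<close> determines \<open>b \<gamma>\<close> and hence
    \<gamma>.\<close>
  define \<theta> where "\<theta> \<gamma> = \<gamma> \<cdot> ginv G (b \<gamma>)" for \<gamma>
  have \<theta>: "\<theta> \<gamma> \<in> D" "rng G (\<theta> \<gamma>) = rng G \<gamma>" "src G (\<theta> \<gamma>) = rng G (b \<gamma>)" "\<theta> \<gamma> \<cdot> b \<gamma> = \<gamma>" if "\<gamma> \<in> E" for \<gamma>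
    using b[OF that] that D(2) by (auto simp: \<theta>_def E_def)
  have beq: "b \<gamma> = b \<gamma>'" if "\<gamma> \<in> E" "\<gamma>' \<in> E" "src G (\<theta> \<gamma>) = src G (\<theta> \<gamma>')" for \<gamma> \<gamma>'
    using that \<theta>(3)[OF that(1)] \<theta>(3)[OF that(2)] b(1)[OF that(1)] b(1)[OF that(2)] inj_onD[OF U(2)] by simp
  have inj\<theta>: "\<gamma> = \<gamma>'" if "\<gamma> \<in> E" "\<gamma>' \<in> E" "\<theta> \<gamma> = \<theta> \<gamma>'" for \<gamma> \<gamma>'
  proof -
    have "src G (\<theta> \<gamma>) = src G (\<theta> \<gamma>')" by (simp only: that(3))
    then have eq: "b \<gamma> = b \<gamma>'" by (rule beq[OF that(1,2)])
    have "\<gamma> = \<theta> \<gamma> \<cdot> b \<gamma>" by (rule \<theta>(4)[OF that(1), symmetric])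
    also have "\<dots> = \<theta> \<gamma>' \<cdot> b \<gamma>'" by (simp only: that(3) eq)
    also have "\<dots> = \<gamma>'" by (rule \<theta>(4)[OF that(2)])
    finally show ?thesis .
  qed
  obtain \<U> where \<U>: "finite \<U>" "D \<subseteq> \<Union>\<U>" "\<And>U. U \<in> \<U> \<Longrightarrow> inj_on (src G) U" "\<And>U. U \<in> \<U> \<Longrightarrow> inj_on (rng G) U"
    using thinE[OF D(1)] by blast
  \<comment> \<open>A cover of \<open>D\<close> is pulled back along \<open>\<theta>\<close> to a
    cover of \<open>E\<close>. Ranges are preserved by \<open>\<theta>\<close>. Arrows with equal
    sources have equal \<open>b\<close>, because the source is injective on \<open>U\<close>, and
    then their images under \<open>\<theta>\<close> have equal sources too.\<close>
  have "inj_on (src G) {\<gamma> \<in> E. \<theta> \<gamma> \<in> V} \<and> inj_on (rng G) {\<gamma> \<in> E. \<theta> \<gamma> \<in> V}" if V: "V \<in> \<U>" for V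
  proof (intro conjI inj_onI)
    fix \<gamma> \<gamma>' assume "\<gamma> \<in> {\<gamma> \<in> E. \<theta> \<gamma> \<in> V}" "\<gamma>' \<in> {\<gamma> \<in> E. \<theta> \<gamma> \<in> V}" and r: "rng G \<gamma> = rng G \<gamma>'"
    then have *: "\<gamma> \<in> E" "\<gamma>' \<in> E" "\<theta> \<gamma> \<in> V" "\<theta> \<gamma>' \<in> V" by auto
    have "\<theta> \<gamma> = \<theta> \<gamma>'"
      using inj_onD[OF \<U>(4)[OF V] _ *(3,4)] \<theta>(2)[OF *(1)] \<theta>(2)[OF *(2)] r by simp
    then show "\<gamma> = \<gamma>'" by (rule inj\<theta>[OF *(1,2)])
  next
    fix \<gamma> \<gamma>' assume "\<gamma> \<in> {\<gamma> \<in> E. \<theta> \<gamma> \<in> V}" "\<gamma>' \<in> {\<gamma> \<in> E. \<theta> \<gamma> \<in> V}" and r: "src G \<gamma> = src G \<gamma>'"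
    then have *: "\<gamma> \<in> E" "\<gamma>' \<in> E" "\<theta> \<gamma> \<in> V" "\<theta> \<gamma>' \<in> V" by auto
    have "b \<gamma> = b \<gamma>'"
      using inj_onD[OF U(1) _ b(1)[OF *(1)] b(1)[OF *(2)]] b(2)[OF *(1)] b(2)[OF *(2)] r by simp
    then have "src G (\<theta> \<gamma>) = src G (\<theta> \<gamma>')" using \<theta>(3)[OF *(1)] \<theta>(3)[OF *(2)] by simp
    then have "\<theta> \<gamma> = \<theta> \<gamma>'" by (rule inj_onD[OF \<U>(3)[OF V] _ *(3,4)])
    then show "\<gamma> = \<gamma>'" by (rule inj\<theta>[OF *(1,2)])
  qed
  moreover have "E \<subseteq> \<Union>((\<lambda>V. {\<gamma> \<in> E. \<theta> \<gamma> \<in> V}) ` \<U>)" using \<theta>(1) \<U>(2) by blast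
  ultimately show "thin E" unfolding thin_def
    using \<U>(1) by (intro exI[of _ "(\<lambda>V. {\<gamma> \<in> E. \<theta> \<gamma> \<in> V}) ` \<U>"]) auto
  have "(\<Sum>\<alpha> | \<alpha> \<in> E \<and> rng G \<alpha> = x. (cmod (?F \<alpha>))\<^sup>2) = (\<Sum>\<alpha> | \<alpha> \<in> E \<and> rng G \<alpha> = x. (cmod (f (\<theta> \<alpha>)))\<^sup>2)"
    by (intro sum.cong refl) (simp add: b(3) \<theta>_def)
  also have "\<dots> = (\<Sum>\<beta>\<in>\<theta> ` {\<alpha> \<in> E. rng G \<alpha> = x}. (cmod (f \<beta>))\<^sup>2)"
    by (rule sum.reindex_cong[symmetric, OF _ refl refl]) (auto intro!: inj_onI inj\<theta>)
  also have "\<dots> \<le> (\<Sum>\<alpha> | \<alpha> \<in> D \<and> rng G \<alpha> = x. (cmod (f \<alpha>))\<^sup>2)"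
    by (rule sum_mono2) (auto simp: \<theta> thin_finite_fibres[OF D(1)])
  finally show "(\<Sum>\<alpha> | \<alpha> \<in> E \<and> rng G \<alpha> = x. (cmod (?F \<alpha>))\<^sup>2) \<le>
      (\<Sum>\<alpha> | \<alpha> \<in> D \<and> rng G \<alpha> = x. (cmod (f \<alpha>))\<^sup>2)" .
qed

text \<open>At a unit x, the product of f with its adjoint is the sum of |f|^2 over the arrows with
  range x. Positivity and contractivity are thus monotonicity of \<open>\<phi>\<close>.\<close>

theorem contractive_trace_complexified: "contractive_trace G complexified"
  unfolding contractive_trace_def Let_def Defs.trace_def linear_functional_def complex_groupoid_algebra_simps
proof (intro conjI ballI allI)
  fix f g :: "'g \<Rightarrow> complex" assume f: "f \<in> groupoid_functions G"
  show "complexified (\<lambda>\<gamma>. c * f \<gamma>) = c * complexified f" for c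
    by (rule complexified_scale[OF groupoid_functions_bounded[OF f]])
  show "complexified (\<lambda>\<gamma>. cnj (f (ginv G \<gamma>))) = cnj (complexified f)"
  proof -
    have "complexified (\<lambda>\<gamma>. cnj (f \<gamma>)) = complexified (\<lambda>\<gamma>. cnj (f (ginv G \<gamma>)))"
    proof (rule complexified_cong)
      obtain b where "\<And>x. x \<in> units G \<Longrightarrow> cmod (f x) \<le> b"
        using groupoid_functions_bounded[OF f, of "units G"] by (auto simp: complex_bounded_on_def)
      then show "(\<lambda>\<gamma>. cnj (f \<gamma>)) \<in> complex_bounded_on (units G)"
        by (intro complex_bounded_onI[of _ _ b]) simp
    qed simp
    then show ?thesis using complexified_cnj[OF groupoid_functions_bounded[OF f]] by simp
  qed
  obtain D where D: "thin D" "\<And>\<alpha>. f \<alpha> \<noteq> 0 \<Longrightarrow> \<alpha> \<in> D" using groupoid_functions_thin[OF f] by blast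
  let ?S = "\<lambda>x. \<Sum>\<alpha> | \<alpha> \<in> D \<and> rng G \<alpha> = x. (cmod (f \<alpha>))\<^sup>2"
  have bS: "?S \<in> bounded_on (units G)"
    by (rule real_sum_bounded[OF D(1) groupoid_functions_bounded[OF f]])
  have eq: "complexified (convolution G f (\<lambda>\<gamma>. cnj (f (ginv G \<gamma>)))) = of_real (\<phi> ?S)"
    by (rule complexified_convolution_star[where f = f, OF D bS])
  have nonneg: "\<phi> (\<lambda>x. 0) \<le> \<phi> ?S" by (rule mono[OF bounded_on_const bS]) (simp add: sum_nonneg)
  then show "0 \<le> complexified (convolution G f (\<lambda>\<gamma>. cnj (f (ginv G \<gamma>))))"
    unfolding eq by (simp add: const less_eq_complex_def)
  {
    assume g: "g \<in> groupoid_functions G"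
    show "complexified (\<lambda>\<gamma>. f \<gamma> + g \<gamma>) = complexified f + complexified g"
      by (intro complexified_add groupoid_functions_bounded f g)
    show "complexified (convolution G f g) = complexified (convolution G g f)"
      by (rule complexified_convolution_commute[OF f g])
  }
  fix U assume "U \<in> compact_open_bisections G"
  then have U: "inj_on (src G) U" "inj_on (rng G) U" by (auto simp: compact_open_bisections_def)
  let ?F = "convolution G f (indicator U)"
  \<comment> \<open>The product f * 1_U is handled through its thin support; its fibre sums of
    squares are bounded because those of f dominate them.\<close>
  let ?E = "{\<gamma>. ?F \<gamma> \<noteq> 0}"
  let ?T = "\<lambda>x. \<Sum>\<alpha> | \<alpha> \<in> ?E \<and> rng G \<alpha> = x. (cmod (?F \<alpha>))\<^sup>2"
  note E = convolution_indicator_sum_le[where f = f, OF D U]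
  have bT: "?T \<in> bounded_on (units G)"
  proof -
    obtain b where b: "\<And>x. x \<in> units G \<Longrightarrow> \<bar>?S x\<bar> \<le> b" using bS by (auto simp: bounded_on_def)
    have "\<bar>?T x\<bar> \<le> b" if "x \<in> units G" for x
    proof -
      have "0 \<le> ?T x" by (simp add: sum_nonneg)
      then show ?thesis using E(2)[of x] b[OF that] by linarith
    qed
    then show ?thesis by (rule bounded_onI)
  qed
  have "complexified (convolution G ?F (\<lambda>\<gamma>. cnj (?F (ginv G \<gamma>)))) = of_real (\<phi> ?T)"
    by (rule complexified_convolution_star[OF E(1) CollectI bT])
  moreover have "\<phi> ?T \<le> \<phi> ?S" by (rule mono[OF bT bS]) (rule E(2))
  ultimately show "complexified (convolution G ?F (\<lambda>\<gamma>. cnj (?F (ginv G \<gamma>)))) \<le>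
      complexified (convolution G f (\<lambda>\<gamma>. cnj (f (ginv G \<gamma>))))"
    unfolding eq by (simp add: less_eq_complex_def)
qed

lemma normalized_complexified: "normalized (complex_groupoid_algebra G) complexified"
proof -
  have "\<phi> (indicator (units G)) = \<phi> (\<lambda>x. 1)" by (intro cong bounded_on_indicator) simp
  then show ?thesis by (simp add: normalized_def complexified_indicator one)
qed

end

section \<open>Square-summable functions and their bounded operators\<close>

lemma l2_bound_finite:
  assumes "\<xi> \<in> l2" "finite F"
  shows "(\<Sum>\<gamma>\<in>F. (cmod (\<xi> \<gamma>))\<^sup>2) \<le> (l2_norm \<xi>)\<^sup>2"
proof -
  have "(\<Sum>\<gamma>\<in>F. (cmod (\<xi> \<gamma>))\<^sup>2) \<le> (\<Sum>\<^sub>\<infinity>\<gamma>. (cmod (\<xi> \<gamma>))\<^sup>2)"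
    using assms by (intro finite_sum_le_infsum) (auto simp: l2_def)
  moreover have "0 \<le> (\<Sum>\<^sub>\<infinity>\<gamma>. (cmod (\<xi> \<gamma>))\<^sup>2)" by (rule infsum_nonneg) simp
  ultimately show ?thesis by (simp add: l2_norm_def)
qed

lemma l2_norm_nonneg [simp]: "0 \<le> l2_norm \<xi>"
  by (simp add: l2_norm_def infsum_nonneg)

text \<open>Bounded finite sums of a nonnegative family give summability and bound the infinite sum,
  so all norm estimates below concern finite sets.\<close>

lemma l2I:
  assumes "\<And>F. finite F \<Longrightarrow> (\<Sum>\<gamma>\<in>F. (cmod (\<xi> \<gamma>))\<^sup>2) \<le> b\<^sup>2" and "0 \<le> b"
  shows "\<xi> \<in> l2" "l2_norm \<xi> \<le> b"
proof -
  have s: "(\<lambda>\<gamma>. (cmod (\<xi> \<gamma>))\<^sup>2) summable_on UNIV"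
    using assms by (intro nonneg_bdd_above_summable_on bdd_aboveI2[of _ _ "b\<^sup>2"]) auto
  then show "\<xi> \<in> l2" by (simp add: l2_def)
  have "(\<Sum>\<^sub>\<infinity>\<gamma>. (cmod (\<xi> \<gamma>))\<^sup>2) \<le> b\<^sup>2"
    using s assms(1) by (rule infsum_le_finite_sums)
  then show "l2_norm \<xi> \<le> b"
    unfolding l2_norm_def using assms(2) by (intro real_le_lsqrt)
qed

lemma L2_set_le_l2_norm: "\<xi> \<in> l2 \<Longrightarrow> finite F \<Longrightarrow> L2_set (\<lambda>\<gamma>. cmod (\<xi> \<gamma>)) F \<le> l2_norm \<xi>"
  unfolding L2_set_def by (rule real_le_lsqrt) (simp_all add: l2_bound_finite sum_nonneg)

lemma cmod_le_l2_norm: "\<xi> \<in> l2 \<Longrightarrow> cmod (\<xi> \<gamma>) \<le> l2_norm \<xi>"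
  using L2_set_le_l2_norm[of \<xi> "{\<gamma>}"] by (simp add: L2_set_def)

lemma l2_add:
  assumes "\<xi> \<in> l2" "\<eta> \<in> l2"
  shows "(\<lambda>\<gamma>. \<xi> \<gamma> + \<eta> \<gamma>) \<in> l2" "l2_norm (\<lambda>\<gamma>. \<xi> \<gamma> + \<eta> \<gamma>) \<le> l2_norm \<xi> + l2_norm \<eta>"
proof -
  have *: "(\<Sum>\<gamma>\<in>F. (cmod (\<xi> \<gamma> + \<eta> \<gamma>))\<^sup>2) \<le> (l2_norm \<xi> + l2_norm \<eta>)\<^sup>2" if "finite F" for F
  proof -
    have "L2_set (\<lambda>\<gamma>. cmod (\<xi> \<gamma> + \<eta> \<gamma>)) F \<le> L2_set (\<lambda>\<gamma>. cmod (\<xi> \<gamma>) + cmod (\<eta> \<gamma>)) F"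
      by (rule L2_set_mono) (simp_all add: norm_triangle_ineq)
    also have "\<dots> \<le> L2_set (\<lambda>\<gamma>. cmod (\<xi> \<gamma>)) F + L2_set (\<lambda>\<gamma>. cmod (\<eta> \<gamma>)) F"
      by (rule L2_set_triangle_ineq)
    also have "\<dots> \<le> l2_norm \<xi> + l2_norm \<eta>"
      using assms that by (intro add_mono L2_set_le_l2_norm)
    finally show ?thesis
      unfolding L2_set_def by (rule sqrt_le_D)
  qed
  then show "(\<lambda>\<gamma>. \<xi> \<gamma> + \<eta> \<gamma>) \<in> l2" by (rule l2I(1)) simp_all
  show "l2_norm (\<lambda>\<gamma>. \<xi> \<gamma> + \<eta> \<gamma>) \<le> l2_norm \<xi> + l2_norm \<eta>" using * by (rule l2I(2)) simp_all
qed

lemma l2_scale: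
  assumes "\<xi> \<in> l2" shows "(\<lambda>\<gamma>. c * \<xi> \<gamma>) \<in> l2"
proof (rule l2I(1))
  fix F :: "'a set" assume "finite F"
  have "(\<Sum>\<gamma>\<in>F. (cmod (c * \<xi> \<gamma>))\<^sup>2) = (cmod c)\<^sup>2 * (\<Sum>\<gamma>\<in>F. (cmod (\<xi> \<gamma>))\<^sup>2)"
    by (simp add: norm_mult power_mult_distrib sum_distrib_left)
  also have "\<dots> \<le> (cmod c)\<^sup>2 * (l2_norm \<xi>)\<^sup>2"
    using l2_bound_finite[OF assms \<open>finite F\<close>] by (rule mult_left_mono) simp
  finally show "(\<Sum>\<gamma>\<in>F. (cmod (c * \<xi> \<gamma>))\<^sup>2) \<le> (cmod c * l2_norm \<xi>)\<^sup>2"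
    by (simp add: power_mult_distrib)
qed simp

lemma l2_diff:
  assumes "\<xi> \<in> l2" "\<eta> \<in> l2"
  shows "(\<lambda>\<gamma>. \<xi> \<gamma> - \<eta> \<gamma>) \<in> l2"
  using l2_add(1)[OF assms(1) l2_scale[OF assms(2), of "-1"]] by simp

lemma l2_zero: "(\<lambda>\<gamma>. 0) \<in> l2" "l2_norm (\<lambda>\<gamma>. 0) = 0"
  by (simp_all add: l2_def l2_norm_def)

lemma l2_indicator_singleton: "indicator {x} \<in> l2" "l2_norm (indicator {x}) \<le> 1"
proof -
  have "(\<Sum>\<gamma>\<in>F. (cmod (indicator {x} \<gamma>))\<^sup>2) \<le> 1\<^sup>2" if "finite F" for F
  proof -
    have "(\<Sum>\<gamma>\<in>F. (cmod (indicator {x} \<gamma>))\<^sup>2) = (\<Sum>\<gamma>\<in>F. if \<gamma> = x then 1 else 0)"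
      by (intro sum.cong) (auto simp: indicator_def)
    then show ?thesis using that by simp
  qed
  from l2I[OF this] show "indicator {x} \<in> l2" "l2_norm (indicator {x}) \<le> 1" by simp_all
qed

lemma l2_inner_summable:
  assumes "\<xi> \<in> l2" "\<eta> \<in> l2"
  shows "(\<lambda>\<gamma>. cmod (\<xi> \<gamma> * cnj (\<eta> \<gamma>))) summable_on UNIV"
    "(\<Sum>\<^sub>\<infinity>\<gamma>. cmod (\<xi> \<gamma> * cnj (\<eta> \<gamma>))) \<le> l2_norm \<xi> * l2_norm \<eta>"
proof -
  have *: "(\<Sum>\<gamma>\<in>F. cmod (\<xi> \<gamma> * cnj (\<eta> \<gamma>))) \<le> l2_norm \<xi> * l2_norm \<eta>" if "finite F" for F
  proof -
    have "(\<Sum>\<gamma>\<in>F. cmod (\<xi> \<gamma> * cnj (\<eta> \<gamma>))) = (\<Sum>\<gamma>\<in>F. \<bar>cmod (\<xi> \<gamma>)\<bar> * \<bar>cmod (\<eta> \<gamma>)\<bar>)"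
      by (simp add: norm_mult)
    also have "\<dots> \<le> L2_set (\<lambda>\<gamma>. cmod (\<xi> \<gamma>)) F * L2_set (\<lambda>\<gamma>. cmod (\<eta> \<gamma>)) F"
      by (rule L2_set_mult_ineq)
    also have "\<dots> \<le> l2_norm \<xi> * l2_norm \<eta>"
      using assms that by (intro mult_mono L2_set_le_l2_norm) simp_all
    finally show ?thesis .
  qed
  then show s: "(\<lambda>\<gamma>. cmod (\<xi> \<gamma> * cnj (\<eta> \<gamma>))) summable_on UNIV"
    by (intro nonneg_bdd_above_summable_on bdd_aboveI2[of _ _ "l2_norm \<xi> * l2_norm \<eta>"]) auto
  show "(\<Sum>\<^sub>\<infinity>\<gamma>. cmod (\<xi> \<gamma> * cnj (\<eta> \<gamma>))) \<le> l2_norm \<xi> * l2_norm \<eta>"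
    using s * by (rule infsum_le_finite_sums)
qed

lemma l2_inner_summable_on:
  assumes "\<xi> \<in> l2" "\<eta> \<in> l2" shows "(\<lambda>\<gamma>. \<xi> \<gamma> * cnj (\<eta> \<gamma>)) summable_on UNIV"
  by (rule abs_summable_summable[OF l2_inner_summable(1)[OF assms]])

lemma l2_Cauchy_Schwarz:
  assumes "\<xi> \<in> l2" "\<eta> \<in> l2" shows "cmod (l2_inner \<xi> \<eta>) \<le> l2_norm \<xi> * l2_norm \<eta>"
  unfolding l2_inner_def
  using norm_infsum_bound[OF l2_inner_summable(1)[OF assms]] l2_inner_summable(2)[OF assms] by simp

lemma l2_inner_add_left:
  assumes "\<xi> \<in> l2" "\<eta> \<in> l2" "\<zeta> \<in> l2"
  shows "l2_inner (\<lambda>\<gamma>. \<xi> \<gamma> + \<eta> \<gamma>) \<zeta> = l2_inner \<xi> \<zeta> + l2_inner \<eta> \<zeta>"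
  unfolding l2_inner_def ring_distribs
  by (rule infsum_add; rule l2_inner_summable_on; fact)

lemma l2_inner_scale_left: "l2_inner (\<lambda>\<gamma>. c * \<xi> \<gamma>) \<zeta> = c * l2_inner \<xi> \<zeta>"
  unfolding l2_inner_def by (simp add: mult.assoc infsum_cmult_right')

lemma l2_inner_cnj: "cnj (l2_inner \<xi> \<eta>) = l2_inner \<eta> \<xi>"
  unfolding l2_inner_def by (simp add: mult.commute flip: infsum_cnj)

lemma l2_inner_indicator: "l2_inner \<xi> (indicator {x}) = \<xi> x"
proof -
  have "l2_inner \<xi> (indicator {x}) = infsum (\<lambda>\<gamma>. \<xi> \<gamma>) {x}"
    unfolding l2_inner_def by (rule infsum_cong_neutral) auto
  then show ?thesis by simp
qed

lemma l2_inner_indicator_left: "l2_inner (indicator {x}) \<xi> = cnj (\<xi> x)"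
  using l2_inner_cnj[of \<xi> "indicator {x}"] by (simp add: l2_inner_indicator)

lemma l2_inner_self_nonneg:
  assumes "\<xi> \<in> l2" shows "0 \<le> l2_inner \<xi> \<xi>"
  unfolding l2_inner_def
  by (rule infsum_nonneg_complex[OF l2_inner_summable_on[OF assms assms]])
     (simp add: less_eq_complex_def flip: complex_norm_square)

text \<open>Restricting to \<epsilon> \<le> 1 allows quadratic error terms to be absorbed into
  linear ones when two operators are approximated at once.\<close>

lemma nonpos_if_le_scaled:
  fixes a B :: real
  assumes B: "0 \<le> B" and le: "\<And>\<epsilon>. 0 < \<epsilon> \<Longrightarrow> \<epsilon> \<le> 1 \<Longrightarrow> a \<le> B * \<epsilon>"
  shows "a \<le> 0"
proof (rule ccontr)
  assume "\<not> a \<le> 0"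
  then have a: "0 < a" by simp
  \<comment> \<open>The second term of the minimum gives B \<epsilon> \<le> a B / (2 (B + 1)) <
    a.\<close>
  define \<epsilon> where "\<epsilon> = min 1 (a / (2 * (B + 1)))"
  have "\<epsilon> \<le> a / (2 * (B + 1))" by (simp add: \<epsilon>_def)
  then have "\<epsilon> * (2 * (B + 1)) \<le> a" using B by (simp add: field_simps)
  moreover have "0 < \<epsilon>" using a B by (simp add: \<epsilon>_def)
  ultimately have "B * \<epsilon> < a" using a by (simp add: algebra_simps)
  moreover have "a \<le> B * \<epsilon>" using \<open>0 < \<epsilon>\<close> by (rule le) (simp add: \<epsilon>_def)
  ultimately show False by simp
qed

lemma l2_truncation:
  assumes "\<xi> \<in> l2" "0 < \<epsilon>"
  obtains F where "finite F" "l2_norm (\<lambda>\<gamma>. \<xi> \<gamma> - (if \<gamma> \<in> F then \<xi> \<gamma> else 0)) \<le> \<epsilon>"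
proof -
  let ?f = "\<lambda>\<gamma>. (cmod (\<xi> \<gamma>))\<^sup>2"
  have s: "?f summable_on UNIV" using assms by (simp add: l2_def)
  obtain F where F: "finite F" "dist (sum ?f F) (infsum ?f UNIV) \<le> \<epsilon>\<^sup>2"
    using infsum_finite_approximation[OF s, of "\<epsilon>\<^sup>2"] assms(2) by auto
  have "l2_norm (\<lambda>\<gamma>. \<xi> \<gamma> - (if \<gamma> \<in> F then \<xi> \<gamma> else 0)) \<le> \<epsilon>"
  proof (rule l2I(2))
    fix E :: "'a set" assume E: "finite E"
    have "(\<Sum>\<gamma>\<in>E. (cmod (\<xi> \<gamma> - (if \<gamma> \<in> F then \<xi> \<gamma> else 0)))\<^sup>2) = (\<Sum>\<gamma>\<in>E - F. ?f \<gamma>)"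
      using E by (intro sum.mono_neutral_cong_right) auto
    also have "\<dots> = (\<Sum>\<gamma>\<in>E \<union> F. ?f \<gamma>) - sum ?f F"
      using E F(1) by (subst sum_diff[symmetric]) (auto intro: sum.cong)
    also have "(\<Sum>\<gamma>\<in>E \<union> F. ?f \<gamma>) \<le> infsum ?f UNIV"
      using E F(1) by (intro finite_sum_le_infsum s) auto
    finally show "(\<Sum>\<gamma>\<in>E. (cmod (\<xi> \<gamma> - (if \<gamma> \<in> F then \<xi> \<gamma> else 0)))\<^sup>2) \<le> \<epsilon>\<^sup>2"
      using F(2) by (simp add: dist_real_def)
  qed (use assms in simp)
  then show thesis using that F(1) by blast
qed

lemma l2_finite_sum:
  assumes "\<And>i. i \<in> I \<Longrightarrow> \<xi> i \<in> l2" shows "(\<lambda>\<gamma>. \<Sum>i\<in>I. \<xi> i \<gamma>) \<in> l2"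
  using assms by (induction I rule: infinite_finite_induct) (simp_all add: l2_zero l2_add)

lemma truncation_eq_sum:
  fixes \<xi> :: "'g \<Rightarrow> complex"
  assumes "finite F"
  shows "(\<lambda>\<gamma>. if \<gamma> \<in> F then \<xi> \<gamma> else 0) = (\<lambda>\<gamma>. \<Sum>y\<in>F. \<xi> y * indicator {y} \<gamma>)"
proof
  fix \<gamma>
  have "(\<Sum>y\<in>F. \<xi> y * indicator {y} \<gamma>) = (\<Sum>y\<in>F. if y = \<gamma> then \<xi> y else 0)"
    by (intro sum.cong) (auto simp: indicator_def)
  then show "(if \<gamma> \<in> F then \<xi> \<gamma> else 0) = (\<Sum>y\<in>F. \<xi> y * indicator {y} \<gamma>)"
    using assms by simp
qed

section \<open>Bounded operators and their adjoints\<close>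

lemma bounded_operatorsD:
  assumes "T \<in> bounded_operators"
  shows "\<xi> \<in> l2 \<Longrightarrow> T \<xi> \<in> l2"
    "\<xi> \<in> l2 \<Longrightarrow> \<eta> \<in> l2 \<Longrightarrow> T (\<lambda>\<gamma>. \<xi> \<gamma> + \<eta> \<gamma>) = (\<lambda>\<gamma>. T \<xi> \<gamma> + T \<eta> \<gamma>)"
    "\<xi> \<in> l2 \<Longrightarrow> T (\<lambda>\<gamma>. c * \<xi> \<gamma>) = (\<lambda>\<gamma>. c * T \<xi> \<gamma>)"
    "T \<in> extensional l2"
proof -
  have 1: "T \<in> l2 \<rightarrow>\<^sub>E l2"
    and 2: "\<forall>\<xi>\<in>l2. \<forall>\<eta>\<in>l2. T (\<lambda>\<gamma>. \<xi> \<gamma> + \<eta> \<gamma>) = (\<lambda>\<gamma>. T \<xi> \<gamma> + T \<eta> \<gamma>)"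
    and 3: "\<forall>c. \<forall>\<xi>\<in>l2. T (\<lambda>\<gamma>. c * \<xi> \<gamma>) = (\<lambda>\<gamma>. c * T \<xi> \<gamma>)"
    using assms by (simp_all add: bounded_operators_def)
  show "\<xi> \<in> l2 \<Longrightarrow> T \<xi> \<in> l2" "T \<in> extensional l2" using 1 by (auto simp: PiE_def)
  show "\<xi> \<in> l2 \<Longrightarrow> \<eta> \<in> l2 \<Longrightarrow> T (\<lambda>\<gamma>. \<xi> \<gamma> + \<eta> \<gamma>) = (\<lambda>\<gamma>. T \<xi> \<gamma> + T \<eta> \<gamma>)"
    by (rule 2[rule_format])
  show "\<xi> \<in> l2 \<Longrightarrow> T (\<lambda>\<gamma>. c * \<xi> \<gamma>) = (\<lambda>\<gamma>. c * T \<xi> \<gamma>)"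
    by (rule 3[rule_format])
qed

lemma bounded_operators_bound:
  assumes "T \<in> bounded_operators"
  obtains C where "0 \<le> C" "\<And>\<xi>. \<xi> \<in> l2 \<Longrightarrow> l2_norm (T \<xi>) \<le> C * l2_norm \<xi>"
proof -
  have "\<exists>C. \<forall>\<xi>\<in>l2. l2_norm (T \<xi>) \<le> C * l2_norm \<xi>"
    using assms by (simp add: bounded_operators_def)
  then obtain C where C: "\<And>\<xi>. \<xi> \<in> l2 \<Longrightarrow> l2_norm (T \<xi>) \<le> C * l2_norm \<xi>" by blast
  have "l2_norm (T \<xi>) \<le> \<bar>C\<bar> * l2_norm \<xi>" if "\<xi> \<in> l2" for \<xi>
    by (rule order_trans[OF C[OF that] mult_right_mono[OF abs_ge_self l2_norm_nonneg]])
  then show thesis using that[of "\<bar>C\<bar>"] by simp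
qed

lemma bounded_operators_diff:
  assumes T: "T \<in> bounded_operators" and "\<xi> \<in> l2" "\<eta> \<in> l2"
  shows "T (\<lambda>\<gamma>. \<xi> \<gamma> - \<eta> \<gamma>) = (\<lambda>\<gamma>. T \<xi> \<gamma> - T \<eta> \<gamma>)"
  using bounded_operatorsD(2)[OF T assms(2) l2_scale[OF assms(3), of "-1"]]
    bounded_operatorsD(3)[OF T assms(3), of "-1"] by simp

lemma bounded_operators_sum:
  assumes T: "T \<in> bounded_operators" and "\<And>i. i \<in> I \<Longrightarrow> \<xi> i \<in> l2"
  shows "T (\<lambda>\<gamma>. \<Sum>i\<in>I. c i * \<xi> i \<gamma>) = (\<lambda>\<gamma>. \<Sum>i\<in>I. c i * T (\<xi> i) \<gamma>)"
proof -
  have zero: "T (\<lambda>\<gamma>. 0) = (\<lambda>\<gamma>. 0)"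
    using bounded_operatorsD(3)[OF T l2_zero(1), of 0] by simp
  show ?thesis
    using assms(2)
  proof (induction I rule: infinite_finite_induct)
    case (insert i I)
    have "T (\<lambda>\<gamma>. c i * \<xi> i \<gamma> + (\<Sum>i\<in>I. c i * \<xi> i \<gamma>)) =
      (\<lambda>\<gamma>. T (\<lambda>\<gamma>. c i * \<xi> i \<gamma>) \<gamma> + T (\<lambda>\<gamma>. \<Sum>i\<in>I. c i * \<xi> i \<gamma>) \<gamma>)"
      using insert.prems by (intro bounded_operatorsD(2)[OF T] l2_scale l2_finite_sum) auto
    then show ?case
      using insert bounded_operatorsD(3)[OF T, of "\<xi> i" "c i"] by simp
  qed (simp_all add: zero)
qed

lemma l2_inner_sum_left:
  assumes "\<And>i. i \<in> I \<Longrightarrow> \<xi> i \<in> l2" "\<eta> \<in> l2"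
  shows "l2_inner (\<lambda>\<gamma>. \<Sum>i\<in>I. c i * \<xi> i \<gamma>) \<eta> = (\<Sum>i\<in>I. c i * l2_inner (\<xi> i) \<eta>)"
proof -
  have zero: "l2_inner (\<lambda>\<gamma>. 0) \<eta> = 0" by (simp add: l2_inner_def)
  show ?thesis
    using assms(1)
  proof (induction I rule: infinite_finite_induct)
    case (insert i I)
    have "l2_inner (\<lambda>\<gamma>. c i * \<xi> i \<gamma> + (\<Sum>i\<in>I. c i * \<xi> i \<gamma>)) \<eta> =
      l2_inner (\<lambda>\<gamma>. c i * \<xi> i \<gamma>) \<eta> + l2_inner (\<lambda>\<gamma>. \<Sum>i\<in>I. c i * \<xi> i \<gamma>) \<eta>"
      using insert.prems assms(2) by (intro l2_inner_add_left l2_scale l2_finite_sum) auto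
    then show ?case using insert by (simp add: l2_inner_scale_left)
  qed (simp_all add: zero)
qed

text \<open>
  The matrix entries of the adjoint are forced; boundedness follows by testing against their finite
  truncations, which avoids the completeness of \<open>\<ell>\<^sup>2\<close>.
\<close>

lemma adjoint_exists:
  assumes T: "T \<in> bounded_operators"
  obtains S where "S \<in> bounded_operators"
    "\<And>\<xi> \<eta>. \<xi> \<in> l2 \<Longrightarrow> \<eta> \<in> l2 \<Longrightarrow> l2_inner (T \<xi>) \<eta> = l2_inner \<xi> (S \<eta>)"
proof -
  obtain C where C: "0 \<le> C" "\<And>\<xi>. \<xi> \<in> l2 \<Longrightarrow> l2_norm (T \<xi>) \<le> C * l2_norm \<xi>"
    using bounded_operators_bound[OF T] by blast
  define s where "s \<eta> \<gamma> = l2_inner \<eta> (T (indicator {\<gamma>}))" for \<eta> \<gamma>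
  let ?S = "\<lambda>\<eta>\<in>l2. s \<eta>"
  have Td: "T (indicator {\<gamma>}) \<in> l2" for \<gamma>
    by (rule bounded_operatorsD(1)[OF T l2_indicator_singleton(1)])
  have fin: "l2_inner (T (\<lambda>\<gamma>. \<Sum>y\<in>F. c y * indicator {y} \<gamma>)) \<eta> = (\<Sum>y\<in>F. c y * cnj (s \<eta> y))"
    if "\<eta> \<in> l2" for F c \<eta>
  proof -
    have "T (\<lambda>\<gamma>. \<Sum>y\<in>F. c y * indicator {y} \<gamma>) = (\<lambda>\<gamma>. \<Sum>y\<in>F. c y * T (indicator {y}) \<gamma>)"
      by (rule bounded_operators_sum[OF T]) (rule l2_indicator_singleton)
    then show ?thesis
      by (simp add: l2_inner_sum_left[OF Td that] s_def l2_inner_cnj)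
  qed
  have bound: "(\<Sum>\<gamma>\<in>F. (cmod (s \<eta> \<gamma>))\<^sup>2) \<le> (C * l2_norm \<eta>)\<^sup>2" if F: "finite F" and \<eta>: "\<eta> \<in> l2" for F \<eta>
  proof -
    \<comment> \<open>Pairing \<open>T \<zeta>\<close> with \<eta>, for the truncation \<zeta> of
      \<open>s \<eta>\<close>, gives the squared norm a^2 of \<zeta>. Cauchy-Schwarz bounds the
      pairing by C a times the norm of \<eta>, and a cancels.\<close>
    define \<zeta> where "\<zeta> = (\<lambda>\<gamma>. \<Sum>y\<in>F. s \<eta> y * indicator {y} \<gamma>)"
    define a where "a = sqrt (\<Sum>\<gamma>\<in>F. (cmod (s \<eta> \<gamma>))\<^sup>2)"
    have a: "0 \<le> a" "a\<^sup>2 = (\<Sum>\<gamma>\<in>F. (cmod (s \<eta> \<gamma>))\<^sup>2)" by (simp_all add: a_def sum_nonneg)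
    have \<zeta>: "\<zeta> = (\<lambda>\<gamma>. if \<gamma> \<in> F then s \<eta> \<gamma> else 0)"
      unfolding \<zeta>_def by (rule truncation_eq_sum[OF F, symmetric])
    have "(\<Sum>\<gamma>\<in>E. (cmod (\<zeta> \<gamma>))\<^sup>2) \<le> a\<^sup>2" if "finite E" for E
    proof -
      have "(\<Sum>\<gamma>\<in>E. (cmod (\<zeta> \<gamma>))\<^sup>2) = (\<Sum>\<gamma>\<in>E \<inter> F. (cmod (s \<eta> \<gamma>))\<^sup>2)"
        using that by (intro sum.mono_neutral_cong_right) (auto simp: \<zeta>)
      also have "\<dots> \<le> a\<^sup>2" unfolding a(2) using F by (intro sum_mono2) auto
      finally show ?thesis .
    qed
    from l2I[OF this a(1)] have \<zeta>2: "\<zeta> \<in> l2" "l2_norm \<zeta> \<le> a" by auto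
    have "complex_of_real (a\<^sup>2) = l2_inner (T \<zeta>) \<eta>"
      unfolding \<zeta>_def fin[OF \<eta>] a(2) of_real_sum by (simp only: complex_norm_square)
    then have "a\<^sup>2 = cmod (l2_inner (T \<zeta>) \<eta>)" by (metis abs_of_nonneg norm_of_real zero_le_power2)
    also have "\<dots> \<le> l2_norm (T \<zeta>) * l2_norm \<eta>"
      by (rule l2_Cauchy_Schwarz[OF bounded_operatorsD(1)[OF T \<zeta>2(1)] \<eta>])
    also have "\<dots> \<le> (C * a) * l2_norm \<eta>"
      using C(2)[OF \<zeta>2(1)] mult_left_mono[OF \<zeta>2(2) C(1)] by (intro mult_right_mono) auto
    finally have "a * a \<le> a * (C * l2_norm \<eta>)" by (simp add: power2_eq_square ac_simps)
    then have "a \<le> C * l2_norm \<eta>"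
      using a(1) C(1) by (cases "a = 0") auto
    then show ?thesis using a by (metis power_mono)
  qed
  have s: "s \<eta> \<in> l2" "l2_norm (s \<eta>) \<le> C * l2_norm \<eta>" if "\<eta> \<in> l2" for \<eta>
    using l2I[OF bound[OF _ that]] C(1) by auto
  have adj: "l2_inner (T \<xi>) \<eta> = l2_inner \<xi> (s \<eta>)" if \<xi>: "\<xi> \<in> l2" and \<eta>: "\<eta> \<in> l2" for \<xi> \<eta>
  proof -
    \<comment> \<open>The defect \<open>?d\<close> is additive, bounded by a multiple of the norm,
      and zero on finitely supported vectors, which are dense.\<close>
    let ?d = "\<lambda>\<xi>. l2_inner (T \<xi>) \<eta> - l2_inner \<xi> (s \<eta>)"
    let ?B = "2 * C * l2_norm \<eta>"
    have d: "cmod (?d \<zeta>) \<le> ?B * l2_norm \<zeta>" if "\<zeta> \<in> l2" for \<zeta>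
    proof -
      have "cmod (l2_inner (T \<zeta>) \<eta>) \<le> l2_norm (T \<zeta>) * l2_norm \<eta>"
        by (rule l2_Cauchy_Schwarz[OF bounded_operatorsD(1)[OF T that] \<eta>])
      also have "\<dots> \<le> (C * l2_norm \<zeta>) * l2_norm \<eta>" using C(2)[OF that] by (rule mult_right_mono) simp
      finally have 1: "cmod (l2_inner (T \<zeta>) \<eta>) \<le> C * l2_norm \<eta> * l2_norm \<zeta>" by (simp add: ac_simps)
      have "cmod (l2_inner \<zeta> (s \<eta>)) \<le> l2_norm \<zeta> * l2_norm (s \<eta>)"
        by (rule l2_Cauchy_Schwarz[OF that s(1)[OF \<eta>]])
      also have "\<dots> \<le> l2_norm \<zeta> * (C * l2_norm \<eta>)" using s(2)[OF \<eta>] by (rule mult_left_mono) simp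
      finally have 2: "cmod (l2_inner \<zeta> (s \<eta>)) \<le> C * l2_norm \<eta> * l2_norm \<zeta>" by (simp add: ac_simps)
      show ?thesis
        using norm_triangle_ineq4[of "l2_inner (T \<zeta>) \<eta>" "l2_inner \<zeta> (s \<eta>)"] 1 2 by (simp add: algebra_simps)
    qed
    have "cmod (?d \<xi>) \<le> ?B * \<epsilon>" if \<epsilon>: "0 < \<epsilon>" for \<epsilon>
    proof -
      obtain F where F: "finite F" "l2_norm (\<lambda>\<gamma>. \<xi> \<gamma> - (if \<gamma> \<in> F then \<xi> \<gamma> else 0)) \<le> \<epsilon>"
        using l2_truncation[OF \<xi> \<epsilon>] by blast
      define \<xi>F where "\<xi>F = (\<lambda>\<gamma>. \<Sum>y\<in>F. \<xi> y * indicator {y} \<gamma>)"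
      have \<xi>F: "\<xi>F = (\<lambda>\<gamma>. if \<gamma> \<in> F then \<xi> \<gamma> else 0)"
        unfolding \<xi>F_def by (rule truncation_eq_sum[OF F(1), symmetric])
      have mem: "\<xi>F \<in> l2"
        unfolding \<xi>F_def by (intro l2_finite_sum l2_scale l2_indicator_singleton)
      define \<zeta> where "\<zeta> = (\<lambda>\<gamma>. \<xi> \<gamma> - \<xi>F \<gamma>)"
      have \<zeta>: "\<zeta> \<in> l2" "l2_norm \<zeta> \<le> \<epsilon>"
        using F(2) l2_diff[OF \<xi> mem] by (simp_all add: \<zeta>_def \<xi>F)
      have zero: "?d \<xi>F = 0"
      proof -
        have "l2_inner \<xi>F (s \<eta>) = (\<Sum>y\<in>F. \<xi> y * l2_inner (indicator {y}) (s \<eta>))"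
          unfolding \<xi>F_def by (rule l2_inner_sum_left[OF l2_indicator_singleton(1) s(1)[OF \<eta>]])
        also have "\<dots> = (\<Sum>y\<in>F. \<xi> y * cnj (s \<eta> y))"
          by (simp only: l2_inner_indicator_left)
        finally show ?thesis using fin[OF \<eta>, of \<xi> F] by (simp add: \<xi>F_def)
      qed
      have \<xi>eq: "\<xi> = (\<lambda>\<gamma>. \<xi>F \<gamma> + \<zeta> \<gamma>)" by (simp add: \<zeta>_def)
      have "T \<xi> = (\<lambda>\<gamma>. T \<xi>F \<gamma> + T \<zeta> \<gamma>)"
        using bounded_operatorsD(2)[OF T mem \<zeta>(1)] \<xi>eq by simp
      then have "l2_inner (T \<xi>) \<eta> = l2_inner (T \<xi>F) \<eta> + l2_inner (T \<zeta>) \<eta>"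
        using l2_inner_add_left[OF bounded_operatorsD(1)[OF T mem] bounded_operatorsD(1)[OF T \<zeta>(1)] \<eta>] by simp
      moreover have "l2_inner \<xi> (s \<eta>) = l2_inner \<xi>F (s \<eta>) + l2_inner \<zeta> (s \<eta>)"
        using l2_inner_add_left[OF mem \<zeta>(1) s(1)[OF \<eta>]] \<xi>eq by simp
      ultimately have "?d \<xi> = ?d \<zeta>" using zero by simp
      then have "cmod (?d \<xi>) \<le> ?B * l2_norm \<zeta>" using d[OF \<zeta>(1)] by simp
      also have "\<dots> \<le> ?B * \<epsilon>" using \<zeta>(2) C(1) by (intro mult_left_mono) auto
      finally show ?thesis .
    qed
    then have "cmod (?d \<xi>) \<le> 0"
      using C(1) by (intro nonpos_if_le_scaled[of ?B]) auto
    then show ?thesis by simp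
  qed
  show thesis
  proof (rule that)
    have "s (\<lambda>\<gamma>. \<xi> \<gamma> + \<eta> \<gamma>) = (\<lambda>\<gamma>. s \<xi> \<gamma> + s \<eta> \<gamma>)" if "\<xi> \<in> l2" "\<eta> \<in> l2" for \<xi> \<eta>
      unfolding s_def using l2_inner_add_left[OF that Td] by (rule ext)
    moreover have "s (\<lambda>\<gamma>. c * \<xi> \<gamma>) = (\<lambda>\<gamma>. c * s \<xi> \<gamma>)" for \<xi> c
      unfolding s_def using l2_inner_scale_left by (rule ext)
    moreover have "\<exists>C. \<forall>\<xi>\<in>l2. l2_norm (s \<xi>) \<le> C * l2_norm \<xi>" using s(2) by blast
    ultimately show "?S \<in> bounded_operators"
      unfolding bounded_operators_def using s(1) by (auto simp: l2_add l2_scale)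
    show "l2_inner (T \<xi>) \<eta> = l2_inner \<xi> (?S \<eta>)" if "\<xi> \<in> l2" "\<eta> \<in> l2" for \<xi> \<eta>
      using adj[OF that] that by simp
  qed
qed

text \<open>Two adjoints agree on \<open>l2\<close> by pairing with point masses. Both are
  \<open>undefined\<close> off \<open>l2\<close>, so they are equal as functions, as the definite
  description requires.\<close>

lemma adjoint_operator:
  assumes T: "T \<in> bounded_operators"
  shows "adjoint_operator T \<in> bounded_operators"
    "\<xi> \<in> l2 \<Longrightarrow> \<eta> \<in> l2 \<Longrightarrow> l2_inner (T \<xi>) \<eta> = l2_inner \<xi> (adjoint_operator T \<eta>)"
proof -
  let ?P = "\<lambda>S. S \<in> bounded_operators \<and> (\<forall>\<xi>\<in>l2. \<forall>\<eta>\<in>l2. l2_inner (T \<xi>) \<eta> = l2_inner \<xi> (S \<eta>))"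
  obtain S where "S \<in> bounded_operators"
    and "\<And>\<xi> \<eta>. \<xi> \<in> l2 \<Longrightarrow> \<eta> \<in> l2 \<Longrightarrow> l2_inner (T \<xi>) \<eta> = l2_inner \<xi> (S \<eta>)"
    using adjoint_exists[OF T] by blast
  then have S: "?P S" by simp
  have "S' = S" if S': "?P S'" for S'
  proof (rule extensionalityI[where A = l2])
    show "S' \<in> extensional l2" "S \<in> extensional l2" using S S' bounded_operatorsD(4) by blast+
    fix \<eta> :: "'a \<Rightarrow> complex" assume \<eta>: "\<eta> \<in> l2"
    show "S' \<eta> = S \<eta>"
    proof
      fix \<gamma>
      have "l2_inner (indicator {\<gamma>}) (S' \<eta>) = l2_inner (indicator {\<gamma>}) (S \<eta>)"
        using S S' \<eta> l2_indicator_singleton(1)[of \<gamma>] by metis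
      then have "cnj (S' \<eta> \<gamma>) = cnj (S \<eta> \<gamma>)"
        by (simp only: l2_inner_indicator_left)
      then show "S' \<eta> \<gamma> = S \<eta> \<gamma>" by simp
    qed
  qed
  with S have "?P (adjoint_operator T)"
    unfolding adjoint_operator_def by (rule theI[where P = ?P])
  then show "adjoint_operator T \<in> bounded_operators"
    "\<xi> \<in> l2 \<Longrightarrow> \<eta> \<in> l2 \<Longrightarrow> l2_inner (T \<xi>) \<eta> = l2_inner \<xi> (adjoint_operator T \<eta>)" by blast+
qed

section \<open>The tracial state on the reduced algebra\<close>

lemma diagonal_bounded:
  fixes T :: "('a \<Rightarrow> complex) \<Rightarrow> 'a \<Rightarrow> complex"
  assumes "\<And>x. T (indicator {x}) \<in> l2" "\<And>x. l2_norm (T (indicator {x})) \<le> C"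
  shows "(\<lambda>x. T (indicator {x}) x) \<in> complex_bounded_on X"
proof (rule complex_bounded_onI[of _ _ C])
  fix x show "cmod (T (indicator {x}) x) \<le> C"
    using cmod_le_l2_norm[OF assms(1)] assms(2) order_trans by blast
qed

lemma bounded_operator_norm_indicator:
  assumes "T \<in> bounded_operators"
  obtains C where "0 \<le> C" "\<And>x. l2_norm (T (indicator {x})) \<le> C"
proof -
  obtain C where C: "0 \<le> C" "\<And>\<xi>. \<xi> \<in> l2 \<Longrightarrow> l2_norm (T \<xi>) \<le> C * l2_norm \<xi>"
    using bounded_operators_bound[OF assms] by blast
  have "l2_norm (T (indicator {x})) \<le> C" for x
    using C(2)[OF l2_indicator_singleton(1), of x] mult_left_mono[OF l2_indicator_singleton(2)[of x] C(1)]
    by simp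
  then show thesis using that C(1) by blast
qed

lemma bounded_operator_diagonal:
  assumes "T \<in> bounded_operators"
  shows "(\<lambda>x. T (indicator {x}) x) \<in> complex_bounded_on X"
proof -
  obtain C where C: "0 \<le> C" "\<And>x. l2_norm (T (indicator {x})) \<le> C"
    using bounded_operator_norm_indicator[OF assms] by blast
  show ?thesis
    by (rule diagonal_bounded[where C = C])
       (rule bounded_operatorsD(1)[OF assms l2_indicator_singleton(1)], rule C(2))
qed

lemma bounded_operator_comp_diagonal:
  assumes S: "S \<in> bounded_operators" and T: "T \<in> bounded_operators"
  shows "(\<lambda>x. S (T (indicator {x})) x) \<in> complex_bounded_on X"
proof -
  obtain C where C: "0 \<le> C" "\<And>x. l2_norm (T (indicator {x})) \<le> C"
    using bounded_operator_norm_indicator[OF T] by blast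
  obtain B where B: "0 \<le> B" "\<And>\<xi>. \<xi> \<in> l2 \<Longrightarrow> l2_norm (S \<xi>) \<le> B * l2_norm \<xi>"
    using bounded_operators_bound[OF S] by blast
  have Td: "T (indicator {x}) \<in> l2" for x
    by (rule bounded_operatorsD(1)[OF T l2_indicator_singleton(1)])
  show ?thesis
  proof (rule diagonal_bounded[where T = "\<lambda>\<xi>. S (T \<xi>)" and C = "B * C"])
    show "S (T (indicator {x})) \<in> l2" for x by (rule bounded_operatorsD(1)[OF S Td])
    show "l2_norm (S (T (indicator {x}))) \<le> B * C" for x
      by (rule order_trans[OF B(2)[OF Td] mult_left_mono[OF C(2) B(1)]])
  qed
qed

section \<open>Convolution operators and approximation of continuous functions\<close>

context compact_ample_groupoid
begin

lemma convolution_thin_sum: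
  assumes D: "thin D" "{\<alpha>. f \<alpha> \<noteq> 0} \<subseteq> D"
  shows "convolution G f g \<gamma> = (\<Sum>\<alpha> | \<alpha> \<in> D \<and> rng G \<alpha> = rng G \<gamma>. f \<alpha> * g (ginv G \<alpha> \<cdot> \<gamma>))"
  unfolding convolution_eq_rng_sum
proof (rule sum.mono_neutral_left)
  show "{\<alpha>. rng G \<alpha> = rng G \<gamma> \<and> f \<alpha> * g (ginv G \<alpha> \<cdot> \<gamma>) \<noteq> 0} \<subseteq> {\<alpha> \<in> D. rng G \<alpha> = rng G \<gamma>}"
  proof
    fix \<alpha> assume \<alpha>: "\<alpha> \<in> {\<alpha>. rng G \<alpha> = rng G \<gamma> \<and> f \<alpha> * g (ginv G \<alpha> \<cdot> \<gamma>) \<noteq> 0}"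
    then have "f \<alpha> \<noteq> 0" by auto
    then show "\<alpha> \<in> {\<alpha> \<in> D. rng G \<alpha> = rng G \<gamma>}" using \<alpha> D(2) by blast
  qed
qed (use thin_finite_fibres[OF D(1)] in auto)

text \<open>A Schur test. Each value of the convolution is a sum of at most \<open>N\<close> terms,
  so Cauchy-Schwarz costs a factor \<open>N\<close>; after exchanging the sums each coordinate of
  \<open>\<xi>\<close> is counted at most \<open>N\<close> times.\<close>

lemma convolution_l2:
  fixes f \<xi> :: "'g \<Rightarrow> complex"
  assumes D: "thin D" "{\<alpha>. f \<alpha> \<noteq> 0} \<subseteq> D" and b: "\<And>\<alpha>. cmod (f \<alpha>) \<le> b" and \<xi>: "\<xi> \<in> l2"
  shows "convolution G f \<xi> \<in> l2"
proof -
  obtain N where N: "\<And>x. card {\<alpha> \<in> D. rng G \<alpha> = x} \<le> N" "\<And>x. card {\<alpha> \<in> D. src G \<alpha> = x} \<le> N"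
    using thin_fibres_bounded[OF D(1)] by blast
  have b0: "0 \<le> b" using b[of undefined] norm_ge_zero order_trans by blast
  let ?R = "\<lambda>\<gamma>. {\<alpha> \<in> D. rng G \<alpha> = rng G \<gamma>}"
  have finR: "finite (?R \<gamma>)" for \<gamma> by (rule thin_finite_fibres(1)[OF D(1)])
  have pt: "(cmod (convolution G f \<xi> \<gamma>))\<^sup>2 \<le> b\<^sup>2 * N * (\<Sum>\<alpha>\<in>?R \<gamma>. (cmod (\<xi> (ginv G \<alpha> \<cdot> \<gamma>)))\<^sup>2)" for \<gamma>
  proof -
    let ?t = "\<lambda>\<alpha>. cmod (\<xi> (ginv G \<alpha> \<cdot> \<gamma>))"
    have "cmod (convolution G f \<xi> \<gamma>) \<le> (\<Sum>\<alpha>\<in>?R \<gamma>. cmod (f \<alpha> * \<xi> (ginv G \<alpha> \<cdot> \<gamma>)))"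
      unfolding convolution_thin_sum[OF D] by (rule norm_sum)
    also have "\<dots> \<le> (\<Sum>\<alpha>\<in>?R \<gamma>. b * ?t \<alpha>)"
      by (rule sum_mono) (simp add: norm_mult mult_right_mono b)
    finally have "(cmod (convolution G f \<xi> \<gamma>))\<^sup>2 \<le> (b * (\<Sum>\<alpha>\<in>?R \<gamma>. ?t \<alpha>))\<^sup>2"
      unfolding sum_distrib_left by (rule power_mono) simp
    also have "\<dots> = b\<^sup>2 * (\<Sum>\<alpha>\<in>?R \<gamma>. ?t \<alpha>)\<^sup>2" by (rule power_mult_distrib)
    also have "\<dots> \<le> b\<^sup>2 * ((\<Sum>\<alpha>\<in>?R \<gamma>. (?t \<alpha>)\<^sup>2) * card (?R \<gamma>))"
      by (intro mult_left_mono sum_squared_le_sum_of_squares) simp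
    also have "\<dots> \<le> b\<^sup>2 * ((\<Sum>\<alpha>\<in>?R \<gamma>. (?t \<alpha>)\<^sup>2) * N)"
      using N(1)[of "rng G \<gamma>"] by (intro mult_left_mono) (simp_all add: sum_nonneg)
    finally show ?thesis by (simp only: ac_simps)
  qed
  show ?thesis
  proof (rule l2I(1)[of _ "b * N * l2_norm \<xi>"])
    fix F :: "'g set" assume F: "finite F"
    let ?P = "SIGMA \<gamma>:F. ?R \<gamma>"
    \<comment> \<open>The pair \<gamma>, \<alpha> is replaced by \<beta>, \<alpha> with \<gamma> =
      \<alpha> \<beta>. For fixed \<beta>, the arrows \<alpha> then lie in one source fibre of
      \<open>D\<close>.\<close>
    let ?q = "\<lambda>(\<gamma>, \<alpha>). (ginv G \<alpha> \<cdot> \<gamma>, \<alpha>)"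
    let ?B = "fst ` ?q ` ?P"
    let ?Q = "SIGMA \<beta>:?B. {\<alpha> \<in> D. src G \<alpha> = rng G \<beta>}"
    have fP: "finite ?P" using F finR by (rule finite_SigmaI)
    have fQ: "finite ?Q"
    proof (rule finite_SigmaI)
      show "finite ?B" by (intro finite_imageI fP)
    qed (rule thin_finite_fibres(2)[OF D(1)])
    have inj: "inj_on ?q ?P"
      by (rule inj_on_inverseI[where g = "\<lambda>(\<beta>, \<alpha>). (\<alpha> \<cdot> \<beta>, \<alpha>)"]) auto
    have sub: "?q ` ?P \<subseteq> ?Q" by force
    have "(\<Sum>\<gamma>\<in>F. \<Sum>\<alpha>\<in>?R \<gamma>. (cmod (\<xi> (ginv G \<alpha> \<cdot> \<gamma>)))\<^sup>2) = (\<Sum>p\<in>?P. (cmod (\<xi> (fst (?q p))))\<^sup>2)"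
      using F finR by (subst sum.Sigma) (auto intro!: sum.cong)
    also have "\<dots> = (\<Sum>p\<in>?q ` ?P. (cmod (\<xi> (fst p)))\<^sup>2)"
      by (subst sum.reindex[OF inj]) simp
    also have "\<dots> \<le> (\<Sum>p\<in>?Q. (cmod (\<xi> (fst p)))\<^sup>2)"
      by (rule sum_mono2[OF fQ sub]) simp
    also have "\<dots> = (\<Sum>\<beta>\<in>?B. \<Sum>\<alpha> | \<alpha> \<in> D \<and> src G \<alpha> = rng G \<beta>. (cmod (\<xi> \<beta>))\<^sup>2)"
      using fP thin_finite_fibres(2)[OF D(1)] by (subst sum.Sigma) (auto intro!: sum.cong)
    also have "\<dots> \<le> (\<Sum>\<beta>\<in>?B. N * (cmod (\<xi> \<beta>))\<^sup>2)"
      using N(2) by (intro sum_mono) (simp add: mult_right_mono)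
    also have "\<dots> = N * (\<Sum>\<beta>\<in>?B. (cmod (\<xi> \<beta>))\<^sup>2)" by (rule sum_distrib_left[symmetric])
    also have "\<dots> \<le> N * (l2_norm \<xi>)\<^sup>2"
      using fP by (intro mult_left_mono l2_bound_finite[OF \<xi>]) auto
    finally have S: "(\<Sum>\<gamma>\<in>F. \<Sum>\<alpha>\<in>?R \<gamma>. (cmod (\<xi> (ginv G \<alpha> \<cdot> \<gamma>)))\<^sup>2) \<le> N * (l2_norm \<xi>)\<^sup>2" .
    have "(\<Sum>\<gamma>\<in>F. (cmod (convolution G f \<xi> \<gamma>))\<^sup>2) \<le>
        (\<Sum>\<gamma>\<in>F. b\<^sup>2 * N * (\<Sum>\<alpha>\<in>?R \<gamma>. (cmod (\<xi> (ginv G \<alpha> \<cdot> \<gamma>)))\<^sup>2))"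
      by (rule sum_mono) (rule pt)
    also have "\<dots> = b\<^sup>2 * N * (\<Sum>\<gamma>\<in>F. \<Sum>\<alpha>\<in>?R \<gamma>. (cmod (\<xi> (ginv G \<alpha> \<cdot> \<gamma>)))\<^sup>2)"
      by (rule sum_distrib_left[symmetric])
    also have "\<dots> \<le> b\<^sup>2 * N * (N * (l2_norm \<xi>)\<^sup>2)" using S by (rule mult_left_mono) simp
    finally show "(\<Sum>\<gamma>\<in>F. (cmod (convolution G f \<xi> \<gamma>))\<^sup>2) \<le> (b * N * l2_norm \<xi>)\<^sup>2"
      by (simp add: power_mult_distrib power2_eq_square ac_simps)
  qed (use b0 in simp)
qed

text \<open>Finitely many compact open bisections cover the support. Both sets are kept: the compact
  \<open>K\<close> for a later covering argument, the open thin \<open>D\<close> as room for the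
  bisections chosen in it.\<close>

lemma compactly_supported_thin:
  assumes "f \<in> compactly_supported_functions"
  obtains K D where "compact K" "{\<alpha>. f \<alpha> \<noteq> 0} \<subseteq> K" "K \<subseteq> D" "open D" "thin D"
proof -
  obtain K where K: "compact K" "\<And>\<alpha>. \<alpha> \<notin> K \<Longrightarrow> f \<alpha> = 0"
    using assms unfolding compactly_supported_functions_def by blast
  have "\<exists>U\<in>compact_open_bisections G. \<gamma> \<in> U" for \<gamma>
    by (rule compact_open_bisection_basis[OF open_UNIV UNIV_I, of \<gamma>]) blast
  then obtain U where U: "\<And>\<gamma>. U \<gamma> \<in> compact_open_bisections G" "\<And>\<gamma>. \<gamma> \<in> U \<gamma>" by metis
  obtain Y where Y: "Y \<subseteq> K" "finite Y" "K \<subseteq> (\<Union>y\<in>Y. U y)"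
  proof (rule compactE_image[OF K(1)])
    show "open (U y)" for y using U(1)[of y] by (simp add: compact_open_bisections_def)
    show "K \<subseteq> (\<Union>y\<in>K. U y)" using U(2) by blast
  qed
  show thesis
  proof (rule that[OF K(1) _ Y(3)])
    show "thin (\<Union>y\<in>Y. U y)" using Y(2) U(1) by (intro thin_Union_bisections) auto
    show "open (\<Union>y\<in>Y. U y)" using U(1) by (auto simp: compact_open_bisections_def)
  qed (use K(2) in blast)
qed

lemma compactly_supported_bounded:
  assumes "f \<in> compactly_supported_functions"
  obtains b where "\<And>\<alpha>. cmod (f \<alpha>) \<le> b"
proof -
  obtain K where K: "compact K" "\<And>\<alpha>. \<alpha> \<notin> K \<Longrightarrow> f \<alpha> = 0" and c: "continuous_on UNIV f"
    using assms unfolding compactly_supported_functions_def by blast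
  have "compact (f ` K)" using K(1) continuous_on_subset[OF c] by (intro compact_continuous_image) auto
  then obtain b where b: "\<And>z. z \<in> f ` K \<Longrightarrow> cmod z \<le> b"
    using compact_imp_bounded bounded_iff by metis
  have "cmod (f \<alpha>) \<le> max b 0" for \<alpha>
    using b[of "f \<alpha>"] K(2)[of \<alpha>] by (cases "\<alpha> \<in> K") auto
  then show thesis by (rule that)
qed

lemma regular_rep_l2:
  assumes f: "f \<in> compactly_supported_functions" and \<xi>: "\<xi> \<in> l2"
  shows "regular_rep G f \<xi> = convolution G f \<xi>" "convolution G f \<xi> \<in> l2"
proof -
  show "regular_rep G f \<xi> = convolution G f \<xi>" using \<xi> by (simp add: regular_rep_def)
  obtain K D where *: "compact K" "{\<alpha>. f \<alpha> \<noteq> 0} \<subseteq> K" "K \<subseteq> D" "open D" "thin D"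
    by (rule compactly_supported_thin[OF f]) (rule that)
  obtain b where b: "\<And>\<alpha>. cmod (f \<alpha>) \<le> b" using compactly_supported_bounded[OF f] by blast
  from convolution_l2[OF *(5) order_trans[OF *(2,3)] b \<xi>] show "convolution G f \<xi> \<in> l2" .
qed

lemma convolution_indicator_singleton:
  fixes g :: "'g \<Rightarrow> complex"
  assumes x: "x \<in> units G"
  shows "convolution G g (indicator {x}) \<gamma> = (if src G \<gamma> = x then g \<gamma> else 0)"
proof -
  let ?S = "{\<beta>. src G \<beta> = src G \<gamma> \<and> g (\<gamma> \<cdot> ginv G \<beta>) * indicator {x} \<beta> \<noteq> 0}"
  have S: "\<beta> = x \<and> src G \<gamma> = x \<and> g \<gamma> \<noteq> 0" if "\<beta> \<in> ?S" for \<beta>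
  proof -
    have "\<beta> = x" using that by (auto split: split_indicator_asm)
    moreover have "src G \<gamma> = x" using that \<open>\<beta> = x\<close> x by simp
    ultimately show ?thesis using that x by simp
  qed
  show ?thesis
  proof (cases "src G \<gamma> = x \<and> g \<gamma> \<noteq> 0")
    case True
    then have "x \<in> ?S" using x by simp
    then have "?S = {x}" using S by blast
    then show ?thesis unfolding convolution_eq_src_sum using True x by simp
  next
    case False
    then have "?S = {}" using S by blast
    then show ?thesis unfolding convolution_eq_src_sum using False by (simp only: sum.empty) auto
  qed
qed

text \<open>Convolving with the point mass at x restricts a function to the arrows with source x.
  The diagonal coefficients of products of convolution operators are therefore the fibre sums known
  from the groupoid algebra.\<close>

lemma convolution_diagonal:
  fixes f g :: "'g \<Rightarrow> complex"
  assumes D: "thin D" "{\<alpha>. f \<alpha> \<noteq> 0} \<subseteq> D" and x: "x \<in> units G"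
  shows "convolution G f (convolution G g (indicator {x})) x =
      (\<Sum>\<alpha> | \<alpha> \<in> D \<and> rng G \<alpha> = x. f \<alpha> * g (ginv G \<alpha>))"
    "convolution G g (convolution G f (indicator {x})) x =
      (\<Sum>\<alpha> | \<alpha> \<in> D \<and> src G \<alpha> = x. f \<alpha> * g (ginv G \<alpha>))"
proof -
  have "convolution G f (convolution G g (indicator {x})) x =
      (\<Sum>\<alpha> | \<alpha> \<in> D \<and> rng G \<alpha> = x. f \<alpha> * convolution G g (indicator {x}) (ginv G \<alpha>))"
    by (rule convolution_at_unit_rng[OF D(1) _ x]) (use D(2) in blast)
  also have "\<dots> = (\<Sum>\<alpha> | \<alpha> \<in> D \<and> rng G \<alpha> = x. f \<alpha> * g (ginv G \<alpha>))"
    by (intro sum.cong refl) (simp add: convolution_indicator_singleton[OF x])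
  finally show "convolution G f (convolution G g (indicator {x})) x =
      (\<Sum>\<alpha> | \<alpha> \<in> D \<and> rng G \<alpha> = x. f \<alpha> * g (ginv G \<alpha>))" .
  have "convolution G g (convolution G f (indicator {x})) x =
      (\<Sum>\<alpha> | \<alpha> \<in> D \<and> src G \<alpha> = x. convolution G f (indicator {x}) \<alpha> * g (ginv G \<alpha>))"
    by (rule convolution_at_unit_src[OF D(1) _ x])
       (use D(2) in \<open>auto simp: convolution_indicator_singleton[OF x] split: if_splits\<close>)
  also have "\<dots> = (\<Sum>\<alpha> | \<alpha> \<in> D \<and> src G \<alpha> = x. f \<alpha> * g (ginv G \<alpha>))"
    by (intro sum.cong refl) (simp add: convolution_indicator_singleton[OF x])
  finally show "convolution G g (convolution G f (indicator {x})) x =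
      (\<Sum>\<alpha> | \<alpha> \<in> D \<and> src G \<alpha> = x. f \<alpha> * g (ginv G \<alpha>))" .
qed

text \<open>Around each point of \<open>K\<close> the function varies by less than \<epsilon> on
  some compact open bisection. Finitely many of these cover \<open>K\<close> and are made disjoint;
  the value at the centre of the original bisection is the coefficient of the piece.\<close>

lemma locally_constant_approximation:
  fixes k :: "'g \<Rightarrow> complex"
  assumes H: "Hausdorff_space (euclidean :: 'g topology)"
    and k: "continuous_on UNIV k" and K: "compact K" "{\<alpha>. k \<alpha> \<noteq> 0} \<subseteq> K"
    and D: "K \<subseteq> D" "open D" and e: "0 < \<epsilon>"
  shows "\<exists>(n::nat) c W. (\<forall>i<n. W i \<in> open_bisections G \<and> W i \<subseteq> D) \<and>
    (\<forall>\<alpha>. cmod (k \<alpha> - (\<Sum>i<n. c i * indicator (W i) \<alpha>)) \<le> \<epsilon>)"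
proof -
  have "\<exists>U\<in>compact_open_bisections G. \<gamma> \<in> U \<and> U \<subseteq> D \<inter> k -` ball (k \<gamma>) \<epsilon>" if "\<gamma> \<in> K" for \<gamma>
  proof -
    have o: "open (D \<inter> k -` ball (k \<gamma>) \<epsilon>)" using open_vimage[OF open_ball k] D(2) by blast
    have m: "\<gamma> \<in> D \<inter> k -` ball (k \<gamma>) \<epsilon>" using that D(1) e by auto
    show ?thesis by (rule compact_open_bisection_basis[OF o m]) blast
  qed
  then obtain U where U: "\<And>\<gamma>. \<gamma> \<in> K \<Longrightarrow> U \<gamma> \<in> compact_open_bisections G" "\<And>\<gamma>. \<gamma> \<in> K \<Longrightarrow> \<gamma> \<in> U \<gamma>"
    "\<And>\<gamma>. \<gamma> \<in> K \<Longrightarrow> U \<gamma> \<subseteq> D \<inter> k -` ball (k \<gamma>) \<epsilon>" by metis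
  obtain Y where Y: "Y \<subseteq> K" "finite Y" "K \<subseteq> (\<Union>y\<in>Y. U y)"
  proof (rule compactE_image[OF K(1)])
    show "open (U y)" if "y \<in> K" for y using U(1)[OF that] by (simp add: compact_open_bisections_def)
    show "K \<subseteq> (\<Union>y\<in>K. U y)" using U(2) by blast
  qed
  obtain y n where y: "Y = y ` {i::nat. i < n}"
    using finite_imp_nat_seg_image_inj_on[OF Y(2)] by blast
  have yK: "y i \<in> K" if "i < n" for i using Y(1) y that by blast
  \<comment> \<open>Removing the earlier sets leaves an open set because compact sets are closed in
    the Hausdorff space of arrows. Disjointness lets at most one coefficient count at each
    arrow.\<close>
  define W where "W i = U (y i) - (\<Union>j<i. U (y j))" for i
  have W: "W i \<in> open_bisections G" "W i \<subseteq> D" if "i < n" for i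
  proof -
    have "closed (U (y j))" if "j < i" for j
    proof -
      have "compact (U (y j))" using U(1)[OF yK, of j] that \<open>i < n\<close> by (simp add: compact_open_bisections_def)
      then have "closedin euclidean (U (y j))" using compactin_imp_closedin[OF H] by simp
      then show ?thesis by simp
    qed
    then have "closed (\<Union>j<i. U (y j))" by (intro closed_UN) auto
    moreover have *: "U (y i) \<in> open_bisections G" using U(1)[OF yK[OF that]] by (simp add: compact_open_bisections_eq)
    ultimately have "open (W i)" unfolding W_def by (intro open_Diff) (auto simp: open_bisections_def)
    then show "W i \<in> open_bisections G" by (rule open_bisection_subset[OF *]) (auto simp: W_def)
    show "W i \<subseteq> D" using U(3)[OF yK[OF that]] by (auto simp: W_def)
  qed
  have "cmod (k \<alpha> - (\<Sum>i<n. k (y i) * indicator (W i) \<alpha>)) \<le> \<epsilon>" for \<alpha>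
  proof (cases "\<exists>i<n. \<alpha> \<in> U (y i)")
    case True
    define i where "i = (LEAST i. i < n \<and> \<alpha> \<in> U (y i))"
    have i: "i < n" "\<alpha> \<in> U (y i)" using LeastI_ex[OF True] by (simp_all add: i_def)
    have least: "\<alpha> \<notin> U (y j)" if "j < i" for j
      using not_less_Least[of j "\<lambda>i. i < n \<and> \<alpha> \<in> U (y i)"] that i(1) by (auto simp: i_def)
    have "\<alpha> \<in> W j \<longleftrightarrow> j = i" for j
    proof
      assume "\<alpha> \<in> W j"
      then have "\<not> j < i" "\<not> i < j" using least i(2) by (auto simp: W_def)
      then show "j = i" by simp
    next
      assume "j = i"
      then show "\<alpha> \<in> W j" using i(2) least by (auto simp: W_def)
    qed
    then have "(\<Sum>j<n. k (y j) * indicator (W j) \<alpha>) = (\<Sum>j<n. if j = i then k (y j) else 0)"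
      by (intro sum.cong) (auto simp: indicator_def)
    also have "\<dots> = k (y i)" using i(1) by simp
    finally show ?thesis using U(3)[OF yK[OF i(1)]] i(2) by (auto simp: dist_norm norm_minus_commute)
  next
    case False
    then have "\<alpha> \<notin> K" using Y(3) y by auto
    then have "k \<alpha> = 0" using K(2) by blast
    moreover have "\<alpha> \<notin> W i" if "i < n" for i using False that by (auto simp: W_def)
    ultimately show ?thesis using e by simp
  qed
  then show ?thesis
    using W by (intro exI[of _ n] exI[of _ "\<lambda>i. k (y i)"] exI[of _ W]) simp
qed

end

section \<open>Traciality of the diagonal state\<close>

context invariant_functional
begin

text \<open>A fibre sum has at most \<open>N\<close> terms, so a uniform error \<epsilon> in k
  changes it by at most N \<epsilon>. The factor 2 of \<open>norm_complexified_le\<close>, once for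
  ranges and once for sources, leads to 4 N \<epsilon>.\<close>

lemma complexified_balanced_continuous:
  fixes k :: "'g \<Rightarrow> complex"
  assumes H: "Hausdorff_space (euclidean :: 'g topology)"
    and k: "continuous_on UNIV k" "k \<in> complex_bounded_on UNIV"
    and K: "compact K" "{\<alpha>. k \<alpha> \<noteq> 0} \<subseteq> K"
    and D: "K \<subseteq> D" "open D" "thin D"
  shows "complexified (\<lambda>x. \<Sum>\<alpha> | \<alpha> \<in> D \<and> rng G \<alpha> = x. k \<alpha>) =
    complexified (\<lambda>x. \<Sum>\<alpha> | \<alpha> \<in> D \<and> src G \<alpha> = x. k \<alpha>)" (is "complexified ?r = complexified ?s")
proof -
  obtain N where N: "\<And>x. card {\<alpha> \<in> D. rng G \<alpha> = x} \<le> N" "\<And>x. card {\<alpha> \<in> D. src G \<alpha> = x} \<le> N"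
    using thin_fibres_bounded[OF D(3)] by blast
  have "cmod (complexified ?r - complexified ?s) \<le> (4 * real N) * \<epsilon>" if e: "0 < \<epsilon>" for \<epsilon>
  proof -
    obtain n :: nat and c W where W: "\<forall>i<n. W i \<in> open_bisections G \<and> W i \<subseteq> D"
      and app: "\<forall>\<alpha>. cmod (k \<alpha> - (\<Sum>i<n. c i * indicator (W i) \<alpha>)) \<le> \<epsilon>"
      using locally_constant_approximation[OF H k(1) K D(1,2) e] by blast
    define l where "l \<alpha> = (\<Sum>i<n. c i * indicator (W i) \<alpha>)" for \<alpha>
    have lb: "l \<in> complex_bounded_on UNIV"
      unfolding l_def[abs_def] by (intro complex_bounded_on_sum complex_bounded_on_scale complex_bounded_on_indicator)
    let ?r' = "\<lambda>x. \<Sum>\<alpha> | \<alpha> \<in> D \<and> rng G \<alpha> = x. l \<alpha>"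
    let ?s' = "\<lambda>x. \<Sum>\<alpha> | \<alpha> \<in> D \<and> src G \<alpha> = x. l \<alpha>"
    have bal: "complexified ?r' = complexified ?s'"
      by (rule complexified_balanced[OF D(3), where I = "{..<n}" and W = W and c = c])
         (use W in \<open>auto simp: l_def\<close>)
    have est: "cmod ((\<Sum>\<alpha>\<in>A. k \<alpha>) - (\<Sum>\<alpha>\<in>A. l \<alpha>)) \<le> N * \<epsilon>" if "card A \<le> N" for A
    proof -
      have "cmod ((\<Sum>\<alpha>\<in>A. k \<alpha>) - (\<Sum>\<alpha>\<in>A. l \<alpha>)) = cmod (\<Sum>\<alpha>\<in>A. k \<alpha> - l \<alpha>)" by (simp add: sum_subtractf)
      also have "\<dots> \<le> card A * \<epsilon>" by (rule sum_norm_bound) (unfold l_def, rule app[rule_format])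
      also have "\<dots> \<le> N * \<epsilon>" using that e by (intro mult_right_mono) auto
      finally show ?thesis .
    qed
    have "cmod (complexified ?r - complexified ?r') \<le> 2 * (N * \<epsilon>)"
      unfolding complexified_diff[OF thin_sum_bounded(1)[OF D(3) k(2)] thin_sum_bounded(1)[OF D(3) lb], symmetric]
      by (rule norm_complexified_le, rule est, rule N)
    moreover have "cmod (complexified ?s - complexified ?s') \<le> 2 * (N * \<epsilon>)"
      unfolding complexified_diff[OF thin_sum_bounded(2)[OF D(3) k(2)] thin_sum_bounded(2)[OF D(3) lb], symmetric]
      by (rule norm_complexified_le, rule est, rule N)
    moreover have "complexified ?r - complexified ?s =
      (complexified ?r - complexified ?r') - (complexified ?s - complexified ?s')"
      using bal by simp
    ultimately show ?thesis
      using norm_triangle_ineq4[of "complexified ?r - complexified ?r'" "complexified ?s - complexified ?s'"]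
      by simp
  qed
  then have "cmod (complexified ?r - complexified ?s) \<le> 0"
    by (intro nonpos_if_le_scaled[of "4 * real N"]) auto
  then show ?thesis by simp
qed

text \<open>For Hausdorff G, passing from an element of the reduced algebra to its diagonal
  coefficients at units is the canonical conditional expectation onto functions on the unit
  space.\<close>

definition diagonal_state :: "(('g \<Rightarrow> complex) \<Rightarrow> 'g \<Rightarrow> complex) \<Rightarrow> complex"
  where "diagonal_state T = complexified (\<lambda>x. T (indicator {x}) x)"

text \<open>Both operators are approximated in norm by convolutions, with errors uniform in the unit
  x. For convolutions the two diagonals are the range and source fibre sums of one continuous
  function that vanishes off a compact set.\<close>

lemma diagonal_state_mult_commute:
  assumes H: "Hausdorff_space (euclidean :: 'g topology)"
    and S: "S \<in> carrier (reduced_cstar_algebra G)" and T: "T \<in> carrier (reduced_cstar_algebra G)"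
  shows "complexified (\<lambda>x. S (T (indicator {x})) x) = complexified (\<lambda>x. T (S (indicator {x})) x)"
proof -
  have bo: "R \<in> bounded_operators"
    and approx: "\<exists>f\<in>compactly_supported_functions. \<forall>\<xi>\<in>l2.
      l2_norm (\<lambda>\<gamma>. R \<xi> \<gamma> - regular_rep G f \<xi> \<gamma>) \<le> \<epsilon> * l2_norm \<xi>"
    if "R \<in> carrier (reduced_cstar_algebra G)" "0 < \<epsilon>" for R \<epsilon>
    using that by (auto simp: reduced_cstar_algebra_def)
  note Sb = bo[OF S zero_less_one] and Tb = bo[OF T zero_less_one]
  obtain C where C: "0 \<le> C" "\<And>\<xi>. \<xi> \<in> l2 \<Longrightarrow> l2_norm (S \<xi>) \<le> C * l2_norm \<xi>"
    using bounded_operators_bound[OF Sb] by blast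
  obtain C' where C': "0 \<le> C'" "\<And>\<xi>. \<xi> \<in> l2 \<Longrightarrow> l2_norm (T \<xi>) \<le> C' * l2_norm \<xi>"
    using bounded_operators_bound[OF Tb] by blast
  \<comment> \<open>B \<epsilon> comes from replacing the inner operator by convolution with g, and
    (B' + 1) \<epsilon> from replacing the outer one by convolution with f on \<open>\<eta>\<close>.
    The bound B' + 1 for the norm of \<open>\<eta>\<close> uses \<epsilon> \<le> 1.\<close>
  have prod: "cmod (R (R' (indicator {x})) x - convolution G f (convolution G g (indicator {x})) x) \<le> (B + B' + 1) * \<epsilon>"
    if R: "R \<in> bounded_operators" "\<And>\<xi>. \<xi> \<in> l2 \<Longrightarrow> l2_norm (R \<xi>) \<le> B * l2_norm \<xi>" "0 \<le> B"
      and R': "R' \<in> bounded_operators" "\<And>\<xi>. \<xi> \<in> l2 \<Longrightarrow> l2_norm (R' \<xi>) \<le> B' * l2_norm \<xi>" "0 \<le> B'"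
      and f: "f \<in> compactly_supported_functions"
        "\<And>\<xi>. \<xi> \<in> l2 \<Longrightarrow> l2_norm (\<lambda>\<gamma>. R \<xi> \<gamma> - regular_rep G f \<xi> \<gamma>) \<le> \<epsilon> * l2_norm \<xi>"
      and g: "g \<in> compactly_supported_functions"
        "\<And>\<xi>. \<xi> \<in> l2 \<Longrightarrow> l2_norm (\<lambda>\<gamma>. R' \<xi> \<gamma> - regular_rep G g \<xi> \<gamma>) \<le> \<epsilon> * l2_norm \<xi>"
      and e: "0 < \<epsilon>" "\<epsilon> \<le> 1"
    for R R' f g B B' \<epsilon> x
  proof -
    let ?d = "indicator {x} :: 'g \<Rightarrow> complex"
    note d = l2_indicator_singleton[of x]
    define \<eta> where "\<eta> = convolution G g ?d"
    have \<eta>: "\<eta> \<in> l2" unfolding \<eta>_def by (rule regular_rep_l2(2)[OF g(1) d(1)])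
    have R'd: "R' ?d \<in> l2" by (rule bounded_operatorsD(1)[OF R'(1) d(1)])
    define \<zeta> where "\<zeta> = (\<lambda>\<gamma>. R' ?d \<gamma> - \<eta> \<gamma>)"
    have \<zeta>: "\<zeta> \<in> l2" unfolding \<zeta>_def by (rule l2_diff[OF R'd \<eta>])
    have "l2_norm \<zeta> \<le> \<epsilon> * l2_norm ?d"
      using g(2)[OF d(1)] unfolding regular_rep_l2(1)[OF g(1) d(1)] \<zeta>_def \<eta>_def .
    also have "\<dots> \<le> \<epsilon>" using mult_left_mono[OF d(2), of \<epsilon>] e by simp
    finally have n\<zeta>: "l2_norm \<zeta> \<le> \<epsilon>" .
    have nR': "l2_norm (R' ?d) \<le> B'" using R'(2)[OF d(1)] mult_left_mono[OF d(2) R'(3)] by simp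
    have "(\<lambda>\<gamma>. R' ?d \<gamma> + (- 1) * \<zeta> \<gamma>) = \<eta>" by (simp add: \<zeta>_def)
    moreover have "l2_norm (\<lambda>\<gamma>. (-1) * \<zeta> \<gamma>) = l2_norm \<zeta>" by (simp add: l2_norm_def)
    ultimately have n\<eta>: "l2_norm \<eta> \<le> B' + 1"
      using l2_add(2)[OF R'd l2_scale[OF \<zeta>, of "-1"]] nR' n\<zeta> e by simp
    have "R (R' ?d) x - R \<eta> x = R \<zeta> x"
      unfolding \<zeta>_def bounded_operators_diff[OF R(1) R'd \<eta>] ..
    then have 1: "cmod (R (R' ?d) x - R \<eta> x) \<le> B * \<epsilon>"
      using cmod_le_l2_norm[OF bounded_operatorsD(1)[OF R(1) \<zeta>], of x] R(2)[OF \<zeta>]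
        mult_left_mono[OF n\<zeta> R(3)] by simp
    have "cmod (R \<eta> x - convolution G f \<eta> x) \<le> l2_norm (\<lambda>\<gamma>. R \<eta> \<gamma> - convolution G f \<eta> \<gamma>)"
      by (rule cmod_le_l2_norm[OF l2_diff[OF bounded_operatorsD(1)[OF R(1) \<eta>] regular_rep_l2(2)[OF f(1) \<eta>]]])
    also have "\<dots> \<le> \<epsilon> * l2_norm \<eta>" using f(2)[OF \<eta>] unfolding regular_rep_l2(1)[OF f(1) \<eta>] .
    also have "\<dots> \<le> \<epsilon> * (B' + 1)" using n\<eta> e by (intro mult_left_mono) auto
    finally have 2: "cmod (R \<eta> x - convolution G f \<eta> x) \<le> \<epsilon> * (B' + 1)" .
    have "cmod (R (R' ?d) x - convolution G f \<eta> x) \<le> B * \<epsilon> + \<epsilon> * (B' + 1)"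
      using norm_triangle_mono[OF 1 2] by simp
    then show ?thesis by (simp add: \<eta>_def algebra_simps)
  qed
  let ?M = "C + C' + 1"
  let ?st = "complexified (\<lambda>x. S (T (indicator {x})) x)" and ?ts = "complexified (\<lambda>x. T (S (indicator {x})) x)"
  have "cmod (?st - ?ts) \<le> (4 * ?M) * \<epsilon>" if e: "0 < \<epsilon>" "\<epsilon> \<le> 1" for \<epsilon>
  proof -
    obtain f where f: "f \<in> compactly_supported_functions"
      "\<And>\<xi>. \<xi> \<in> l2 \<Longrightarrow> l2_norm (\<lambda>\<gamma>. S \<xi> \<gamma> - regular_rep G f \<xi> \<gamma>) \<le> \<epsilon> * l2_norm \<xi>"
      using approx[OF S e(1)] by blast
    obtain g where g: "g \<in> compactly_supported_functions"
      "\<And>\<xi>. \<xi> \<in> l2 \<Longrightarrow> l2_norm (\<lambda>\<gamma>. T \<xi> \<gamma> - regular_rep G g \<xi> \<gamma>) \<le> \<epsilon> * l2_norm \<xi>"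
      using approx[OF T e(1)] by blast
    obtain K D where K: "compact K" "{\<alpha>. f \<alpha> \<noteq> 0} \<subseteq> K" and D: "K \<subseteq> D" "open D" "thin D"
      by (rule compactly_supported_thin[OF f(1)]) (rule that)
    let ?k = "\<lambda>\<alpha>. f \<alpha> * g (ginv G \<alpha>)"
    have kc: "continuous_on UNIV ?k"
    proof (rule continuous_on_mult)
      show "continuous_on UNIV f" using f(1) by (auto simp: compactly_supported_functions_def)
      have "continuous_on UNIV g" using g(1) by (auto simp: compactly_supported_functions_def)
      then show "continuous_on UNIV (\<lambda>\<alpha>. g (ginv G \<alpha>))"
        by (rule continuous_on_compose2[OF _ continuous_on_ginv]) simp
    qed
    have kb: "?k \<in> complex_bounded_on UNIV"
    proof -
      obtain b where b: "\<And>\<alpha>. cmod (f \<alpha>) \<le> b" using compactly_supported_bounded[OF f(1)] by blast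
      obtain c where c: "\<And>\<alpha>. cmod (g \<alpha>) \<le> c" using compactly_supported_bounded[OF g(1)] by blast
      have "0 \<le> b" using b[of undefined] norm_ge_zero order_trans by blast
      then show ?thesis
        by (intro complex_bounded_onI[of _ _ "b * c"]) (simp add: norm_mult mult_mono b c)
    qed
    let ?fg = "\<lambda>x. \<Sum>\<alpha> | \<alpha> \<in> D \<and> rng G \<alpha> = x. ?k \<alpha>"
    let ?gf = "\<lambda>x. \<Sum>\<alpha> | \<alpha> \<in> D \<and> src G \<alpha> = x. ?k \<alpha>"
    have eq: "complexified ?fg = complexified ?gf"
      by (rule complexified_balanced_continuous[OF H kc kb K(1) _ D]) (use K(2) in auto)
    note diag = convolution_diagonal[where g = g, OF D(3) order_trans[OF K(2) D(1)]]
    have ST: "(\<lambda>x. S (T (indicator {x})) x) \<in> complex_bounded_on (units G)"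
      and TS: "(\<lambda>x. T (S (indicator {x})) x) \<in> complex_bounded_on (units G)"
      by (intro bounded_operator_comp_diagonal Sb Tb)+
    have "cmod (?st - complexified ?fg) \<le> 2 * (?M * \<epsilon>)"
      unfolding complexified_diff[OF ST thin_sum_bounded(1)[OF D(3) kb], symmetric]
    proof (rule norm_complexified_le)
      fix x assume x: "x \<in> units G"
      show "cmod (S (T (indicator {x})) x - ?fg x) \<le> ?M * \<epsilon>"
        using prod[OF Sb C(2,1) Tb C'(2,1) f g e, of x] unfolding diag(1)[OF x] .
    qed
    moreover have "cmod (?ts - complexified ?gf) \<le> 2 * (?M * \<epsilon>)"
      unfolding complexified_diff[OF TS thin_sum_bounded(2)[OF D(3) kb], symmetric]
    proof (rule norm_complexified_le)
      fix x assume x: "x \<in> units G"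
      show "cmod (T (S (indicator {x})) x - ?gf x) \<le> ?M * \<epsilon>"
        using prod[OF Tb C'(2,1) Sb C(2,1) g f e, of x] unfolding diag(2)[OF x] by (simp add: add_ac)
    qed
    moreover have "cmod (?st - ?ts) \<le> cmod (?st - complexified ?fg) + cmod (?ts - complexified ?gf)"
      using norm_triangle_ineq4[of "?st - complexified ?fg" "?ts - complexified ?gf"] eq by simp
    ultimately have "cmod (?st - ?ts) \<le> 2 * (?M * \<epsilon>) + 2 * (?M * \<epsilon>)" by linarith
    then show ?thesis by (simp add: algebra_simps)
  qed
  then have "cmod (?st - ?ts) \<le> 0"
    using C(1) C'(1) by (intro nonpos_if_le_scaled[of "4 * ?M"]) auto
  then show ?thesis by simp
qed

text \<open>Positivity holds coefficientwise: composing S with its adjoint gives, at x, the squared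
  norm of S applied to the point mass at x.\<close>

theorem tracial_state_diagonal:
  assumes H: "Hausdorff_space (euclidean :: 'g topology)"
  shows "tracial_state (reduced_cstar_algebra G) diagonal_state"
proof -
  let ?A = "reduced_cstar_algebra G"
  have bo: "S \<in> bounded_operators" if "S \<in> carrier ?A" for S
    using that by (simp add: reduced_cstar_algebra_def)
  have ops: "S \<otimes>\<^bsub>?A\<^esub> T = (\<lambda>\<xi>\<in>l2. S (T \<xi>))" "\<one>\<^bsub>?A\<^esub> = (\<lambda>\<xi>\<in>l2. \<xi>)"
    "S \<oplus>\<^bsub>?A\<^esub> T = (\<lambda>\<xi>\<in>l2. \<lambda>\<gamma>. S \<xi> \<gamma> + T \<xi> \<gamma>)" "c \<odot>\<^bsub>?A\<^esub> T = (\<lambda>\<xi>\<in>l2. \<lambda>\<gamma>. c * T \<xi> \<gamma>)"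
    "star ?A T = adjoint_operator T" for S T c
    by (simp_all add: reduced_cstar_algebra_def)
  note d = l2_indicator_singleton(1)
  show ?thesis
    unfolding tracial_state_def state_def linear_functional_def
  proof (intro conjI ballI allI)
    fix S assume S: "S \<in> carrier ?A"
    note Sb = bo[OF S] and SX = bounded_operator_diagonal[OF bo[OF S], of "units G"]
    show "diagonal_state (c \<odot>\<^bsub>?A\<^esub> S) = c * diagonal_state S" for c
      using complexified_scale[OF SX] by (simp add: diagonal_state_def ops d)
    show "0 \<le> diagonal_state (star ?A S \<otimes>\<^bsub>?A\<^esub> S)"
    proof -
      let ?h = "\<lambda>x. adjoint_operator S (S (indicator {x})) x"
      have h: "0 \<le> ?h x" for x
      proof -
        have Sd: "S (indicator {x}) \<in> l2" by (rule bounded_operatorsD(1)[OF Sb d])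
        have "cnj (?h x) = l2_inner (S (indicator {x})) (S (indicator {x}))"
          unfolding adjoint_operator(2)[OF Sb d Sd] l2_inner_indicator_left ..
        then have "0 \<le> cnj (?h x)" using l2_inner_self_nonneg[OF Sd] by simp
        then show ?thesis by (simp add: less_eq_complex_def)
      qed
      have hb: "?h \<in> complex_bounded_on (units G)"
        by (rule bounded_operator_comp_diagonal[OF adjoint_operator(1)[OF Sb] Sb])
      have "diagonal_state (star ?A S \<otimes>\<^bsub>?A\<^esub> S) = complexified ?h"
        by (simp add: diagonal_state_def ops d)
      also have "\<dots> = complexified (\<lambda>x. of_real (Re (?h x)))"
        using h by (intro complexified_cong[OF hb]) (simp add: complex_eq_iff less_eq_complex_def)
      also have "\<dots> = of_real (\<phi> (\<lambda>x. Re (?h x)))" by (rule complexified_of_real)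
      finally have eq: "diagonal_state (star ?A S \<otimes>\<^bsub>?A\<^esub> S) = of_real (\<phi> (\<lambda>x. Re (?h x)))" .
      have "\<phi> (\<lambda>x. 0) \<le> \<phi> (\<lambda>x. Re (?h x))"
        using h by (intro mono bounded_on_const complex_bounded_on_Re[OF hb]) (simp add: less_eq_complex_def)
      then show ?thesis unfolding eq by (simp add: const less_eq_complex_def)
    qed
    fix T assume T: "T \<in> carrier ?A"
    show "diagonal_state (S \<oplus>\<^bsub>?A\<^esub> T) = diagonal_state S + diagonal_state T"
      using complexified_add[OF SX bounded_operator_diagonal[OF bo[OF T]]]
      by (simp add: diagonal_state_def ops d)
    show "diagonal_state (S \<otimes>\<^bsub>?A\<^esub> T) = diagonal_state (T \<otimes>\<^bsub>?A\<^esub> S)"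
      using diagonal_state_mult_commute[OF H S T] by (simp add: diagonal_state_def ops d)
  next
    show "diagonal_state \<one>\<^bsub>?A\<^esub> = 1"
      using complexified_of_real[of "\<lambda>x. 1"] by (simp add: diagonal_state_def ops d one)
  qed
qed

end

theorem theorem7p12:
  fixes G :: "'g::topological_space groupoid_data"
  assumes "ample_groupoid G"
    and "compact (units G)"
    and "stably_finite (groupoid_algebra G :: ('g \<Rightarrow> 'k::comm_ring_1) ring)"
  shows "(\<exists>\<mu>. invariant_mean G \<mu> \<and> normalized_mean G \<mu>) \<and>
    (\<exists>\<tau>. contractive_trace G \<tau> \<and> normalized (complex_groupoid_algebra G) \<tau>) \<and>
    (Hausdorff_space (euclidean :: 'g topology) \<longrightarrow>
      (\<exists>\<tau>. tracial_state (reduced_cstar_algebra G) \<tau>))"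
proof -
  interpret compact_ample_groupoid G
    using assms by (simp add: compact_ample_groupoid_def compact_ample_groupoid_axioms_def)
  obtain \<phi> where "invariant_functional G \<phi>"
    using exists_open_invariant_functional[OF assms(3)] by blast
  then interpret invariant_functional G \<phi> .
  show ?thesis
    using invariant_mean_functional normalized_mean_functional contractive_trace_complexified
      normalized_complexified tracial_state_diagonal by blast
qed

end
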